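(* Let $R = Y*$ be a pseudo-passive causal operator of slow growth, satisfying the pseudo-passivity condition (a') for some number $N \in \mathbb{N}_0$ and some vectors $\vec{c} = (c_0,\ldots,c_N)$, $\vec{d} = (d_0,\ldots,d_N) \in \mathbb{R}^{N+1}$. Then the Laplace transform $W := \mathcal{L}(Y)$ of its defining distribution $Y$ exists and is a holomorphic function on the right half-plane $\mathbb{C}_+ = \{z \in \mathbb{C} : \mathrm{Re}[z] > 0\}$ satisfying $$\mathrm{Re}[W(s)] \geq \sum_{j=0}^{N} |s|^{2j}\left(c_j + |W(s)|^2 d_j\right) \quad \text{for all } s \in \mathbb{C}_+.$$ Furthermore, if the operator $R$ is assumed to be real, then $W(s) \in \mathbb{R}$ for all $s \in (0,\infty)$.
   Context: Notation. $\mathcal{D} = C_0^\infty(\mathbb{R},\mathbb{C})$ is the space of test functions and $\mathcal{D}'$ the space of distributions on $\mathbb{R}$; $\mathcal{S}'$ is the space of Schwartz (tempered) distributions. $L^1_{\mathrm{loc}} = L^1_{\mathrm{loc}}(\mathbb{R},\mathbb{C})$, and $\iota\colon L^1_{\mathrm{loc}} \hookrightarrow \mathcal{D}'$ is the inclusion $f \mapsto T_f$, $\langle T_f,\varphi\rangle = \int_{\mathbb{R}} f(t)\varphi(t)\,dt$ (no complex conjugation). A convolution operator $R = Y*$ on $\mathcal{D}'$ with defining distribution $Y \in \mathcal{D}'$ is the operator $U \mapsto Y*U$, with the largest possible domain of definition $\mathrm{Dom}(R)$; this domain contains at least all compactly supported distributions. $R$ is called real if it maps real distributions to real distributions, where $U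 \in \mathcal{D}'$ is real if $\langle U,\varphi\rangle \in \mathbb{R}$ for every real-valued test function $\varphi \in \mathcal{D}$. A convolution operator $R = Y*$ is called a pseudo-passive causal operator of slow growth if it satisfies: (a') pseudo-passivity on $\iota(\mathcal{D})$: there exist $N \in \mathbb{N}_0$ and vectors $\vec{c},\vec{d} \in \mathbb{R}^{N+1}$ such that for any $t \in \mathbb{R}$ and any $\varphi \in \mathcal{D}$ it holds that $R(\iota(\varphi)) \in \iota(\mathcal{D})$ and $$\mathrm{Re}\left[\int_{-\infty}^t \overline{\varphi(\tau)}\,\psi(\tau)\,d\tau\right] \geq \sum_{j=0}^{N}\int_{-\infty}^t \left(c_j|\varphi^{(j)}(\tau)|^2 + d_j|\psi^{(j)}(\tau)|^2\right)d\tau,$$ where $\psi := \iota^{-1}(R(\iota(\varphi)))$; if $\vec{d} = \vec{0}$, the requirement $R(\iota(\varphi)) \in \iota(\mathcal{D})$ is weakened to $R(\iota(\varphi)) \in \iota(L^1_{\mathrm{loc}})$; (b) causality: $\mathrm{supp}(Y) \subseteq [0,\infty)$; (c) slow growth: $Y \in \mathcal{S}'$. Laplace transform: if $U \in \mathcal{D}'$ has support bounded on the left and $e^{-c\tau}U \in \mathcal{S}'$ for some $c \in \mathbb{R}$, then for $s \in \mathbb{C}$ with $\mathrm{Re}[s] > c$, $$\mathcal{L}(U)(s) := \langle e^{-c\,\cdot}U,\ \xi \mapsto \rho(\xi)e^{-(s-c)\xi}\rangle,$$ where $\rho$ is any smooth function with support bounded on the left such that $\rho \equiv 1$ on some neighbourhood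 of $\mathrm{supp}(U)$. *)

theory Defs
  imports "HOL-Analysis.Analysis" "HOL-Library.FuncSet"
begin

section \<open>Test functions and Schwartz functions\<close>

primrec partials :: "'a list \<Rightarrow> ('a::euclidean_space \<Rightarrow> complex) \<Rightarrow> 'a \<Rightarrow> complex" where
  "partials [] f = f"
| "partials (b # bs) f = (\<lambda>x. frechet_derivative (partials bs f) (at x) b)"

definition smooth :: "('a::euclidean_space \<Rightarrow> complex) \<Rightarrow> bool" where
  "smooth f \<longleftrightarrow> (\<forall>bs. set bs \<subseteq> Basis \<longrightarrow> (\<forall>x. partials bs f differentiable at x))"

definition fun_supp :: "('a::topological_space \<Rightarrow> complex) \<Rightarrow> 'a set" where
  "fun_supp f = closure {x. f x \<noteq> 0}"

text \<open>The type is kept general because the convolution of distributions on the line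
  needs test functions on the plane.\<close>

definition test_functions :: "('a::euclidean_space \<Rightarrow> complex) set" where
  "test_functions = {\<phi>. smooth \<phi> \<and> compact (fun_supp \<phi>)}"

definition nderiv :: "nat \<Rightarrow> (real \<Rightarrow> complex) \<Rightarrow> real \<Rightarrow> complex" where
  "nderiv k f = ((\<lambda>g x. vector_derivative g (at x)) ^^ k) f"

definition schwartz_functions :: "(real \<Rightarrow> complex) set" where
  "schwartz_functions =
     {\<phi>. smooth \<phi> \<and> (\<forall>j k. bounded (range (\<lambda>x. of_real (x ^ j) * nderiv k \<phi> x)))}"


section \<open>Distributions\<close>

text \<open>A distribution is a functional that is \<open>undefined\<close> outside its space of test
  functions (\<open>extensional\<close>), so that equality of distributions is equality in HOL.
  Continuity is expressed by the usual seminorm estimates.\<close>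

type_synonym functional = "(real \<Rightarrow> complex) \<Rightarrow> complex"

definition linear_functional_on :: "(real \<Rightarrow> complex) set \<Rightarrow> functional \<Rightarrow> bool" where
  "linear_functional_on V T \<longleftrightarrow>
     (\<forall>\<phi>\<in>V. \<forall>\<psi>\<in>V. T (\<lambda>x. \<phi> x + \<psi> x) = T \<phi> + T \<psi>) \<and>
     (\<forall>a. \<forall>\<phi>\<in>V. T (\<lambda>x. a * \<phi> x) = a * T \<phi>)"

definition distributions :: "functional set" where
  "distributions =
     {T. T \<in> extensional test_functions \<and> linear_functional_on test_functions T \<and>
         (\<forall>K. compact K \<longrightarrow> (\<exists>C m. \<forall>\<phi>\<in>test_functions. fun_supp \<phi> \<subseteq> K \<longrightarrow>
            norm (T \<phi>) \<le> C * (\<Sum>k\<le>m. SUP x. norm (nderiv k \<phi> x))))}"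

definition tempered_functionals :: "functional set" where
  "tempered_functionals =
     {V. V \<in> extensional schwartz_functions \<and> linear_functional_on schwartz_functions V \<and>
         (\<exists>C m. \<forall>\<phi>\<in>schwartz_functions.
            norm (V \<phi>) \<le> C * (\<Sum>j\<le>m. \<Sum>k\<le>m. SUP x. \<bar>x\<bar> ^ j * norm (nderiv k \<phi> x)))}"

text \<open>Membership of a distribution in the space of tempered distributions, and its
  (unique) extension to the Schwartz functions.\<close>

definition tempered :: "functional \<Rightarrow> bool" where
  "tempered T \<longleftrightarrow> (\<exists>V\<in>tempered_functionals. restrict V test_functions = T)"

definition tempered_extension :: "functional \<Rightarrow> functional" where
  "tempered_extension T = (THE V. V \<in> tempered_functionals \<and> restrict V test_functions = T)"

definition L1_loc :: "(real \<Rightarrow> complex) set" where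
  "L1_loc = {f. \<forall>K. compact K \<longrightarrow> set_integrable lborel K f}"

definition dist_of_fun :: "(real \<Rightarrow> complex) \<Rightarrow> functional" where
  "dist_of_fun f = (\<lambda>\<phi>\<in>test_functions. \<integral>t. f t * \<phi> t \<partial>lborel)"

definition dist_supp :: "functional \<Rightarrow> real set" where
  "dist_supp T =
     - \<Union>{G. open G \<and> (\<forall>\<phi>\<in>test_functions. fun_supp \<phi> \<subseteq> G \<longrightarrow> T \<phi> = 0)}"

definition real_distribution :: "functional \<Rightarrow> bool" where
  "real_distribution T \<longleftrightarrow> (\<forall>\<phi>\<in>test_functions. (\<forall>x. \<phi> x \<in> \<real>) \<longrightarrow> T \<phi> \<in> \<real>)"

definition mult_dist :: "(real \<Rightarrow> complex) \<Rightarrow> functional \<Rightarrow> functional" where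
  "mult_dist a T = (\<lambda>\<phi>\<in>test_functions. T (\<lambda>x. a x * \<phi> x))"


section \<open>Convolution\<close>

text \<open>The convolution of two arbitrary distributions in the sense of Vladimirov:
  \<open>Y * U\<close> is defined if, for every test function \<open>\<phi>\<close>, the numbers
  \<open>\<langle>Y(x) \<otimes> U(y), \<eta>\<^sub>k(x,y) \<phi>(x+y)\<rangle>\<close> converge along every sequence of
  cut-offs \<open>\<eta>\<^sub>k\<close> tending to \<open>1\<close> on the plane, the limit being independent of the sequence.\<close>

definition tends_to_one :: "(nat \<Rightarrow> real \<times> real \<Rightarrow> complex) \<Rightarrow> bool" where
  "tends_to_one \<eta> \<longleftrightarrow>
     (\<forall>k. \<eta> k \<in> test_functions) \<and>
     (\<forall>K. compact K \<longrightarrow> (\<forall>\<^sub>F k in sequentially. \<forall>p\<in>K. \<eta> k p = 1)) \<and>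
     (\<forall>bs. set bs \<subseteq> Basis \<longrightarrow> (\<exists>C. \<forall>k p. norm (partials bs (\<eta> k) p) \<le> C))"

definition tensor :: "functional \<Rightarrow> functional \<Rightarrow> (real \<times> real \<Rightarrow> complex) \<Rightarrow> complex" where
  "tensor Y U \<Phi> = Y (\<lambda>x. U (\<lambda>y. \<Phi> (x, y)))"

definition conv_limit :: "functional \<Rightarrow> functional \<Rightarrow> (real \<Rightarrow> complex) \<Rightarrow> complex \<Rightarrow> bool" where
  "conv_limit Y U \<phi> l \<longleftrightarrow>
     (\<forall>\<eta>. tends_to_one \<eta> \<longrightarrow>
        (\<lambda>k. tensor Y U (\<lambda>(x, y). \<eta> k (x, y) * \<phi> (x + y))) \<longlonglongrightarrow> l)"

definition conv_domain :: "functional \<Rightarrow> functional set" where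
  "conv_domain Y = {U \<in> distributions. \<forall>\<phi>\<in>test_functions. \<exists>l. conv_limit Y U \<phi> l}"

definition conv :: "functional \<Rightarrow> functional \<Rightarrow> functional" where
  "conv Y U = (\<lambda>\<phi>\<in>test_functions. THE l. conv_limit Y U \<phi> l)"


section \<open>Convolution operators\<close>

text \<open>The convolution operator \<open>R = Y*\<close> is represented by its defining distribution \<open>Y\<close>;
  it acts as \<open>conv Y\<close> on \<open>conv_domain Y\<close>. A vector with the \<open>N + 1\<close> entries
  \<open>c\<^sub>0, \<dots>, c\<^sub>N\<close> is a function of which only the values on \<open>{..N}\<close> are used.\<close>

definition real_operator :: "functional \<Rightarrow> bool" where
  "real_operator Y \<longleftrightarrow>
     (\<forall>U\<in>conv_domain Y. real_distribution U \<longrightarrow> real_distribution (conv Y U))"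

text \<open>If \<open>d = 0\<close>, the output \<open>\<psi>\<close> is only locally integrable; the terms involving
  \<open>nderiv j \<psi>\<close> then carry the factor \<open>0\<close>, so that the same inequality can be used.\<close>

definition pseudo_passivity :: "functional \<Rightarrow> nat \<Rightarrow> (nat \<Rightarrow> real) \<Rightarrow> (nat \<Rightarrow> real) \<Rightarrow> bool" where
  "pseudo_passivity Y N c d \<longleftrightarrow>
     (\<forall>\<phi>\<in>test_functions.
        \<exists>\<psi>\<in>(if \<forall>j\<le>N. d j = 0 then L1_loc else test_functions).
          conv Y (dist_of_fun \<phi>) = dist_of_fun \<psi> \<and>
          (\<forall>t. Re (LINT \<tau>:{..t}|lborel. cnj (\<phi> \<tau>) * \<psi> \<tau>) \<ge>
               (\<Sum>j\<le>N. LINT \<tau>:{..t}|lborel.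
                  c j * (norm (nderiv j \<phi> \<tau>))\<^sup>2 + d j * (norm (nderiv j \<psi> \<tau>))\<^sup>2)))"

definition pseudo_passive_causal_slow_growth :: "functional \<Rightarrow> bool" where
  "pseudo_passive_causal_slow_growth Y \<longleftrightarrow>
     Y \<in> distributions \<and>
     (\<exists>N c d. pseudo_passivity Y N c d) \<and>
     dist_supp Y \<subseteq> {0..} \<and>
     tempered Y"


section \<open>Laplace transform\<close>

definition laplace_abscissa :: "functional \<Rightarrow> real \<Rightarrow> bool" where
  "laplace_abscissa U c \<longleftrightarrow> tempered (mult_dist (\<lambda>\<tau>. of_real (exp (- c * \<tau>))) U)"

definition laplace_exists :: "functional \<Rightarrow> complex \<Rightarrow> bool" where
  "laplace_exists U s \<longleftrightarrow> bdd_below (dist_supp U) \<and> (\<exists>c. laplace_abscissa U c \<and> c < Re s)"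

definition left_cutoff :: "functional \<Rightarrow> (real \<Rightarrow> complex) \<Rightarrow> bool" where
  "left_cutoff U \<rho> \<longleftrightarrow>
     smooth \<rho> \<and> bdd_below (fun_supp \<rho>) \<and>
     (\<exists>G. open G \<and> dist_supp U \<subseteq> G \<and> (\<forall>x\<in>G. \<rho> x = 1))"

text \<open>The value is independent of the choice of \<open>c\<close> and \<open>\<rho>\<close>. Membership in
  \<open>schwartz_functions\<close> has to be required: a cut-off \<open>\<rho>\<close> is unrestricted away from the
  support of \<open>U\<close> and could grow arbitrarily fast there, in which case the pairing with a
  tempered distribution makes no sense.\<close>

definition laplace :: "functional \<Rightarrow> complex \<Rightarrow> complex" where
  "laplace U s =
     (THE w. \<exists>c \<rho>. laplace_abscissa U c \<and> c < Re s \<and> left_cutoff U \<rho> \<and>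
        (\<lambda>\<xi>. \<rho> \<xi> * exp (- (s - of_real c) * of_real \<xi>)) \<in> schwartz_functions \<and>
        w = tempered_extension (mult_dist (\<lambda>\<tau>. of_real (exp (- c * \<tau>))) U)
              (\<lambda>\<xi>. \<rho> \<xi> * exp (- (s - of_real c) * of_real \<xi>)))"

end

theory Submission
  imports Defs
begin

text \<open>
  Let \<open>V\<close> extend \<open>Y\<close> to the Schwartz functions. Since \<open>supp Y \<subseteq> [0, \<infinity>)\<close>, \<open>Y\<close> pairs with every smooth
  function whose derivatives decay rapidly on a right half-line, and this pairing \<open>L\<close> is bounded
  by finitely many weighted sup-norms on \<open>[-2, \<infinity>)\<close>. Then \<open>W(s) = L(e\<^sup>-\<^sup>s\<^sup>x)\<close>, which is holomorphic
  because the Taylor remainder of \<open>e\<^sup>-\<^sup>s\<^sup>x\<close> in \<open>s\<close> is quadratically small in these norms, and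
  \<open>Y * \<phi>\<close> is the smooth function \<open>t \<mapsto> L(\<phi>(t - \<cdot>))\<close>.

  The inequality comes from testing passivity up to time \<open>t = 0\<close> with \<open>e\<^sup>s\<^sup>\<tau>\<close> cut off at \<open>-n\<close> and at \<open>4\<close>.
  By causality the upper cut-off is not felt at times \<open>\<tau> \<le> 0\<close>, where the output and its derivatives
  converge to \<open>s\<^sup>j e\<^sup>s\<^sup>\<tau> W(s)\<close>, dominated by a multiple of \<open>exp (Re s \<tau>)\<close>; both sides of the limiting
  inequality carry the factor \<open>\<integral>\<^bsub>-\<infinity>\<^esub>\<^bsup>0\<^esup> exp (2 Re s \<tau>) d\<tau> > 0\<close>. If \<open>R\<close> is real, \<open>L\<close> is real on real test functions,
  hence so is its limit \<open>W(x)\<close> for \<open>x > 0\<close>.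
\<close>

subsection \<open>Smooth functions on the line\<close>

text \<open>Three obstacles shape the proof. The pairing must accept \<open>exp (- s * x)\<close>,
  which blows up at minus infinity: hence the fixed cut-off \<open>left_step\<close> with its
  transition over \<open>[-2, -1]\<close>, invisible to \<open>Y\<close>, and estimates on
  \<open>x \<ge> -2\<close> only. Limits and derivatives must pass through a functional controlled
  only by finitely many seminorms. The cut-offs \<open>cut\<close>, whose ends move to infinity,
  therefore have transition layers of fixed width, so that their derivatives are bounded
  independently of position; one spare power of \<open>1 + |x|\<close> then turns boundedness into
  convergence. Derivatives in a parameter all come from one quadratic remainder criterion,
  \<open>pairing_has_derivative\<close>, used for the complex frequency, for translations, and for
  the upper limit of an integral. Finally, passivity integrates up to a sharp time and may give an
  output that is only locally integrable, whereas the convolution is known only against smooth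
  tests. Steep smooth cut-offs bridge this gap; the output is identified pointwise only when some
  \<open>d j\<close> is nonzero.\<close>

lemma nderiv_0 [simp]: "nderiv 0 f = f"
  by (simp add: nderiv_def)

lemma nderiv_Suc: "nderiv (Suc k) f = (\<lambda>x. vector_derivative (nderiv k f) (at x))"
  by (simp add: nderiv_def)

text \<open>The line has \<open>1\<close> as its only basis vector, so \<open>partials bs f\<close>
  depends on the length of \<open>bs\<close> alone. Guessing all derivatives and checking one
  differentiation rule then gives smoothness and the formula for \<open>nderiv\<close> together;
  most closure properties below are instances.\<close>

lemma smooth_tower:
  assumes "D 0 = f" and "\<And>k x. (D k has_vector_derivative D (Suc k) x) (at x)"
  shows smooth_towerI: "smooth f" and nderiv_tower: "nderiv k f = D k"
proof -
  show nd: "nderiv k f = D k" for k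
  proof (induction k)
    case (Suc k)
    then show ?case using vector_derivative_at[OF assms(2)] by (simp add: nderiv_Suc)
  qed (simp add: assms)
  have "partials bs f = D (length bs)" if "set bs \<subseteq> Basis" for bs
    using that
  proof (induction bs)
    case (Cons b bs)
    have "frechet_derivative (D (length bs)) (at x) 1 = D (Suc (length bs)) x" for x
      using fun_cong[OF frechet_derivative_at[OF assms(2)[of "length bs" x, unfolded has_vector_derivative_def]], of 1]
      by simp
    then show ?case using Cons by auto
  qed (use assms in auto)
  then show "smooth f"
    unfolding smooth_def using differentiableI_vector[OF assms(2)] by simp
qed

text \<open>Converse of \<open>smooth_tower\<close>: the Frechet-style notion \<open>smooth\<close>
  becomes usable by specialising the list of directions to \<open>replicate k 1\<close>.\<close>

lemma smooth_nderiv: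
  assumes "smooth f"
  shows "(nderiv k f has_vector_derivative nderiv (Suc k) f x) (at x within S)"
proof -
  have "partials (replicate k 1) f = nderiv k f \<and> (\<forall>x. nderiv k f differentiable at x)" for k
  proof (induction k)
    case 0
    show ?case using assms unfolding smooth_def by (auto dest!: spec[of _ "[]"])
  next
    case (Suc k)
    have "frechet_derivative (nderiv k f) (at x) 1 = vector_derivative (nderiv k f) (at x)" for x
    proof -
      have "(nderiv k f has_vector_derivative vector_derivative (nderiv k f) (at x)) (at x)"
        using Suc vector_derivative_works by blast
      from fun_cong[OF frechet_derivative_at[OF this[unfolded has_vector_derivative_def]], of 1] show ?thesis
        by simp
    qed
    then have "partials (replicate (Suc k) 1) f = nderiv (Suc k) f"
      using Suc by (simp add: nderiv_Suc)
    moreover have "partials (replicate (Suc k) 1) f differentiable at x" for x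
      using assms unfolding smooth_def by (auto dest!: spec[of _ "replicate (Suc k) 1"])
    ultimately show ?case by simp
  qed
  then have "(nderiv k f has_vector_derivative nderiv (Suc k) f x) (at x)"
    using vector_derivative_works unfolding nderiv_Suc by blast
  then show ?thesis
    by (rule has_vector_derivative_at_within)
qed

lemma smooth_continuous_nderiv:
  fixes f :: "real \<Rightarrow> complex"
  shows "smooth f \<Longrightarrow> continuous_on S (nderiv k f)"
  unfolding continuous_on_eq_continuous_within
  by (intro ballI has_vector_derivative_continuous[OF smooth_nderiv])

lemma smooth_continuous:
  fixes f :: "real \<Rightarrow> complex"
  shows "smooth f \<Longrightarrow> continuous_on S f"
  using smooth_continuous_nderiv[of f S 0] by simp

lemma nderiv_add_index: "nderiv k (nderiv j f) = nderiv (k + j) f"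
  by (simp add: nderiv_def funpow_add)

lemma smooth_nderiv_smooth:
  assumes "smooth f" shows "smooth (nderiv j f)"
  by (rule smooth_towerI[where D = "\<lambda>k. nderiv (k + j) f"]) (use smooth_nderiv[OF assms] in auto)

lemma
  assumes "smooth f" "smooth g"
  shows smooth_add: "smooth (\<lambda>x. f x + g x)"
    and nderiv_add: "nderiv k (\<lambda>x. f x + g x) = (\<lambda>x. nderiv k f x + nderiv k g x)"
proof -
  have "((\<lambda>x. nderiv k f x + nderiv k g x) has_vector_derivative nderiv (Suc k) f x + nderiv (Suc k) g x) (at x)" for k x
    by (intro has_vector_derivative_add smooth_nderiv assms)
  note * = smooth_tower[where D="\<lambda>k x. nderiv k f x + nderiv k g x", OF _ this]
  show "smooth (\<lambda>x. f x + g x)" by (rule *) simp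
  show "nderiv k (\<lambda>x. f x + g x) = (\<lambda>x. nderiv k f x + nderiv k g x)" by (rule *) simp
qed

lemma
  assumes "smooth f"
  shows smooth_cmult: "smooth (\<lambda>x. a * f x)"
    and nderiv_cmult: "nderiv k (\<lambda>x. a * f x) = (\<lambda>x. a * nderiv k f x)"
proof -
  have "((\<lambda>x. a * nderiv k f x) has_vector_derivative a * nderiv (Suc k) f x) (at x)" for k x
    by (intro has_vector_derivative_mult_right smooth_nderiv assms)
  note * = smooth_tower[where D="\<lambda>k x. a * nderiv k f x", OF _ this]
  show "smooth (\<lambda>x. a * f x)" by (rule *) simp
  show "nderiv k (\<lambda>x. a * f x) = (\<lambda>x. a * nderiv k f x)" by (rule *) simp
qed

lemma
  assumes "smooth f" "smooth g"
  shows smooth_diff: "smooth (\<lambda>x. f x - g x)"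
    and nderiv_diff: "nderiv k (\<lambda>x. f x - g x) = (\<lambda>x. nderiv k f x - nderiv k g x)"
  using smooth_add[OF assms(1) smooth_cmult[OF assms(2), of "-1"]]
    nderiv_add[OF assms(1) smooth_cmult[OF assms(2), of "-1"], of k]
    nderiv_cmult[OF assms(2), of k "-1"] by simp_all

lemma smooth_const [simp]: "smooth (\<lambda>x::real. a)"
  by (rule smooth_towerI[where D="\<lambda>k x. if k = 0 then a else 0"]) auto

lemma smooth_cnj:
  fixes f :: "real \<Rightarrow> complex"
  assumes "smooth f"
  shows "smooth (\<lambda>x. cnj (f x))"
proof (rule smooth_towerI[where D = "\<lambda>k x. cnj (nderiv k f x)"])
  show "((\<lambda>x. cnj (nderiv k f x)) has_vector_derivative cnj (nderiv (Suc k) f x)) (at x)" for k x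
    by (intro has_vector_derivative_cnj smooth_nderiv assms)
qed simp

lemma
  assumes "smooth f"
  shows smooth_affine: "smooth (\<lambda>x. f (a * x + b))"
    and nderiv_affine: "nderiv k (\<lambda>x. f (a * x + b)) = (\<lambda>x. of_real (a ^ k) * nderiv k f (a * x + b))"
proof -
  have "((\<lambda>x. of_real (a ^ k) * nderiv k f (a * x + b)) has_vector_derivative
      of_real (a ^ Suc k) * nderiv (Suc k) f (a * x + b)) (at x)" for k x
  proof -
    have "((\<lambda>x. a * x + b) has_vector_derivative a) (at x)"
      by (auto intro!: derivative_eq_intros)
    from vector_diff_chain_at[OF this smooth_nderiv[OF assms, of k]]
    have "((\<lambda>x. nderiv k f (a * x + b)) has_vector_derivative a *\<^sub>R nderiv (Suc k) f (a * x + b)) (at x)"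
      by (simp add: o_def)
    from has_vector_derivative_mult_right[OF this, of "of_real (a ^ k)"]
    show ?thesis by (simp add: scaleR_conv_of_real mult_ac)
  qed
  note * = smooth_tower[where D="\<lambda>k x. of_real (a ^ k) * nderiv k f (a * x + b)", OF _ this]
  show "smooth (\<lambda>x. f (a * x + b))" by (rule *) simp
  show "nderiv k (\<lambda>x. f (a * x + b)) = (\<lambda>x. of_real (a ^ k) * nderiv k f (a * x + b))" by (rule *) simp
qed

lemma smooth_shift: "smooth f \<Longrightarrow> smooth (\<lambda>x. f (x + b))"
  and nderiv_shift: "smooth f \<Longrightarrow> nderiv k (\<lambda>x. f (x + b)) = (\<lambda>x. nderiv k f (x + b))"
  using smooth_affine[of f 1 b] nderiv_affine[of f k 1 b] by simp_all

lemma smooth_reflect: "smooth f \<Longrightarrow> smooth (\<lambda>x. f (b - x))"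
  and nderiv_reflect: "smooth f \<Longrightarrow> nderiv k (\<lambda>x. f (b - x)) = (\<lambda>x. (- 1) ^ k * nderiv k f (b - x))"
  using smooth_affine[of f "-1" b] nderiv_affine[of f k "-1" b] by simp_all

lemma
  assumes f: "smooth f" and g: "smooth g"
  shows smooth_mult: "smooth (\<lambda>x. f x * g x)"
    and nderiv_mult: "nderiv k (\<lambda>x. f x * g x) =
      (\<lambda>x. \<Sum>i\<le>k. of_nat (k choose i) * nderiv i f x * nderiv (k - i) g x)"
proof -
  let ?D = "\<lambda>k x. \<Sum>i\<le>k. of_nat (k choose i) * nderiv i f x * nderiv (k - i) g x"
  have "(?D k has_vector_derivative ?D (Suc k) x) (at x)" for k x
  proof -
    let ?t = "\<lambda>i j. nderiv i f x * nderiv j g x"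
    have "(?D k has_vector_derivative (\<Sum>i\<le>k. of_nat (k choose i) *
        (?t i (Suc (k - i)) + ?t (Suc i) (k - i)))) (at x)"
      unfolding mult.assoc
      by (intro has_vector_derivative_sum has_vector_derivative_mult_right has_vector_derivative_mult smooth_nderiv f g)
    also have "(\<Sum>i\<le>k. of_nat (k choose i) * (?t i (Suc (k - i)) + ?t (Suc i) (k - i)))
      = (\<Sum>i\<le>k. of_nat (k choose i) * ?t i (Suc k - i)) + (\<Sum>i\<le>k. of_nat (k choose i) * ?t (Suc i) (Suc k - Suc i))"
      by (simp add: sum.distrib[symmetric] ring_distribs Suc_diff_le)
    \<comment> \<open>The added summand is zero because \<open>k choose Suc k = 0\<close>; splitting
      off index \<open>0\<close> then aligns both sums for Pascal's rule.\<close>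
    also have "(\<Sum>i\<le>k. of_nat (k choose i) * ?t i (Suc k - i)) = (\<Sum>i\<le>Suc k. of_nat (k choose i) * ?t i (Suc k - i))"
      by simp
    also have "\<dots> = ?t 0 (Suc k) + (\<Sum>i\<le>k. of_nat (k choose Suc i) * ?t (Suc i) (Suc k - Suc i))"
      by (subst sum.atMost_Suc_shift) simp
    also have "\<dots> + (\<Sum>i\<le>k. of_nat (k choose i) * ?t (Suc i) (Suc k - Suc i)) =
      ?t 0 (Suc k) + (\<Sum>i\<le>k. of_nat (Suc k choose Suc i) * ?t (Suc i) (Suc k - Suc i))"
      by (simp add: sum.distrib[symmetric] ring_distribs add_ac)
    also have "\<dots> = ?D (Suc k) x"
      by (subst sum.atMost_Suc_shift) (simp add: mult_ac)
    finally show ?thesis .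
  qed
  note * = smooth_tower[where D="?D", OF _ this]
  show "smooth (\<lambda>x. f x * g x)" by (rule *) simp
  show "nderiv k (\<lambda>x. f x * g x) = ?D k" by (rule *) simp
qed

lemma
  shows smooth_exp: "smooth (\<lambda>x. exp (z * of_real x))"
    and nderiv_exp: "nderiv k (\<lambda>x. exp (z * of_real x)) = (\<lambda>x. z ^ k * exp (z * of_real x))"
proof -
  have "((\<lambda>x. z ^ k * exp (z * of_real x)) has_vector_derivative z ^ Suc k * exp (z * of_real x)) (at x)" for k and x :: real
  proof -
    have "((\<lambda>w. z ^ k * exp (z * w)) has_field_derivative z ^ Suc k * exp (z * of_real x)) (at (of_real x))"
      by (auto intro!: derivative_eq_intros)
    then show ?thesis
      by (rule has_vector_derivative_real_field)
  qed
  note * = smooth_tower[where D="\<lambda>k x. z ^ k * exp (z * of_real x)", OF _ this]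
  show "smooth (\<lambda>x. exp (z * of_real x))" by (rule *) simp
  show "nderiv k (\<lambda>x. exp (z * of_real x)) = (\<lambda>x. z ^ k * exp (z * of_real x))" by (rule *) simp
qed

text \<open>Derivatives are local. This is how a truncated function is compared with the original
  where the cut-off is constant.\<close>

lemma nderiv_cong_open:
  assumes "smooth f" "smooth g" "open S" "\<And>x. x \<in> S \<Longrightarrow> f x = g x" "x \<in> S"
  shows "nderiv k f x = nderiv k g x"
  using assms(5)
proof (induction k arbitrary: x)
  case (Suc k)
  have "(nderiv k g has_vector_derivative nderiv (Suc k) f x) (at x)"
    using has_vector_derivative_transform_within_open[OF smooth_nderiv[OF assms(1)] assms(3) Suc(2)] Suc(1)
    by blast
  then show ?case
    using smooth_nderiv[OF assms(2)] vector_derivative_unique_at by blast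
qed (use assms in auto)

lemma nderiv_zero: "nderiv k (\<lambda>x. 0) = (\<lambda>x. 0)"
  by (rule nderiv_tower[where D = "\<lambda>k x. 0"]) auto

lemma nderiv_outside_supp:
  assumes "smooth f" "x \<notin> fun_supp f"
  shows "nderiv k f x = 0"
proof -
  have "nderiv k f x = nderiv k (\<lambda>x. 0) x"
    using assms(2)
    by (intro nderiv_cong_open[where S = "- fun_supp f"] assms smooth_const)
      (auto simp: fun_supp_def intro: closure_subset[THEN subsetD])
  then show ?thesis by (simp add: nderiv_zero)
qed

subsection \<open>Test functions\<close>

lemma test_smooth: "f \<in> test_functions \<Longrightarrow> smooth f"
  by (simp add: test_functions_def)

lemma test_functionI:
  fixes f :: "real \<Rightarrow> complex"
  assumes "smooth f" "\<And>x. f x \<noteq> 0 \<Longrightarrow> a \<le> x \<and> x \<le> b"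
  shows "f \<in> test_functions"
proof -
  have "fun_supp f \<subseteq> {a..b}"
    unfolding fun_supp_def by (rule closure_minimal) (use assms in auto)
  then have "compact (fun_supp f)"
    using compact_Int_closed[OF compact_Icc[of a b], of "fun_supp f"]
    by (simp add: fun_supp_def inf.absorb2)
  then show ?thesis using assms by (simp add: test_functions_def)
qed

lemma test_functionI_abs:
  fixes f :: "real \<Rightarrow> complex"
  assumes "smooth f" "\<And>x. \<bar>x\<bar> \<ge> M \<Longrightarrow> f x = 0"
  shows "f \<in> test_functions"
proof (rule test_functionI[of _ "- M" M])
  show "- M \<le> x \<and> x \<le> M" if "f x \<noteq> 0" for x
    using assms(2)[of x] that by linarith
qed (rule assms)

lemma test_function_bounds:
  fixes f :: "real \<Rightarrow> complex"
  assumes "f \<in> test_functions"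
  obtains M where "M > 0" "\<forall>k x. \<bar>x\<bar> \<ge> M \<longrightarrow> nderiv k f x = 0"
proof -
  obtain M where M: "M > 0" "\<And>x. x \<in> fun_supp f \<Longrightarrow> \<bar>x\<bar> \<le> M"
    using assms by (auto simp: test_functions_def dest!: compact_imp_bounded simp: bounded_pos)
  show ?thesis
  proof (rule that[of "M + 1"], safe)
    show "nderiv k f x = 0" if "\<bar>x\<bar> \<ge> M + 1" for k x
    proof (rule nderiv_outside_supp[OF test_smooth[OF assms]])
      show "x \<notin> fun_supp f" using M(2)[of x] that by linarith
    qed
  qed (use M in auto)
qed

lemma nderiv_test:
  assumes "f \<in> test_functions" shows "nderiv k f \<in> test_functions"
proof -
  obtain M where M: "M > 0" "\<forall>k x. \<bar>x\<bar> \<ge> M \<longrightarrow> nderiv k f x = 0"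
    by (rule test_function_bounds[OF assms])
  show ?thesis
    using M(2)[rule_format] by (rule test_functionI_abs[OF smooth_nderiv_smooth[OF test_smooth[OF assms]]])
qed

lemma test_mult:
  fixes f g :: "real \<Rightarrow> complex"
  assumes "f \<in> test_functions" "smooth g" shows "(\<lambda>x. f x * g x) \<in> test_functions"
proof -
  obtain M where M: "M > 0" "\<forall>k x. \<bar>x\<bar> \<ge> M \<longrightarrow> nderiv k f x = 0"
    by (rule test_function_bounds[OF assms(1)])
  show ?thesis
    using M(2)[rule_format, of _ 0] by (intro test_functionI_abs[OF smooth_mult[OF test_smooth[OF assms(1)] assms(2)], of M]) simp
qed

lemma test_mult_left:
  fixes f g :: "real \<Rightarrow> complex"
  assumes "f \<in> test_functions" "smooth g" shows "(\<lambda>x. g x * f x) \<in> test_functions"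
  using test_mult[OF assms] by (simp add: mult.commute)

lemma test_cnj:
  fixes f :: "real \<Rightarrow> complex"
  assumes "f \<in> test_functions" shows "(\<lambda>x. cnj (f x)) \<in> test_functions"
proof -
  obtain M where M: "M > 0" "\<forall>k x. \<bar>x\<bar> \<ge> M \<longrightarrow> nderiv k f x = 0"
    by (rule test_function_bounds[OF assms])
  show ?thesis
    using M(2)[rule_format, of _ 0] by (intro test_functionI_abs[OF smooth_cnj[OF test_smooth[OF assms]], of M]) simp
qed

lemma test_add:
  fixes f g :: "real \<Rightarrow> complex"
  assumes "f \<in> test_functions" "g \<in> test_functions" shows "(\<lambda>x. f x + g x) \<in> test_functions"
proof -
  obtain M where M: "M > 0" "\<forall>k x. \<bar>x\<bar> \<ge> M \<longrightarrow> nderiv k f x = 0"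
    by (rule test_function_bounds[OF assms(1)])
  obtain M' where M': "M' > 0" "\<forall>k x. \<bar>x\<bar> \<ge> M' \<longrightarrow> nderiv k g x = 0"
    by (rule test_function_bounds[OF assms(2)])
  show ?thesis
    using M(2)[rule_format, of _ 0] M'(2)[rule_format, of _ 0]
    by (intro test_functionI_abs[OF smooth_add[OF test_smooth[OF assms(1)] test_smooth[OF assms(2)]], of "max M M'"]) simp
qed

lemma test_cmult:
  fixes f :: "real \<Rightarrow> complex"
  shows "f \<in> test_functions \<Longrightarrow> (\<lambda>x. a * f x) \<in> test_functions"
  by (simp add: test_mult_left)

lemma test_reflect:
  fixes f :: "real \<Rightarrow> complex"
  assumes "f \<in> test_functions" shows "(\<lambda>x. f (b - x)) \<in> test_functions"
proof -
  obtain M where M: "M > 0" "\<forall>k x. \<bar>x\<bar> \<ge> M \<longrightarrow> nderiv k f x = 0"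
    by (rule test_function_bounds[OF assms(1)])
  show ?thesis
    using M(2)[rule_format, of _ 0]
    by (intro test_functionI_abs[OF smooth_reflect[OF test_smooth[OF assms]], of "M + \<bar>b\<bar>"]) simp
qed

lemma test_function_nderiv_bounded:
  fixes f :: "real \<Rightarrow> complex"
  assumes "f \<in> test_functions"
  obtains B where "B > 0" "\<forall>x. norm (nderiv k f x) \<le> B"
proof -
  obtain M where M: "M > 0" "\<forall>k x. \<bar>x\<bar> \<ge> M \<longrightarrow> nderiv k f x = 0"
    by (rule test_function_bounds[OF assms(1)])
  have "bounded (nderiv k f ` {-M..M})"
    by (intro compact_imp_bounded compact_continuous_image smooth_continuous_nderiv test_smooth assms) auto
  then obtain B where B: "B > 0" "\<And>x. x \<in> {-M..M} \<Longrightarrow> norm (nderiv k f x) \<le> B"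
    by (auto simp: bounded_pos)
  have "norm (nderiv k f x) \<le> B" for x
  proof (cases "\<bar>x\<bar> \<ge> M")
    case False
    then have "x \<in> {-M..M}" by simp linarith
    then show ?thesis by (rule B(2))
  qed (use M B in auto)
  with B(1) show ?thesis using that by blast
qed

subsection \<open>A smooth step and partitions of unity\<close>

lemma nderiv_const: "nderiv k (\<lambda>x. a) = (\<lambda>x. if k = 0 then a else 0)"
  by (rule nderiv_tower[where D = "\<lambda>k x. if k = 0 then a else 0"]) auto

text \<open>The numerator of the \<open>k\<close>-th derivative of \<open>1 / f\<close> over the denominator \<open>f ^ (k + 1)\<close>.\<close>

primrec recip_num :: "(real \<Rightarrow> complex) \<Rightarrow> nat \<Rightarrow> real \<Rightarrow> complex" where
  "recip_num f 0 = (\<lambda>x. 1)"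
| "recip_num f (Suc k) = (\<lambda>x. nderiv 1 (recip_num f k) x * f x - of_nat (Suc k) * (recip_num f k x * nderiv 1 f x))"

lemma smooth_recip_num: "smooth f \<Longrightarrow> smooth (recip_num f k)"
  by (induction k) (simp_all add: smooth_diff smooth_mult smooth_cmult smooth_nderiv_smooth)

lemma smooth_inverse:
  fixes f :: "real \<Rightarrow> complex"
  assumes f: "smooth f" and nz: "\<And>x. f x \<noteq> 0"
  shows "smooth (\<lambda>x. inverse (f x))"
proof (rule smooth_towerI[where D = "\<lambda>k x. recip_num f k x * inverse (f x) ^ Suc k"])
  fix k x
  let ?q = "recip_num f k"
  have "(f has_vector_derivative nderiv 1 f x) (at x)"
    using smooth_nderiv[OF f, of 0] by simp
  moreover have "(inverse has_field_derivative - (inverse (f x))\<^sup>2) (at (f x))"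
    using DERIV_inverse[OF nz[of x]] by (simp add: numeral_2_eq_2)
  ultimately have inv: "((inverse \<circ> f) has_vector_derivative nderiv 1 f x * - (inverse (f x))\<^sup>2) (at x)"
    by (rule field_vector_diff_chain_at)
  have "((\<lambda>z. z ^ Suc k) has_field_derivative of_nat (Suc k) * inverse (f x) ^ k) (at ((inverse \<circ> f) x))"
    using DERIV_power_Suc[OF DERIV_ident, of k "inverse (f x)"] by (simp add: algebra_simps)
  from field_vector_diff_chain_at[OF inv this]
  have pw: "((\<lambda>x. inverse (f x) ^ Suc k) has_vector_derivative
      (nderiv 1 f x * - (inverse (f x))\<^sup>2) * (of_nat (Suc k) * inverse (f x) ^ k)) (at x)"
    by (simp only: o_def)
  have "(?q has_vector_derivative nderiv 1 ?q x) (at x)"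
    using smooth_nderiv[OF smooth_recip_num[OF f], of 0] by simp
  from has_vector_derivative_mult[OF this pw]
  show "((\<lambda>x. ?q x * inverse (f x) ^ Suc k) has_vector_derivative
      recip_num f (Suc k) x * inverse (f x) ^ Suc (Suc k)) (at x)"
  proof (rule has_vector_derivative_eq_rhs)
    have "nderiv 1 ?q x * f x * inverse (f x) ^ Suc (Suc k) = nderiv 1 ?q x * inverse (f x) ^ Suc k"
      using nz[of x] by simp
    then show "?q x * (nderiv 1 f x * - (inverse (f x))\<^sup>2 * (of_nat (Suc k) * inverse (f x) ^ k)) +
        nderiv 1 ?q x * inverse (f x) ^ Suc k = recip_num f (Suc k) x * inverse (f x) ^ Suc (Suc k)"
      by (simp only: recip_num.simps left_diff_distrib) (simp add: power2_eq_square mult_ac del: of_nat_Suc)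
  qed
qed (simp add: fun_eq_iff)

text \<open>The \<open>k\<close>-th derivative of \<open>exp (- 1 / x)\<close> is \<open>flat_poly k\<close>, evaluated at \<open>1 / x\<close>, times \<open>exp (- 1 / x)\<close>.\<close>

primrec flat_poly :: "nat \<Rightarrow> real poly" where
  "flat_poly 0 = 1"
| "flat_poly (Suc k) = [:0, 0, 1:] * (flat_poly k - pderiv (flat_poly k))"

lemma poly_times_exp_minus_tendsto_0:
  "((\<lambda>y::real. poly p y * exp (- y)) \<longlongrightarrow> 0) at_top"
proof -
  have "((\<lambda>y. \<Sum>i\<le>degree p. coeff p i * (y ^ i / exp y)) \<longlongrightarrow> (\<Sum>i\<le>degree p. coeff p i * 0)) at_top"
    by (intro tendsto_sum tendsto_mult tendsto_const tendsto_power_div_exp_0)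
  then show ?thesis
    by (simp add: poly_altdef exp_minus field_simps sum_divide_distrib)
qed

definition flat :: "real \<Rightarrow> real" where
  "flat x = (if x \<le> 0 then 0 else exp (- inverse x))"

lemma smooth_flat: "smooth (\<lambda>x. of_real (flat x))"
proof -
  define D where "D k x = (if x \<le> 0 then 0 else poly (flat_poly k) (inverse x) * exp (- inverse x))" for k and x :: real
  have "(D k has_real_derivative D (Suc k) x) (at x)" for k x
  proof -
    consider "x < 0" | "x = 0" | "x > 0" by linarith
    then show ?thesis
    proof cases
      case 1
      have "((\<lambda>x. 0) has_real_derivative 0) (at x)" by simp
      then have "(D k has_real_derivative 0) (at x)"
        by (rule has_field_derivative_transform_within_open[where S = "{..<0}"]) (use 1 in \<open>auto simp: D_def\<close>)
      then show ?thesis using 1 by (simp add: D_def)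
    next
      case 3
      have "((\<lambda>x. poly (flat_poly k) (inverse x) * exp (- inverse x)) has_real_derivative
          poly (flat_poly (Suc k)) (inverse x) * exp (- inverse x)) (at x)"
        using 3 by (auto intro!: derivative_eq_intros simp: field_simps power2_eq_square)
      then have "(D k has_real_derivative poly (flat_poly (Suc k)) (inverse x) * exp (- inverse x)) (at x)"
        by (rule has_field_derivative_transform_within_open[where S = "{0<..}"]) (use 3 in \<open>auto simp: D_def\<close>)
      then show ?thesis using 3 by (simp add: D_def)
    next
      case 2
      \<comment> \<open>The factor \<open>[:0, 1:]\<close> is the division by \<open>h\<close> in
        the difference quotient at \<open>0\<close>, read in the variable \<open>y = 1 / h\<close>;
        the exponential beats every polynomial.\<close>
      have "((\<lambda>y. poly ([:0, 1:] * flat_poly k) y * exp (- y)) \<longlongrightarrow> 0) at_top"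
        by (rule poly_times_exp_minus_tendsto_0)
      then have "((\<lambda>h. poly ([:0, 1:] * flat_poly k) (inverse h) * exp (- inverse h)) \<longlongrightarrow> 0) (at_right 0)"
        by (simp add: filterlim_at_right_to_top)
      then have "((\<lambda>h. (D k h - D k 0) / h) \<longlongrightarrow> 0) (at_right 0)"
        by (rule Lim_transform_eventually)
          (auto simp: eventually_at_filter D_def field_simps)
      moreover have "((\<lambda>h. (D k h - D k 0) / h) \<longlongrightarrow> 0) (at_left 0)"
        by (rule Lim_transform_eventually[OF tendsto_const])
          (auto simp: eventually_at_filter D_def)
      ultimately have "((\<lambda>h. (D k h - D k 0) / h) \<longlongrightarrow> 0) (at 0)"
        by (simp add: filterlim_split_at_real)
      then show ?thesis using 2 by (simp add: has_field_derivative_iff D_def)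
    qed
  qed
  then have "((\<lambda>x. complex_of_real (D k x)) has_vector_derivative of_real (D (Suc k) x)) (at x)" for k x
    by (rule has_vector_derivative_of_real)
  then show ?thesis
    by (rule smooth_towerI[rotated]) (auto simp: D_def flat_def fun_eq_iff)
qed

text \<open>The classical smooth transition from \<open>0\<close> to \<open>1\<close> over
  \<open>[0, 1]\<close>. At least one of \<open>x\<close> and \<open>1 - x\<close> is positive, so
  the denominator never vanishes.\<close>

definition step :: "real \<Rightarrow> complex" where
  "step x = of_real (flat x) * inverse (of_real (flat x) + of_real (flat (1 - x)))"

lemma flat_pos: "x > 0 \<Longrightarrow> flat x > 0" and flat_nonneg: "flat x \<ge> 0" and flat_zero: "x \<le> 0 \<Longrightarrow> flat x = 0"
  by (simp_all add: flat_def)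

lemma flat_sum_pos: "flat x + flat (1 - x) > 0"
  by (cases "x > 0") (auto intro: add_pos_nonneg add_nonneg_pos simp: flat_pos flat_nonneg)

lemma smooth_step: "smooth step"
proof -
  have "smooth (\<lambda>x. complex_of_real (flat x) + of_real (flat (1 - x)))"
    by (intro smooth_add smooth_flat smooth_reflect[OF smooth_flat])
  moreover have "complex_of_real (flat x) + of_real (flat (1 - x)) \<noteq> 0" for x
    using flat_sum_pos[of x] unfolding of_real_add[symmetric] of_real_eq_0_iff by linarith
  ultimately show ?thesis
    unfolding step_def[abs_def] by (intro smooth_mult smooth_flat smooth_inverse)
qed

lemma step_0: "x \<le> 0 \<Longrightarrow> step x = 0"
  by (simp add: step_def flat_zero)

lemma step_1: "x \<ge> 1 \<Longrightarrow> step x = 1"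
  using flat_pos[of x] by (simp add: step_def flat_zero)

lemma step_Reals: "step x \<in> \<real>"
  by (simp add: step_def)

lemma step_nderiv_neg:
  assumes "x < 0" shows "nderiv k step x = 0"
  using nderiv_cong_open[OF smooth_step smooth_const, of "{..<0}" 0 x k] assms
  by (simp add: step_0 nderiv_const split: if_splits)

lemma step_nderiv_bounded: "\<exists>B. \<forall>x. norm (nderiv k step x) \<le> B"
proof -
  have "bounded (nderiv k step ` {0..1})"
    by (intro compact_imp_bounded compact_continuous_image smooth_continuous_nderiv smooth_step) auto
  then obtain B where B: "\<And>x. x \<in> {0..1} \<Longrightarrow> norm (nderiv k step x) \<le> B"
    unfolding bounded_iff by blast
  have "norm (nderiv k step x) \<le> max B 1" for x
  proof -
    consider "x < 0" | "x \<in> {0..1}" | "x > 1" by force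
    then show ?thesis
    proof cases
      case 3
      then have "nderiv k step x = nderiv k (\<lambda>x. 1) x"
        using nderiv_cong_open[OF smooth_step smooth_const, of "{1<..}" 1 x k] by (simp add: step_1)
      then show ?thesis by (simp add: nderiv_const le_max_iff_disj)
    qed (use B step_nderiv_neg in \<open>auto simp: le_max_iff_disj\<close>)
  qed
  then show ?thesis by blast
qed

text \<open>The transition layers \<open>[a, a + 1]\<close> and \<open>[b - 1, b]\<close> have width
  1 wherever \<open>a\<close> and \<open>b\<close> lie, so moving the ends to infinity costs nothing
  in the derivative bounds. The form \<open>x + (- a)\<close> is the one that
  \<open>smooth_shift\<close> expects.\<close>

definition cut :: "real \<Rightarrow> real \<Rightarrow> real \<Rightarrow> complex" where
  "cut a b x = step (x + (- a)) * step (b - x)"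

lemma smooth_cut: "smooth (cut a b)"
  unfolding cut_def[abs_def] by (intro smooth_mult smooth_shift[OF smooth_step] smooth_reflect[OF smooth_step])

lemma cut_0: "x \<le> a \<or> b \<le> x \<Longrightarrow> cut a b x = 0"
  by (auto simp: cut_def step_0)

lemma cut_1: "a + 1 \<le> x \<Longrightarrow> x \<le> b - 1 \<Longrightarrow> cut a b x = 1"
  by (simp add: cut_def step_1)

lemma cut_Reals: "cut a b x \<in> \<real>"
  by (simp add: cut_def step_Reals)

lemma cut_test: "cut a b \<in> test_functions"
proof (rule test_functionI[OF smooth_cut])
  show "a \<le> x \<and> x \<le> b" if "cut a b x \<noteq> 0" for x
    using cut_0[of x a b] that by linarith
qed

lemma cut_mult_test: "smooth g \<Longrightarrow> (\<lambda>x. cut a b x * g x) \<in> test_functions"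
  by (intro test_mult cut_test)

text \<open>The bound is chosen before \<open>a\<close> and \<open>b\<close>: translating or
  reflecting \<open>step\<close> does not change the sup norms of its derivatives, and Leibniz' rule
  combines them.\<close>

lemma cut_nderiv_bounded: "\<exists>B\<ge>0. \<forall>a b x. norm (nderiv k (cut a b) x) \<le> B"
proof -
  have "\<forall>k. \<exists>B. \<forall>x. norm (nderiv k step x) \<le> B"
    using step_nderiv_bounded by blast
  from choice[OF this] obtain B where "\<forall>k x. norm (nderiv k step x) \<le> B k" ..
  then have B: "norm (nderiv k step x) \<le> B k" for k x by blast
  have Bpos: "B k \<ge> 0" for k using order_trans[OF norm_ge_zero B] .
  have "norm (nderiv k (cut a b) x) \<le> (\<Sum>i\<le>k. of_nat (k choose i) * B i * B (k - i))" for a b x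
  proof -
    have "nderiv k (cut a b) x = (\<Sum>i\<le>k. of_nat (k choose i) * nderiv i step (x + - a) *
        ((-1) ^ (k - i) * nderiv (k - i) step (b - x)))"
      unfolding cut_def[abs_def]
      by (simp only: nderiv_mult[OF smooth_shift[OF smooth_step] smooth_reflect[OF smooth_step]]
          nderiv_shift[OF smooth_step] nderiv_reflect[OF smooth_step])
    also have "norm \<dots> \<le> (\<Sum>i\<le>k. of_nat (k choose i) * B i * B (k - i))"
      by (intro sum_norm_le) (auto simp: norm_mult norm_power intro!: mult_mono B Bpos)
    finally show ?thesis .
  qed
  moreover have "(\<Sum>i\<le>k. of_nat (k choose i) * B i * B (k - i)) \<ge> 0"
    by (intro sum_nonneg mult_nonneg_nonneg Bpos) auto
  ultimately show ?thesis by blast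
qed

subsection \<open>Functionals and their supports\<close>

lemma test_zero: "(\<lambda>x::real. 0) \<in> test_functions"
  by (rule test_functionI_abs[OF smooth_const]) simp

lemma linear_functional_add:
  "linear_functional_on A T \<Longrightarrow> \<phi> \<in> A \<Longrightarrow> \<psi> \<in> A \<Longrightarrow> T (\<lambda>x. \<phi> x + \<psi> x) = T \<phi> + T \<psi>"
  by (simp add: linear_functional_on_def)

lemma linear_functional_cmult:
  "linear_functional_on A T \<Longrightarrow> \<phi> \<in> A \<Longrightarrow> T (\<lambda>x. a * \<phi> x) = a * T \<phi>"
  by (simp add: linear_functional_on_def)

lemma linear_functional_diff:
  assumes "linear_functional_on A T" "\<phi> \<in> A" "\<psi> \<in> A" "(\<lambda>x. -1 * \<psi> x) \<in> A"
  shows "T (\<lambda>x. \<phi> x - \<psi> x) = T \<phi> - T \<psi>"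
  using linear_functional_add[OF assms(1,2,4)] linear_functional_cmult[OF assms(1,3), of "-1"] by simp

lemma linear_functional_test_zero:
  assumes "linear_functional_on test_functions T" shows "T (\<lambda>x. 0) = 0"
  using linear_functional_cmult[OF assms test_zero, of 0] by simp

lemma linear_functional_test_sum:
  assumes T: "linear_functional_on test_functions T" and p: "\<And>i. p i \<in> test_functions"
  shows "(\<lambda>x. \<Sum>i<n. p i x) \<in> test_functions \<and> T (\<lambda>x. \<Sum>i<(n::nat). p i x) = (\<Sum>i<n. T (p i))"
proof (induction n)
  case 0
  then show ?case by (simp add: test_zero linear_functional_test_zero[OF T])
next
  case (Suc n)
  then show ?case
    using test_add[of "\<lambda>x. \<Sum>i<n. p i x" "p n"] linear_functional_add[OF T, of "\<lambda>x. \<Sum>i<n. p i x" "p n"] p[of n]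
    by simp
qed

lemma closure_subset_closed: "closed C \<Longrightarrow> {x. f x \<noteq> 0} \<subseteq> C \<Longrightarrow> fun_supp f \<subseteq> C"
  unfolding fun_supp_def by (rule closure_minimal)

text \<open>The differences \<open>step (y - i) - step (y - i - 1)\<close> telescope, which gives a partition of unity
  into pieces shorter than a Lebesgue number of the cover of \<open>fun_supp \<phi>\<close> by null sets.\<close>

lemma functional_vanishes_off_support:
  assumes T: "linear_functional_on test_functions T" and \<phi>: "\<phi> \<in> test_functions"
    and disj: "fun_supp \<phi> \<inter> dist_supp T = {}"
  shows "T \<phi> = 0"
proof -
  let ?\<G> = "{G. open G \<and> (\<forall>\<phi>\<in>test_functions. fun_supp \<phi> \<subseteq> G \<longrightarrow> T \<phi> = 0)}"
  have K: "compact (fun_supp \<phi>)" using \<phi> by (simp add: test_functions_def)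
  have "fun_supp \<phi> \<subseteq> \<Union>?\<G>" using disj unfolding dist_supp_def by blast
  from Heine_Borel_lemma[OF K this] obtain e where e: "e > 0"
    "\<And>x. x \<in> fun_supp \<phi> \<Longrightarrow> \<exists>G\<in>?\<G>. ball x e \<subseteq> G"
    by (metis (no_types, lifting) mem_Collect_eq)
  \<comment> \<open>Each piece \<open>p i\<close> below lives in an interval of length
    \<open>2 * \<delta>\<close>, half the Lebesgue number \<open>e\<close>, so it fits into the ball
    of radius \<open>e\<close> around any point of its support.\<close>
  define \<delta> where "\<delta> = e / 4"
  have \<delta>: "\<delta> > 0" using e by (simp add: \<delta>_def)
  obtain R where R: "R > 0" "\<forall>k x. \<bar>x\<bar> \<ge> R \<longrightarrow> nderiv k \<phi> x = 0"
    by (rule test_function_bounds[OF \<phi>])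
  \<comment> \<open>The shift by \<open>M\<close> allows natural indices: for \<open>|x| < R\<close>
    the first step has argument at least \<open>1\<close> and the last one at most \<open>0\<close>,
    so the \<open>2 * M\<close> differences telescope to \<open>1\<close>.\<close>
  obtain M :: nat where M: "R / \<delta> + 1 \<le> M" using real_arch_simple by blast
  define p where "p i x = \<phi> x * (step (x / \<delta> + real M - real i) - step (x / \<delta> + real M - real (Suc i)))" for i x
  have ptest: "p i \<in> test_functions" for i
  proof -
    have "smooth (\<lambda>x. step ((1 / \<delta>) * x + (real M - real i)) - step ((1 / \<delta>) * x + (real M - real (Suc i))))"
      by (intro smooth_diff smooth_affine[OF smooth_step])
    from test_mult[OF \<phi> this] show ?thesis
      by (simp add: p_def[abs_def] algebra_simps)
  qed
  have p0: "T (p i) = 0" for i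
  proof (cases "fun_supp (p i) = {}")
    case True
    then have "p i = (\<lambda>x. 0)" by (auto simp: fun_supp_def)
    then show ?thesis by (simp add: linear_functional_test_zero[OF T])
  next
    case False
    define u where "u = (real i - real M) * \<delta>"
    have "x \<in> fun_supp \<phi> \<and> u \<le> x \<and> x \<le> u + 2 * \<delta>" if nz: "p i x \<noteq> 0" for x
    proof -
      have "\<phi> x \<noteq> 0" using nz by (auto simp: p_def)
      then have "x \<in> fun_supp \<phi>" by (auto simp: fun_supp_def intro: closure_subset[THEN subsetD])
      moreover have "x / \<delta> + real M - real i > 0"
      proof (rule ccontr)
        assume "\<not> ?thesis"
        then have "p i x = 0" by (simp add: p_def step_0)
        then show False using nz by simp
      qed
      moreover have "x / \<delta> + real M - real (Suc i) < 1"
      proof (rule ccontr)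
        assume "\<not> ?thesis"
        then have "p i x = 0" by (simp add: p_def step_1)
        then show False using nz by simp
      qed
      ultimately show ?thesis using \<delta> by (simp add: u_def field_simps)
    qed
    then have "fun_supp (p i) \<subseteq> fun_supp \<phi> \<inter> {u..u + 2 * \<delta>}"
      by (intro closure_subset_closed) (auto simp: fun_supp_def)
    moreover from False obtain x0 where "x0 \<in> fun_supp (p i)" by blast
    ultimately have x0: "x0 \<in> fun_supp \<phi>" "u \<le> x0" "x0 \<le> u + 2 * \<delta>"
      and sub: "fun_supp (p i) \<subseteq> {u..u + 2 * \<delta>}" by auto
    have "{u..u + 2 * \<delta>} \<subseteq> ball x0 e"
      using x0(2,3) e(1) by (auto simp: \<delta>_def dist_real_def abs_less_iff)
    with sub have sub: "fun_supp (p i) \<subseteq> ball x0 e" by blast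
    from e(2)[OF x0(1)] obtain G where "G \<in> ?\<G>" "ball x0 e \<subseteq> G" by blast
    then show ?thesis using sub ptest[of i] by blast
  qed
  have "\<phi> x = (\<Sum>i<2 * M. p i x)" for x
  proof (cases "\<bar>x\<bar> \<ge> R")
    case True
    then have "\<phi> x = 0" using R(2)[rule_format, of x 0] by simp
    then show ?thesis by (simp add: p_def)
  next
    case False
    have "\<bar>x / \<delta>\<bar> \<le> R / \<delta>" using False \<delta> by (simp add: field_simps)
    then have "- (R / \<delta>) \<le> x / \<delta> \<and> x / \<delta> \<le> R / \<delta>" by linarith
    then have *: "x / \<delta> + real M \<ge> 1" "x / \<delta> + real M - real (2 * M) \<le> 0"
      using M by linarith+
    have "(\<Sum>i<2 * M. p i x) = \<phi> x * (\<Sum>i<2 * M. step (x / \<delta> + real M - real i) - step (x / \<delta> + real M - real (Suc i)))"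
      by (simp add: p_def sum_distrib_left)
    also have "\<dots> = \<phi> x * (step (x / \<delta> + real M - real 0) - step (x / \<delta> + real M - real (2 * M)))"
      by (subst sum_lessThan_telescope') simp
    also have "\<dots> = \<phi> x" using * by (simp add: step_0 step_1)
    finally show ?thesis by simp
  qed
  then have "T \<phi> = T (\<lambda>x. \<Sum>i<2 * M. p i x)" by presburger
  also have "\<dots> = 0" using linear_functional_test_sum[OF T ptest] p0 by simp
  finally show ?thesis .
qed

subsection \<open>Schwartz functions and tempered functionals\<close>

lemma one_plus_abs_power_le: "(1 + \<bar>x::real\<bar>) ^ j \<le> 2 ^ j * (1 + \<bar>x\<bar> ^ j)"
proof (cases "\<bar>x\<bar> \<le> 1")
  case True
  then have "(1 + \<bar>x\<bar>) ^ j \<le> 2 ^ j" by (intro power_mono) auto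
  also have "\<dots> \<le> 2 ^ j * (1 + \<bar>x\<bar> ^ j)" by simp
  finally show ?thesis .
next
  case False
  then have "(1 + \<bar>x\<bar>) ^ j \<le> (2 * \<bar>x\<bar>) ^ j" by (intro power_mono) auto
  also have "\<dots> \<le> 2 ^ j * (1 + \<bar>x\<bar> ^ j)" by (simp add: power_mult_distrib)
  finally show ?thesis .
qed

text \<open>Unlike the monomials \<open>x ^ j\<close>, the weights \<open>(1 + |x|) ^ j\<close>
  increase with \<open>j\<close> and never vanish, so a single weight controls all lower ones. The
  bounds for exponents \<open>0\<close> and \<open>j\<close> together give the new bound.\<close>

lemma schwartz_iff:
  "\<phi> \<in> schwartz_functions \<longleftrightarrow>
     smooth \<phi> \<and> (\<forall>j k. \<exists>B. \<forall>x. (1 + \<bar>x\<bar>) ^ j * norm (nderiv k \<phi> x) \<le> B)"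
proof -
  have "(\<forall>j. bounded (range (\<lambda>x. of_real (x ^ j) * nderiv k \<phi> x))) \<longleftrightarrow>
    (\<forall>j. \<exists>B. \<forall>x. (1 + \<bar>x\<bar>) ^ j * norm (nderiv k \<phi> x) \<le> B)" (is "?L \<longleftrightarrow> ?R") for k
  proof safe
    fix j assume L: ?L
    obtain B0 where B0: "\<And>x. norm (of_real (x ^ 0) * nderiv k \<phi> x) \<le> B0"
      using L[rule_format, of 0] unfolding bounded_iff by blast
    obtain B1 where B1: "\<And>x. norm (of_real (x ^ j) * nderiv k \<phi> x) \<le> B1"
      using L[rule_format, of j] unfolding bounded_iff by blast
    have "(1 + \<bar>x\<bar>) ^ j * norm (nderiv k \<phi> x) \<le> 2 ^ j * (B0 + B1)" for x
    proof -
      have "(1 + \<bar>x\<bar>) ^ j * norm (nderiv k \<phi> x) \<le> 2 ^ j * (1 + \<bar>x\<bar> ^ j) * norm (nderiv k \<phi> x)"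
        by (intro mult_right_mono one_plus_abs_power_le) auto
      also have "\<dots> = 2 ^ j * (norm (nderiv k \<phi> x) + \<bar>x\<bar> ^ j * norm (nderiv k \<phi> x))"
        by (simp add: algebra_simps)
      also have "\<dots> \<le> 2 ^ j * (B0 + B1)"
        using B0[of x] B1[of x] by (intro mult_left_mono add_mono) (auto simp: norm_mult norm_power)
      finally show ?thesis .
    qed
    then show "\<exists>B. \<forall>x. (1 + \<bar>x\<bar>) ^ j * norm (nderiv k \<phi> x) \<le> B" by blast
  next
    fix j assume R: ?R
    then obtain B where B: "\<And>x. (1 + \<bar>x\<bar>) ^ j * norm (nderiv k \<phi> x) \<le> B" by blast
    have "norm (of_real (x ^ j) * nderiv k \<phi> x) \<le> B" for x
    proof -
      have "norm (of_real (x ^ j) * nderiv k \<phi> x) \<le> (1 + \<bar>x\<bar>) ^ j * norm (nderiv k \<phi> x)"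
        by (auto simp: norm_mult norm_power intro!: mult_right_mono power_mono)
      then show ?thesis using B[of x] by linarith
    qed
    then show "bounded (range (\<lambda>x. of_real (x ^ j) * nderiv k \<phi> x))"
      unfolding bounded_iff by blast
  qed
  then show ?thesis unfolding schwartz_functions_def by blast
qed

lemma schwartz_smooth: "\<phi> \<in> schwartz_functions \<Longrightarrow> smooth \<phi>"
  by (simp add: schwartz_functions_def)

lemma schwartz_add:
  assumes "\<phi> \<in> schwartz_functions" "\<psi> \<in> schwartz_functions"
  shows "(\<lambda>x. \<phi> x + \<psi> x) \<in> schwartz_functions"
  unfolding schwartz_iff
proof safe
  show "smooth (\<lambda>x. \<phi> x + \<psi> x)" by (intro smooth_add schwartz_smooth assms)
  fix j k
  obtain A where A: "\<And>x. (1 + \<bar>x\<bar>) ^ j * norm (nderiv k \<phi> x) \<le> A"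
    using assms(1) unfolding schwartz_iff by blast
  obtain B where B: "\<And>x. (1 + \<bar>x\<bar>) ^ j * norm (nderiv k \<psi> x) \<le> B"
    using assms(2) unfolding schwartz_iff by blast
  have "(1 + \<bar>x\<bar>) ^ j * norm (nderiv k (\<lambda>x. \<phi> x + \<psi> x) x) \<le> A + B" for x
  proof -
    have "(1 + \<bar>x\<bar>) ^ j * norm (nderiv k (\<lambda>x. \<phi> x + \<psi> x) x) \<le>
      (1 + \<bar>x\<bar>) ^ j * (norm (nderiv k \<phi> x) + norm (nderiv k \<psi> x))"
      unfolding nderiv_add[OF schwartz_smooth[OF assms(1)] schwartz_smooth[OF assms(2)]]
      by (intro mult_left_mono norm_triangle_ineq) auto
    then show ?thesis using A[of x] B[of x] by (simp add: ring_distribs)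
  qed
  then show "\<exists>B. \<forall>x. (1 + \<bar>x\<bar>) ^ j * norm (nderiv k (\<lambda>x. \<phi> x + \<psi> x) x) \<le> B" by blast
qed

lemma schwartz_cmult:
  assumes "\<phi> \<in> schwartz_functions"
  shows "(\<lambda>x. a * \<phi> x) \<in> schwartz_functions"
  unfolding schwartz_iff
proof safe
  show "smooth (\<lambda>x. a * \<phi> x)" by (intro smooth_cmult schwartz_smooth assms)
  fix j k
  obtain A where A: "\<And>x. (1 + \<bar>x\<bar>) ^ j * norm (nderiv k \<phi> x) \<le> A"
    using assms(1) unfolding schwartz_iff by blast
  have "(1 + \<bar>x\<bar>) ^ j * norm (nderiv k (\<lambda>x. a * \<phi> x) x) \<le> norm a * A" for x
    using mult_left_mono[OF A[of x], of "norm a"]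
    unfolding nderiv_cmult[OF schwartz_smooth[OF assms(1)]] by (simp add: norm_mult mult_ac)
  then show "\<exists>B. \<forall>x. (1 + \<bar>x\<bar>) ^ j * norm (nderiv k (\<lambda>x. a * \<phi> x) x) \<le> B" by blast
qed

lemma test_subset_schwartz: "test_functions \<subseteq> schwartz_functions"
proof
  fix \<phi> :: "real \<Rightarrow> complex" assume \<phi>: "\<phi> \<in> test_functions"
  show "\<phi> \<in> schwartz_functions"
    unfolding schwartz_iff
  proof safe
    show "smooth \<phi>" by (rule test_smooth[OF \<phi>])
    fix j k
    obtain M where M: "M > 0" "\<forall>k x. \<bar>x\<bar> \<ge> M \<longrightarrow> nderiv k \<phi> x = 0"
      by (rule test_function_bounds[OF \<phi>])
    obtain B where B: "B > 0" "\<forall>x. norm (nderiv k \<phi> x) \<le> B"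
      by (rule test_function_nderiv_bounded[OF \<phi>])
    have "(1 + \<bar>x\<bar>) ^ j * norm (nderiv k \<phi> x) \<le> (1 + M) ^ j * B" for x
    proof (cases "\<bar>x\<bar> \<ge> M")
      case True
      then show ?thesis using M(2)[rule_format, of x k] B(1) M(1) by simp
    next
      case False
      then show ?thesis using B by (intro mult_mono power_mono) (use M in auto)
    qed
    then show "\<exists>B. \<forall>x. (1 + \<bar>x\<bar>) ^ j * norm (nderiv k \<phi> x) \<le> B" by blast
  qed
qed

text \<open>Suprema are traded for pointwise bounds: one weight, finitely many derivatives and a
  common bound \<open>B\<close> suffice. Later continuity arguments only have to verify such
  bounds.\<close>

lemma tempered_functional_bound:
  assumes "V \<in> tempered_functionals"
  obtains C m where "C \<ge> 0"
    "\<forall>\<phi> B. \<phi> \<in> schwartz_functions \<longrightarrow> B \<ge> 0 \<longrightarrow>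
       (\<forall>k x. k \<le> m \<longrightarrow> (1 + \<bar>x\<bar>) ^ m * norm (nderiv k \<phi> x) \<le> B) \<longrightarrow> norm (V \<phi>) \<le> C * B"
proof -
  obtain C m where *: "\<And>\<phi>. \<phi> \<in> schwartz_functions \<Longrightarrow>
      norm (V \<phi>) \<le> C * (\<Sum>j\<le>m. \<Sum>k\<le>m. SUP x. \<bar>x\<bar> ^ j * norm (nderiv k \<phi> x))"
    using assms unfolding tempered_functionals_def by blast
  show ?thesis
  proof (rule that[of "\<bar>C\<bar> * (real (Suc m) * real (Suc m))" m], safe)
    fix \<phi> B
    assume \<phi>: "\<phi> \<in> schwartz_functions" and B: "B \<ge> 0"
      and H: "\<forall>k x. k \<le> m \<longrightarrow> (1 + \<bar>x\<bar>) ^ m * norm (nderiv k \<phi> x) \<le> B"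
    have le: "\<bar>x\<bar> ^ j * norm (nderiv k \<phi> x) \<le> B" if "j \<le> m" "k \<le> m" for j k x
    proof -
      have "\<bar>x\<bar> ^ j \<le> (1 + \<bar>x\<bar>) ^ j" by (intro power_mono) auto
      also have "\<dots> \<le> (1 + \<bar>x\<bar>) ^ m" using that by (intro power_increasing) auto
      finally have "\<bar>x\<bar> ^ j * norm (nderiv k \<phi> x) \<le> (1 + \<bar>x\<bar>) ^ m * norm (nderiv k \<phi> x)"
        by (intro mult_right_mono) auto
      also have "\<dots> \<le> B" using H that by blast
      finally show ?thesis .
    qed
    have up: "(SUP x. \<bar>x\<bar> ^ j * norm (nderiv k \<phi> x)) \<le> B" if "j \<le> m" "k \<le> m" for j k
      using le[OF that] by (intro cSUP_least) auto
    \<comment> \<open>Nonnegativity of the suprema allows the constant \<open>C\<close>, whose sign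
      is unknown, to be replaced by its absolute value.\<close>
    have low: "(SUP x. \<bar>x\<bar> ^ j * norm (nderiv k \<phi> x)) \<ge> 0" if "j \<le> m" "k \<le> m" for j k
      using le[OF that] by (intro cSUP_upper2[of _ _ 0] bdd_aboveI2[of _ _ B]) auto
    have "norm (V \<phi>) \<le> C * (\<Sum>j\<le>m. \<Sum>k\<le>m. SUP x. \<bar>x\<bar> ^ j * norm (nderiv k \<phi> x))" by (rule *[OF \<phi>])
    also have "\<dots> \<le> \<bar>C\<bar> * (\<Sum>j\<le>m. \<Sum>k\<le>m. SUP x. \<bar>x\<bar> ^ j * norm (nderiv k \<phi> x))"
      by (intro mult_right_mono sum_nonneg low) auto
    also have "\<dots> \<le> \<bar>C\<bar> * (\<Sum>j\<le>m. \<Sum>k\<le>m. B)"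
      by (intro mult_left_mono sum_mono up) auto
    finally show "norm (V \<phi>) \<le> \<bar>C\<bar> * (real (Suc m) * real (Suc m)) * B" by (simp add: mult_ac)
  qed simp
qed

section \<open>Approximation by test functions and uniqueness of the tempered extension\<close>

definition plateau :: "nat \<Rightarrow> real \<Rightarrow> complex" where
  "plateau n = cut (- real n - 1) (real n + 1)"

lemma plateau_1: "\<bar>x\<bar> \<le> real n \<Longrightarrow> plateau n x = 1"
  by (auto simp: plateau_def intro!: cut_1)

text \<open>The estimate is pointwise in \<open>x\<close> with a constant depending on
  \<open>k\<close> alone, so it preserves whatever weight or exponential profile \<open>f\<close>
  has, for all cut-offs at once.\<close>

lemma cut_mult_nderiv_bound:
  "\<exists>C\<ge>0. \<forall>a b f x A. smooth f \<longrightarrow> (\<forall>i\<le>k. norm (nderiv i f x) \<le> A) \<longrightarrow>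
     norm (nderiv k (\<lambda>x. cut a b x * f x) x) \<le> C * A"
proof -
  have "\<forall>k. \<exists>B. B \<ge> 0 \<and> (\<forall>a b x. norm (nderiv k (cut a b) x) \<le> B)"
    using cut_nderiv_bounded by blast
  from choice[OF this] obtain B where "\<forall>k. B k \<ge> 0 \<and> (\<forall>a b x. norm (nderiv k (cut a b) x) \<le> B k)" ..
  then have Bpos: "B k \<ge> 0" and B: "norm (nderiv k (cut a b) x) \<le> B k" for k a b x by auto
  have "norm (nderiv k (\<lambda>x. cut a b x * f x) x) \<le> (\<Sum>i\<le>k. of_nat (k choose i) * B i) * A"
    if f: "smooth f" and A: "\<forall>i\<le>k. norm (nderiv i f x) \<le> A" for a b f x A
  proof -
    have "A \<ge> 0" using A[rule_format, of 0] norm_ge_zero order_trans by blast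
    have "norm (nderiv k (\<lambda>x. cut a b x * f x) x) \<le> (\<Sum>i\<le>k. of_nat (k choose i) * B i * A)"
      unfolding nderiv_mult[OF smooth_cut f]
      by (intro sum_norm_le) (use A \<open>A \<ge> 0\<close> in \<open>auto simp: norm_mult intro!: mult_mono B Bpos\<close>)
    then show ?thesis by (simp add: sum_distrib_right)
  qed
  moreover have "(\<Sum>i\<le>k. of_nat (k choose i) * B i) \<ge> 0"
    by (intro sum_nonneg mult_nonneg_nonneg Bpos) auto
  ultimately show ?thesis by blast
qed

lemma plateau_mult_test: "smooth f \<Longrightarrow> (\<lambda>x. plateau n x * f x) \<in> test_functions"
  unfolding plateau_def by (rule cut_mult_test)

text \<open>Truncation alters the function only where \<open>|x| \<ge> n\<close>. There rapid decay
  provides one factor \<open>1 + |x|\<close> more than the continuity estimate consumes, and the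
  error is of order \<open>1 / (1 + n)\<close>.\<close>

lemma tempered_functional_plateau_limit:
  assumes V: "V \<in> tempered_functionals" and \<phi>: "\<phi> \<in> schwartz_functions"
  shows "(\<lambda>n. V (\<lambda>x. plateau n x * \<phi> x)) \<longlonglongrightarrow> V \<phi>"
proof -
  have lin: "linear_functional_on schwartz_functions V"
    using V by (simp add: tempered_functionals_def)
  obtain C m where C: "C \<ge> 0" "\<forall>\<phi> B. \<phi> \<in> schwartz_functions \<longrightarrow> B \<ge> 0 \<longrightarrow>
       (\<forall>k x. k \<le> m \<longrightarrow> (1 + \<bar>x\<bar>) ^ m * norm (nderiv k \<phi> x) \<le> B) \<longrightarrow> norm (V \<phi>) \<le> C * B"
    by (rule tempered_functional_bound[OF V])
  note sm = schwartz_smooth[OF \<phi>]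
  have "\<forall>k. \<exists>D. D \<ge> 0 \<and> (\<forall>a b f x A. smooth f \<longrightarrow> (\<forall>i\<le>k. norm (nderiv i f x) \<le> A) \<longrightarrow>
     norm (nderiv k (\<lambda>x. cut a b x * f x) x) \<le> D * A)"
    using cut_mult_nderiv_bound by blast
  from choice[OF this] obtain D where D0: "\<And>k. D k \<ge> 0" and
    D: "\<And>k a b f x A. smooth f \<Longrightarrow> (\<forall>i\<le>k. norm (nderiv i f x) \<le> A) \<Longrightarrow>
     norm (nderiv k (\<lambda>x. cut a b x * f x) x) \<le> D k * A" by metis
  have "\<forall>k. \<exists>B. \<forall>x. (1 + \<bar>x\<bar>) ^ Suc m * norm (nderiv k \<phi> x) \<le> B"
    using \<phi> unfolding schwartz_iff by blast
  from choice[OF this] obtain B where "\<forall>k x. (1 + \<bar>x\<bar>) ^ Suc m * norm (nderiv k \<phi> x) \<le> B k" ..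
  then have B: "(1 + \<bar>x\<bar>) ^ Suc m * norm (nderiv k \<phi> x) \<le> B k" for k x by blast
  have B0: "B k \<ge> 0" for k
    by (rule order_trans[OF _ B[of 0 k]]) auto
  define S where "S = (\<Sum>k\<le>m. B k)"
  have S: "B k \<le> S" if "k \<le> m" for k
    unfolding S_def using that B0 by (intro member_le_sum) auto
  have S0: "S \<ge> 0" unfolding S_def by (intro sum_nonneg B0)
  \<comment> \<open>The summand \<open>1\<close> accounts for \<open>\<phi>\<close> itself, the sum
    of the \<open>D k\<close> for its truncation.\<close>
  define E where "E = (1 + (\<Sum>k\<le>m. D k)) * S"
  have E0: "E \<ge> 0" unfolding E_def by (intro mult_nonneg_nonneg add_nonneg_nonneg sum_nonneg D0 S0) auto
  have main: "norm (V (\<lambda>x. plateau n x * \<phi> x) - V \<phi>) \<le> C * (E / (1 + real n))" for n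
  proof -
    let ?\<psi> = "\<lambda>x. plateau n x * \<phi> x"
    have \<psi>: "?\<psi> \<in> schwartz_functions" using plateau_mult_test[OF sm] test_subset_schwartz by blast
    have mem: "(\<lambda>x. ?\<psi> x - \<phi> x) \<in> schwartz_functions"
      using schwartz_add[OF \<psi> schwartz_cmult[OF \<phi>, of "-1"]] by simp
    have "norm (V (\<lambda>x. ?\<psi> x - \<phi> x)) \<le> C * (E / (1 + real n))"
    proof (rule C(2)[rule_format, OF mem])
      show "0 \<le> E / (1 + real n)" using E0 by simp
      fix k x assume k: "k \<le> m"
      have d: "nderiv k (\<lambda>x. ?\<psi> x - \<phi> x) x = nderiv k ?\<psi> x - nderiv k \<phi> x"
        by (simp add: nderiv_diff[OF test_smooth[OF plateau_mult_test[OF sm]] sm])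
      show "(1 + \<bar>x\<bar>) ^ m * norm (nderiv k (\<lambda>x. ?\<psi> x - \<phi> x) x) \<le> E / (1 + real n)"
      proof (cases "\<bar>x\<bar> < real n")
        case True
        have "nderiv k ?\<psi> x = nderiv k \<phi> x"
          using True
          by (intro nderiv_cong_open[OF test_smooth[OF plateau_mult_test[OF sm]] sm, of "{- real n<..<real n}"])
            (auto simp: plateau_1)
        then show ?thesis using d E0 by simp
      next
        case False
        have *: "norm (nderiv i \<phi> x) \<le> S / (1 + \<bar>x\<bar>) ^ Suc m" if "i \<le> m" for i
          using B[of x i] S[OF that] by (simp add: pos_le_divide_eq mult.commute del: power_Suc)
        have "norm (nderiv k ?\<psi> x) \<le> D k * (S / (1 + \<bar>x\<bar>) ^ Suc m)"
          unfolding plateau_def using * k by (intro D sm) auto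
        also have "\<dots> \<le> (\<Sum>k\<le>m. D k) * (S / (1 + \<bar>x\<bar>) ^ Suc m)"
          using k D0 S0 by (intro mult_right_mono member_le_sum) auto
        finally have "norm (nderiv k ?\<psi> x - nderiv k \<phi> x) \<le> E / (1 + \<bar>x\<bar>) ^ Suc m"
          using norm_triangle_ineq4[of "nderiv k ?\<psi> x" "nderiv k \<phi> x"] *[OF k]
          by (simp add: E_def ring_distribs add_divide_distrib)
        then have "(1 + \<bar>x\<bar>) ^ m * norm (nderiv k (\<lambda>x. ?\<psi> x - \<phi> x) x) \<le> (1 + \<bar>x\<bar>) ^ m * (E / (1 + \<bar>x\<bar>) ^ Suc m)"
          unfolding d by (intro mult_left_mono) auto
        also have "\<dots> = E / (1 + \<bar>x\<bar>)" by simp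
        also have "\<dots> \<le> E / (1 + real n)"
          using False E0 by (intro divide_left_mono) auto
        finally show ?thesis .
      qed
    qed
    moreover have "V (\<lambda>x. ?\<psi> x - \<phi> x) = V ?\<psi> - V \<phi>"
      by (rule linear_functional_diff[OF lin \<psi> \<phi> schwartz_cmult[OF \<phi>]])
    ultimately show ?thesis by simp
  qed
  have "(\<lambda>n. C * (E / (1 + real n))) \<longlonglongrightarrow> 0"
    by real_asymp
  then have "(\<lambda>n. V (\<lambda>x. plateau n x * \<phi> x) - V \<phi>) \<longlonglongrightarrow> 0"
    by (rule Lim_null_comparison[rotated]) (use main in auto)
  then show ?thesis by (simp add: LIM_zero_iff)
qed

text \<open>Resolves the definite description: tempered functionals that agree on test functions
  agree on Schwartz functions by truncation, and elsewhere both are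
  \<open>undefined\<close>.\<close>

lemma tempered_extension_eq:
  assumes V: "V \<in> tempered_functionals" and "restrict V test_functions = T"
  shows "tempered_extension T = V"
  unfolding tempered_extension_def
proof (rule the_equality)
  fix V' assume V': "V' \<in> tempered_functionals \<and> restrict V' test_functions = T"
  show "V' = V"
  proof
    fix \<phi>
    show "V' \<phi> = V \<phi>"
    proof (cases "\<phi> \<in> schwartz_functions")
      case True
      have "V' (\<lambda>x. plateau n x * \<phi> x) = V (\<lambda>x. plateau n x * \<phi> x)" for n
      proof -
        have "(\<lambda>x. plateau n x * \<phi> x) \<in> test_functions"
          by (rule plateau_mult_test[OF schwartz_smooth[OF True]])
        moreover have "restrict V' test_functions = restrict V test_functions"
          using V' assms(2) by simp
        ultimately show ?thesis by (metis restrict_apply')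
      qed
      then show ?thesis
        using LIMSEQ_unique[OF tempered_functional_plateau_limit[OF conjunct1[OF V'] True]]
            tempered_functional_plateau_limit[OF V True] by simp
    next
      case False
      then show ?thesis using V V' by (simp add: tempered_functionals_def extensional_def)
    qed
  qed
qed (use assms in auto)

subsection \<open>The pairing with functions decaying on a half-line\<close>

text \<open>Left of \<open>-2\<close> only smoothness is asked, which admits
  \<open>exp (- s * x)\<close> with \<open>Re s > 0\<close>. The point \<open>-2\<close> is where
  \<open>left_step\<close> begins.\<close>

definition right_decaying :: "(real \<Rightarrow> complex) set" where
  "right_decaying = {g. smooth g \<and> (\<forall>j k. \<exists>B. \<forall>x\<ge>-2. (1 + \<bar>x\<bar>) ^ j * norm (nderiv k g x) \<le> B)}"

text \<open>Its transition over \<open>[-2, -1]\<close> leaves room before \<open>0\<close>: it is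
  \<open>1\<close> on the open set \<open>{-1<..}\<close>, a neighbourhood of the support of
  \<open>Y\<close> as \<open>left_cutoff\<close> demands.\<close>

definition left_step :: "real \<Rightarrow> complex" where
  "left_step x = step (x + 2)"

lemma smooth_left_step: "smooth left_step"
  unfolding left_step_def[abs_def] by (rule smooth_shift[OF smooth_step])

lemma nderiv_left_step: "nderiv k left_step = (\<lambda>x. nderiv k step (x + 2))"
  unfolding left_step_def[abs_def] by (rule nderiv_shift[OF smooth_step])

lemma left_step_1: "x \<ge> -1 \<Longrightarrow> left_step x = 1"
  by (simp add: left_step_def step_1)

lemma left_step_0: "x \<le> -2 \<Longrightarrow> left_step x = 0"
  by (simp add: left_step_def step_0)

lemma right_decaying_smooth: "g \<in> right_decaying \<Longrightarrow> smooth g"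
  by (simp add: right_decaying_def)

lemma schwartz_right_decaying: "schwartz_functions \<subseteq> right_decaying"
proof
  fix \<phi> assume "\<phi> \<in> schwartz_functions"
  then show "\<phi> \<in> right_decaying"
    unfolding right_decaying_def schwartz_iff mem_Collect_eq by meson
qed

lemma test_right_decaying: "test_functions \<subseteq> right_decaying"
  using test_subset_schwartz schwartz_right_decaying by blast

text \<open>All derivatives of \<open>left_step\<close> vanish left of \<open>-2\<close>, so bounds
  for \<open>g\<close> on \<open>[-2, \<infinity>)\<close> become bounds for the product on the
  whole line. The constant serves every weight \<open>j\<close>.\<close>

lemma left_step_mult_bound:
  "\<exists>C\<ge>0. \<forall>g B j. smooth g \<longrightarrow> (\<forall>i\<le>k. \<forall>x\<ge>-2. (1 + \<bar>x\<bar>) ^ j * norm (nderiv i g x) \<le> B) \<longrightarrow>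
     (\<forall>x. (1 + \<bar>x\<bar>) ^ j * norm (nderiv k (\<lambda>x. left_step x * g x) x) \<le> C * B)"
proof -
  have "\<forall>k. \<exists>B. \<forall>x. norm (nderiv k step x) \<le> B" using step_nderiv_bounded by blast
  from choice[OF this] obtain S where "\<forall>k x. norm (nderiv k step x) \<le> S k" ..
  then have S: "norm (nderiv k step x) \<le> S k" for k x by blast
  have S0: "S k \<ge> 0" for k using order_trans[OF norm_ge_zero S] .
  let ?C = "\<Sum>i\<le>k. of_nat (k choose i) * S i"
  have C0: "?C \<ge> 0" by (intro sum_nonneg mult_nonneg_nonneg S0) auto
  have "(1 + \<bar>x\<bar>) ^ j * norm (nderiv k (\<lambda>x. left_step x * g x) x) \<le> ?C * B"
    if g: "smooth g" and B: "\<forall>i\<le>k. \<forall>x\<ge>-2. (1 + \<bar>x\<bar>) ^ j * norm (nderiv i g x) \<le> B" for g B j x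
  proof -
    have "0 \<le> (1 + \<bar>0::real\<bar>) ^ j * norm (nderiv 0 g 0)" by simp
    also have "\<dots> \<le> B" using B[rule_format, of 0 0] by simp
    finally have B0: "B \<ge> 0" .
    have eq: "nderiv k (\<lambda>x. left_step x * g x) x =
        (\<Sum>i\<le>k. of_nat (k choose i) * nderiv i step (x + 2) * nderiv (k - i) g x)"
      by (simp only: nderiv_mult[OF smooth_left_step g] nderiv_left_step)
    show ?thesis
    proof (cases "x \<ge> -2")
      case True
      have "(1 + \<bar>x\<bar>) ^ j * norm (nderiv k (\<lambda>x. left_step x * g x) x) \<le>
          (1 + \<bar>x\<bar>) ^ j * (\<Sum>i\<le>k. of_nat (k choose i) * S i * norm (nderiv (k - i) g x))"
        unfolding eq
        by (intro mult_left_mono sum_norm_le) (auto simp: norm_mult intro!: mult_right_mono mult_left_mono S)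
      also have "\<dots> = (\<Sum>i\<le>k. of_nat (k choose i) * S i * ((1 + \<bar>x\<bar>) ^ j * norm (nderiv (k - i) g x)))"
        by (simp add: sum_distrib_left mult_ac)
      also have "\<dots> \<le> (\<Sum>i\<le>k. of_nat (k choose i) * S i * B)"
        by (intro sum_mono mult_left_mono mult_nonneg_nonneg S0) (use B True in auto)
      finally show ?thesis by (simp add: sum_distrib_right)
    next
      case False
      then show ?thesis unfolding eq using step_nderiv_neg C0 B0 by simp
    qed
  qed
  then show ?thesis using C0 by blast
qed

lemma left_step_mult_schwartz:
  assumes g: "g \<in> right_decaying" shows "(\<lambda>x. left_step x * g x) \<in> schwartz_functions"
  unfolding schwartz_iff
proof safe
  show "smooth (\<lambda>x. left_step x * g x)"
    by (rule smooth_mult[OF smooth_left_step right_decaying_smooth[OF g]])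
  fix j k
  obtain C where C: "C \<ge> 0" "\<forall>g B j. smooth g \<longrightarrow> (\<forall>i\<le>k. \<forall>x\<ge>-2. (1 + \<bar>x\<bar>) ^ j * norm (nderiv i g x) \<le> B) \<longrightarrow>
     (\<forall>x. (1 + \<bar>x\<bar>) ^ j * norm (nderiv k (\<lambda>x. left_step x * g x) x) \<le> C * B)"
    using left_step_mult_bound by blast
  have "\<forall>i. \<exists>B. \<forall>x\<ge>-2. (1 + \<bar>x\<bar>) ^ j * norm (nderiv i g x) \<le> B"
    using g by (simp add: right_decaying_def)
  from choice[OF this] obtain B where B: "\<forall>i. \<forall>x\<ge>-2. (1 + \<bar>x\<bar>) ^ j * norm (nderiv i g x) \<le> B i" ..
  have "(1 + \<bar>x\<bar>) ^ j * norm (nderiv i g x) \<le> Max (B ` {..k})" if "i \<le> k" "x \<ge> -2" for i x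
    using B that by (intro order_trans[OF _ Max_ge[of "B ` {..k}" "B i"]]) auto
  then have "\<forall>x. (1 + \<bar>x\<bar>) ^ j * norm (nderiv k (\<lambda>x. left_step x * g x) x) \<le> C * Max (B ` {..k})"
    using C(2) right_decaying_smooth[OF g] by blast
  then show "\<exists>B. \<forall>x. (1 + \<bar>x\<bar>) ^ j * norm (nderiv k (\<lambda>x. left_step x * g x) x) \<le> B" by blast
qed

lemma right_decaying_add:
  assumes f: "f \<in> right_decaying" and g: "g \<in> right_decaying"
  shows "(\<lambda>x. f x + g x) \<in> right_decaying"
  unfolding right_decaying_def
proof safe
  show "smooth (\<lambda>x. f x + g x)" by (intro smooth_add right_decaying_smooth f g)
  fix j k
  obtain A where A: "\<And>x. x \<ge> -2 \<Longrightarrow> (1 + \<bar>x\<bar>) ^ j * norm (nderiv k f x) \<le> A"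
    using f unfolding right_decaying_def by blast
  obtain B where B: "\<And>x. x \<ge> -2 \<Longrightarrow> (1 + \<bar>x\<bar>) ^ j * norm (nderiv k g x) \<le> B"
    using g unfolding right_decaying_def by blast
  have "(1 + \<bar>x\<bar>) ^ j * norm (nderiv k (\<lambda>x. f x + g x) x) \<le> A + B" if "x \<ge> -2" for x
  proof -
    have "(1 + \<bar>x\<bar>) ^ j * norm (nderiv k (\<lambda>x. f x + g x) x) \<le>
      (1 + \<bar>x\<bar>) ^ j * (norm (nderiv k f x) + norm (nderiv k g x))"
      unfolding nderiv_add[OF right_decaying_smooth[OF f] right_decaying_smooth[OF g]]
      by (intro mult_left_mono norm_triangle_ineq) auto
    then show ?thesis using A[OF that] B[OF that] by (simp add: ring_distribs)
  qed
  then show "\<exists>B. \<forall>x\<ge>-2. (1 + \<bar>x\<bar>) ^ j * norm (nderiv k (\<lambda>x. f x + g x) x) \<le> B" by blast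
qed

lemma right_decaying_cmult:
  assumes f: "f \<in> right_decaying"
  shows "(\<lambda>x. a * f x) \<in> right_decaying"
  unfolding right_decaying_def
proof safe
  show "smooth (\<lambda>x. a * f x)" by (intro smooth_cmult right_decaying_smooth f)
  fix j k
  obtain A where A: "\<And>x. x \<ge> -2 \<Longrightarrow> (1 + \<bar>x\<bar>) ^ j * norm (nderiv k f x) \<le> A"
    using f unfolding right_decaying_def by blast
  have "(1 + \<bar>x\<bar>) ^ j * norm (nderiv k (\<lambda>x. a * f x) x) \<le> norm a * A" if "x \<ge> -2" for x
    using mult_left_mono[OF A[OF that], of "norm a"]
    unfolding nderiv_cmult[OF right_decaying_smooth[OF f]] by (simp add: norm_mult mult_ac)
  then show "\<exists>B. \<forall>x\<ge>-2. (1 + \<bar>x\<bar>) ^ j * norm (nderiv k (\<lambda>x. a * f x) x) \<le> B" by blast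
qed

lemma right_decaying_diff:
  "f \<in> right_decaying \<Longrightarrow> g \<in> right_decaying \<Longrightarrow> (\<lambda>x. f x - g x) \<in> right_decaying"
  using right_decaying_add[of f "\<lambda>x. -1 * g x"] right_decaying_cmult[of g "-1"] by simp

lemma power_times_exp_bounded:
  fixes a :: real
  assumes "a > 0"
  obtains C where "C > 0" "\<forall>x\<ge>-2. (1 + \<bar>x\<bar>) ^ j * exp (- a * x) \<le> C"
proof -
  let ?h = "\<lambda>x::real. (1 + \<bar>x\<bar>) ^ j * exp (- a * x)"
  have "((\<lambda>x. (1 + x) ^ j * exp (- a * x)) \<longlongrightarrow> 0) at_top"
    using assms by real_asymp
  then have "eventually (\<lambda>x. (1 + x) ^ j * exp (- a * x) < 1) at_top"
    by (rule order_tendstoD) simp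
  then obtain X where X: "\<And>x. x \<ge> X \<Longrightarrow> (1 + x) ^ j * exp (- a * x) < 1"
    unfolding eventually_at_top_linorder by blast
  have "bounded (?h ` {-2..max X 0})"
    by (intro compact_imp_bounded compact_continuous_image continuous_intros) auto
  then obtain K where K: "K > 0" "\<forall>y\<in>?h ` {-2..max X 0}. norm y \<le> K"
    unfolding bounded_pos by blast
  have "?h x \<le> K + 1" if "x \<ge> -2" for x
  proof (cases "x \<le> max X 0")
    case True
    then have "norm (?h x) \<le> K" using K(2) that by auto
    then show ?thesis by simp
  next
    case False
    then have "X \<le> x" "x > 0" by auto
    then show ?thesis using X[of x] K(1) by simp
  qed
  then show ?thesis using that[of "K + 1"] K(1) by auto
qed

lemma norm_exp_mult_of_real: "norm (exp (z * complex_of_real x)) = exp (Re z * x)"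
  by (simp add: norm_exp_eq_Re)

lemma exp_right_decaying:
  assumes "Re s > 0" shows "(\<lambda>x. exp (- s * of_real x)) \<in> right_decaying"
  unfolding right_decaying_def
proof safe
  show "smooth (\<lambda>x. exp (- s * of_real x))" by (rule smooth_exp)
  fix j k
  obtain C where C: "C > 0" "\<forall>x\<ge>-2. (1 + \<bar>x\<bar>) ^ j * exp (- Re s * x) \<le> C"
    by (rule power_times_exp_bounded[OF assms])
  have "(1 + \<bar>x\<bar>) ^ j * norm (nderiv k (\<lambda>x. exp (- s * of_real x)) x) \<le> norm s ^ k * C" if "x \<ge> -2" for x
    unfolding nderiv_exp norm_mult norm_power norm_exp_mult_of_real
    using mult_left_mono[OF C(2)[rule_format, OF that], of "norm s ^ k"] by (simp add: mult_ac)
  then show "\<exists>B. \<forall>x\<ge>-2. (1 + \<bar>x\<bar>) ^ j * norm (nderiv k (\<lambda>x. exp (- s * of_real x)) x) \<le> B" by blast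
qed

section \<open>The causal distribution extended to functions decaying on the right\<close>

locale causal_tempered =
  fixes Y V :: functional
  assumes V: "V \<in> tempered_functionals"
    and Y_eq: "restrict V test_functions = Y"
    and causal: "dist_supp Y \<subseteq> {0..}"
begin

definition pairing :: functional where
  "pairing g = V (\<lambda>x. left_step x * g x)"

lemma V_lin: "linear_functional_on schwartz_functions V"
  using V by (simp add: tempered_functionals_def)

lemma Y_V: "\<phi> \<in> test_functions \<Longrightarrow> Y \<phi> = V \<phi>"
  using Y_eq by (metis restrict_apply')

lemma Y_lin: "linear_functional_on test_functions Y"
  using V_lin test_subset_schwartz unfolding linear_functional_on_def
  by (simp add: Y_V test_add test_cmult subset_iff)

text \<open>What \<open>left_step\<close> removes is supported in \<open>(-\<infinity>, -1]\<close>,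
  away from the support of \<open>Y\<close>; so the pairing, although built from \<open>V\<close>,
  extends \<open>Y\<close>.\<close>

lemma Y_pairing:
  assumes "\<phi> \<in> test_functions" shows "Y \<phi> = pairing \<phi>"
proof -
  have t: "(\<lambda>x. left_step x * \<phi> x) \<in> test_functions" by (rule test_mult_left[OF assms smooth_left_step])
  have t': "(\<lambda>x. \<phi> x - left_step x * \<phi> x) \<in> test_functions"
    using test_add[OF assms test_cmult[OF t, of "-1"]] by simp
  have "Y (\<lambda>x. \<phi> x - left_step x * \<phi> x) = 0"
  proof (rule functional_vanishes_off_support[OF Y_lin t'])
    have "fun_supp (\<lambda>x. \<phi> x - left_step x * \<phi> x) \<subseteq> {..-1}"
    proof (rule closure_subset_closed)
      show "{x. \<phi> x - left_step x * \<phi> x \<noteq> 0} \<subseteq> {..-1}"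
      proof safe
        show "x \<le> -1" if "\<phi> x - left_step x * \<phi> x \<noteq> 0" for x
          using that left_step_1[of x] by (cases "x \<ge> -1") auto
      qed
    qed simp
    then show "fun_supp (\<lambda>x. \<phi> x - left_step x * \<phi> x) \<inter> dist_supp Y = {}"
      using causal by force
  qed
  then have "Y \<phi> = Y (\<lambda>x. left_step x * \<phi> x)"
    using linear_functional_diff[OF Y_lin assms t test_cmult[OF t]] by simp
  then show ?thesis using Y_V[OF t] by (simp add: pairing_def)
qed

lemma pairing_add:
  assumes "f \<in> right_decaying" "g \<in> right_decaying"
  shows "pairing (\<lambda>x. f x + g x) = pairing f + pairing g"
  using linear_functional_add[OF V_lin left_step_mult_schwartz[OF assms(1)] left_step_mult_schwartz[OF assms(2)]]
  by (simp add: pairing_def ring_distribs)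

lemma pairing_cmult:
  assumes "f \<in> right_decaying"
  shows "pairing (\<lambda>x. a * f x) = a * pairing f"
  using linear_functional_cmult[OF V_lin left_step_mult_schwartz[OF assms], of a]
  by (simp add: pairing_def mult_ac)

lemma pairing_diff:
  assumes "f \<in> right_decaying" "g \<in> right_decaying"
  shows "pairing (\<lambda>x. f x - g x) = pairing f - pairing g"
  using pairing_add[OF assms(1) right_decaying_cmult[OF assms(2), of "-1"]] pairing_cmult[OF assms(2), of "-1"]
  by simp

lemma pairing_bound:
  obtains C m where "C > 0"
    "\<forall>g B. g \<in> right_decaying \<longrightarrow> (\<forall>k\<le>m. \<forall>x\<ge>-2. (1 + \<bar>x\<bar>) ^ m * norm (nderiv k g x) \<le> B) \<longrightarrow>
       norm (pairing g) \<le> C * B"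
proof -
  obtain C m where C: "C \<ge> 0"
    "\<forall>\<phi> B. \<phi> \<in> schwartz_functions \<longrightarrow> B \<ge> 0 \<longrightarrow>
       (\<forall>k x. k \<le> m \<longrightarrow> (1 + \<bar>x\<bar>) ^ m * norm (nderiv k \<phi> x) \<le> B) \<longrightarrow> norm (V \<phi>) \<le> C * B"
    by (rule tempered_functional_bound[OF V])
  have "\<forall>k. \<exists>D. D \<ge> 0 \<and> (\<forall>g B j. smooth g \<longrightarrow> (\<forall>i\<le>k. \<forall>x\<ge>-2. (1 + \<bar>x\<bar>) ^ j * norm (nderiv i g x) \<le> B) \<longrightarrow>
     (\<forall>x. (1 + \<bar>x\<bar>) ^ j * norm (nderiv k (\<lambda>x. left_step x * g x) x) \<le> D * B))"
    using left_step_mult_bound by blast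
  from choice[OF this] obtain D where DD: "\<forall>k. D k \<ge> 0 \<and> (\<forall>g B j. smooth g \<longrightarrow>
     (\<forall>i\<le>k. \<forall>x\<ge>-2. (1 + \<bar>x\<bar>) ^ j * norm (nderiv i g x) \<le> B) \<longrightarrow>
     (\<forall>x. (1 + \<bar>x\<bar>) ^ j * norm (nderiv k (\<lambda>x. left_step x * g x) x) \<le> D k * B))" ..
  have D0: "D k \<ge> 0" for k using DD by blast
  have D: "(1 + \<bar>x\<bar>) ^ j * norm (nderiv k (\<lambda>x. left_step x * g x) x) \<le> D k * B"
    if "smooth g" "\<forall>i\<le>k. \<forall>x\<ge>-2. (1 + \<bar>x\<bar>) ^ j * norm (nderiv i g x) \<le> B" for k g B j x
    using DD[rule_format, of k] that by blast
  show ?thesis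
  proof (rule that[of "C * (\<Sum>k\<le>m. D k) + 1" m], safe)
    show "C * (\<Sum>k\<le>m. D k) + 1 > 0"
      by (intro add_nonneg_pos mult_nonneg_nonneg sum_nonneg D0 C) auto
    fix g B assume g: "g \<in> right_decaying"
      and B: "\<forall>k\<le>m. \<forall>x\<ge>-2. (1 + \<bar>x\<bar>) ^ m * norm (nderiv k g x) \<le> B"
    have "0 \<le> (1 + \<bar>0::real\<bar>) ^ m * norm (nderiv 0 g 0)" by simp
    also have "\<dots> \<le> B" using B[rule_format, of 0 0] by simp
    finally have B0: "B \<ge> 0" .
    have "norm (pairing g) \<le> C * ((\<Sum>k\<le>m. D k) * B)"
      unfolding pairing_def
    proof (rule C(2)[rule_format, OF left_step_mult_schwartz[OF g]])
      show "0 \<le> (\<Sum>k\<le>m. D k) * B" by (intro mult_nonneg_nonneg sum_nonneg D0 B0)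
      fix k x assume k: "k \<le> m"
      have "(1 + \<bar>x\<bar>) ^ m * norm (nderiv k (\<lambda>x. left_step x * g x) x) \<le> D k * B"
        by (rule D[OF right_decaying_smooth[OF g]]) (use B k in auto)
      also have "\<dots> \<le> (\<Sum>k\<le>m. D k) * B"
        using k D0 B0 by (intro mult_right_mono member_le_sum) auto
      finally show "(1 + \<bar>x\<bar>) ^ m * norm (nderiv k (\<lambda>x. left_step x * g x) x) \<le> (\<Sum>k\<le>m. D k) * B" .
    qed
    also have "\<dots> \<le> (C * (\<Sum>k\<le>m. D k) + 1) * B" using B0 by (simp add: ring_distribs)
    finally show "norm (pairing g) \<le> (C * (\<Sum>k\<le>m. D k) + 1) * B" .
  qed
qed

subsection \<open>The Laplace transform\<close>

lemma laplace_abscissa_0: "laplace_abscissa Y 0"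
proof -
  have "mult_dist (\<lambda>\<tau>. 1) Y = Y"
    unfolding mult_dist_def Y_eq[symmetric] by auto
  then show ?thesis using V Y_eq by (auto simp: laplace_abscissa_def tempered_def)
qed

text \<open>The description in \<open>laplace\<close> needs a witness, here \<open>c = 0\<close>
  with \<open>left_step\<close>, and independence of \<open>c\<close> and of the cut-off.
  \<open>Y\<close> itself does not act on the functions involved, so independence is checked after
  truncation by \<open>plateau n\<close> and carried to the limit in both tempered
  functionals.\<close>

lemma laplace_eq_pairing:
  assumes s: "Re s > 0"
  shows "laplace Y s = pairing (\<lambda>x. exp (- s * of_real x))"
proof -
  let ?w = "pairing (\<lambda>x. exp (- s * of_real x))"
  let ?P = "\<lambda>w c \<rho>. laplace_abscissa Y c \<and> c < Re s \<and> left_cutoff Y \<rho> \<and>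
        (\<lambda>\<xi>. \<rho> \<xi> * exp (- (s - of_real c) * of_real \<xi>)) \<in> schwartz_functions \<and>
        w = tempered_extension (mult_dist (\<lambda>\<tau>. of_real (exp (- c * \<tau>))) Y)
              (\<lambda>\<xi>. \<rho> \<xi> * exp (- (s - of_real c) * of_real \<xi>))"
  let ?e = "\<lambda>x. left_step x * exp (- s * of_real x)"
  have e: "?e \<in> schwartz_functions" by (rule left_step_mult_schwartz[OF exp_right_decaying[OF s]])
  have cutoff: "left_cutoff Y left_step"
    unfolding left_cutoff_def
  proof (intro conjI exI)
    show "smooth left_step" by (rule smooth_left_step)
    have "fun_supp left_step \<subseteq> {-2..}"
    proof (rule closure_subset_closed)
      show "{x. left_step x \<noteq> 0} \<subseteq> {-2..}"
      proof safe
        show "x \<ge> -2" if "left_step x \<noteq> 0" for x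
          using that left_step_0[of x] by (cases "x \<le> -2") auto
      qed
    qed simp
    then show "bdd_below (fun_supp left_step)" by (meson bdd_below_mono bdd_below_Ici)
    show "open {-1::real<..}" by simp
    show "dist_supp Y \<subseteq> {-1<..}" using causal by force
    show "\<forall>x\<in>{-1<..}. left_step x = 1" by (auto simp: left_step_1)
  qed
  have m1: "mult_dist (\<lambda>\<tau>. of_real (exp (- 0 * \<tau>))) Y = Y"
    unfolding mult_dist_def Y_eq[symmetric] by auto
  have ex: "?P ?w 0 left_step"
    using laplace_abscissa_0 s cutoff e m1 tempered_extension_eq[OF V Y_eq]
    by (simp add: pairing_def)
  have uniq: "w = ?w" if P: "?P w c \<rho>" for w c \<rho>
  proof -
    let ?T = "mult_dist (\<lambda>\<tau>. of_real (exp (- c * \<tau>))) Y"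
    let ?h = "\<lambda>\<xi>. \<rho> \<xi> * exp (- (s - of_real c) * of_real \<xi>)"
    from P obtain V' where V': "V' \<in> tempered_functionals" "restrict V' test_functions = ?T"
      by (auto simp: laplace_abscissa_def tempered_def)
    have h: "?h \<in> schwartz_functions" using P by blast
    have w: "w = V' ?h" using P tempered_extension_eq[OF V'] by simp
    obtain G where G: "open G" "dist_supp Y \<subseteq> G" "\<forall>x\<in>G. \<rho> x = 1" and \<rho>: "smooth \<rho>"
      using P unfolding left_cutoff_def by blast
    have "V' (\<lambda>x. plateau n x * ?h x) = V (\<lambda>x. plateau n x * ?e x)" for n
    proof -
      let ?a = "\<lambda>x. plateau n x * (\<rho> x * exp (- s * of_real x))"
      let ?b = "\<lambda>x. plateau n x * (left_step x * exp (- s * of_real x))"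
      have a: "?a \<in> test_functions" by (intro plateau_mult_test smooth_mult[OF \<rho> smooth_exp])
      have b: "?b \<in> test_functions" by (intro plateau_mult_test smooth_mult[OF smooth_left_step smooth_exp])
      have ph: "(\<lambda>x. plateau n x * ?h x) \<in> test_functions"
        by (intro plateau_mult_test schwartz_smooth[OF h])
      have "V' (\<lambda>x. plateau n x * ?h x) = ?T (\<lambda>x. plateau n x * ?h x)"
        using ph unfolding V'(2)[symmetric] by simp
      also have "\<dots> = Y (\<lambda>x. of_real (exp (- c * x)) * (plateau n x * ?h x))"
        using ph by (simp add: mult_dist_def)
      \<comment> \<open>The weight contained in \<open>?T\<close> cancels the shift by
        \<open>c\<close> in the exponent, so \<open>c\<close> disappears.\<close>
      also have "(\<lambda>x. of_real (exp (- c * x)) * (plateau n x * ?h x)) = ?a"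
      proof
        fix x
        have "exp (- s * of_real x) = of_real (exp (- c * x)) * exp (- (s - of_real c) * of_real x)"
          by (simp add: exp_of_real[symmetric] exp_add[symmetric] algebra_simps)
        then show "of_real (exp (- c * x)) * (plateau n x * ?h x) = ?a x" by (simp add: mult_ac)
      qed
      also have "Y ?a = Y ?b"
      proof -
        have t: "(\<lambda>x. ?a x - ?b x) \<in> test_functions"
          using test_add[OF a test_cmult[OF b, of "-1"]] by simp
        have "Y (\<lambda>x. ?a x - ?b x) = 0"
        proof (rule functional_vanishes_off_support[OF Y_lin t])
          \<comment> \<open>Both cut-offs equal \<open>1\<close> on
            \<open>G \<inter> {-1<..}\<close>, an open set that contains the support of
            \<open>Y\<close>.\<close>
          have "fun_supp (\<lambda>x. ?a x - ?b x) \<subseteq> - (G \<inter> {-1<..})"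
          proof (rule closure_subset_closed)
            show "closed (- (G \<inter> {-1<..}))" by (rule closed_Compl[OF open_Int[OF G(1) open_greaterThan]])
            show "{x. ?a x - ?b x \<noteq> 0} \<subseteq> - (G \<inter> {-1<..})" using G(3) by (auto simp: left_step_1)
          qed
          moreover have "dist_supp Y \<subseteq> G \<inter> {-1<..}" using G(2) causal by force
          ultimately show "fun_supp (\<lambda>x. ?a x - ?b x) \<inter> dist_supp Y = {}" by blast
        qed
        then show ?thesis
          using linear_functional_diff[OF Y_lin a b test_cmult[OF b]] by simp
      qed
      also have "\<dots> = V ?b" by (rule Y_V[OF b])
      finally show ?thesis .
    qed
    then have "V' ?h = V ?e"
      using LIMSEQ_unique[OF tempered_functional_plateau_limit[OF V'(1) h] ]
        tempered_functional_plateau_limit[OF V e] by simp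
    then show ?thesis using w by (simp add: pairing_def)
  qed
  show ?thesis
    unfolding laplace_def
  proof (rule the_equality)
    show "\<exists>c \<rho>. ?P ?w c \<rho>"
      by (rule exI[of _ 0], rule exI[of _ left_step], rule ex)
    show "w = ?w" if "\<exists>c \<rho>. ?P w c \<rho>" for w
      using that by (elim exE) (rule uniq)
  qed
qed

end

subsection \<open>Differentiation under the pairing\<close>

text \<open>Normed spaces are kept arbitrary so that one criterion serves a complex parameter (the
  frequency) and a real one (time).\<close>

lemma has_derivative_quadratic:
  fixes W :: "'p::real_normed_vector \<Rightarrow> 'q::real_normed_vector"
  assumes "bounded_linear W'" and e: "e > 0"
    and quad: "\<And>r. norm (r - t) < e \<Longrightarrow> norm (W r - W t - W' (r - t)) \<le> C * (norm (r - t))\<^sup>2"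
  shows "(W has_derivative W') (at t)"
  unfolding has_derivative_at_alt
proof (intro conjI allI impI)
  fix \<epsilon> :: real assume \<epsilon>: "\<epsilon> > 0"
  define d where "d = min e (\<epsilon> / (\<bar>C\<bar> + 1))"
  have "norm (W r - W t - W' (r - t)) \<le> \<epsilon> * norm (r - t)" if "norm (r - t) < d" for r
  proof -
    have "norm (W r - W t - W' (r - t)) \<le> C * (norm (r - t))\<^sup>2"
      using that by (intro quad) (simp add: d_def)
    also have "\<dots> \<le> (\<bar>C\<bar> + 1) * norm (r - t) * norm (r - t)"
      unfolding power2_eq_square mult.assoc by (intro mult_right_mono) auto
    also have "\<dots> \<le> \<epsilon> * norm (r - t)"
    proof (intro mult_right_mono)
      have "norm (r - t) \<le> \<epsilon> / (\<bar>C\<bar> + 1)" using that by (simp add: d_def)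
      then show "(\<bar>C\<bar> + 1) * norm (r - t) \<le> \<epsilon>"
        by (simp add: pos_le_divide_eq mult.commute add_nonneg_pos)
    qed simp
    finally show ?thesis .
  qed
  moreover have "d > 0" using e \<epsilon> by (simp add: d_def add_nonneg_pos)
  ultimately show "\<exists>d>0. \<forall>r. norm (r - t) < d \<longrightarrow> norm (W r - W t - W' (r - t)) \<le> \<epsilon> * norm (r - t)" by blast
qed (fact assms(1))

text \<open>The mean value inequality used twice: for \<open>g'\<close>, then for the linearization
  error of \<open>g\<close>. Derivatives are taken within the interval, the form in which the
  fundamental theorem of calculus provides them for a variable upper limit.\<close>

lemma vector_taylor_quadratic:
  fixes g :: "real \<Rightarrow> 'b::real_normed_vector"
  assumes g: "\<And>x. x \<in> {a..b} \<Longrightarrow> (g has_vector_derivative g' x) (at x within {a..b})"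
    and g': "\<And>x. x \<in> {a..b} \<Longrightarrow> (g' has_vector_derivative g'' x) (at x within {a..b})"
    and B: "\<And>x. x \<in> {a..b} \<Longrightarrow> norm (g'' x) \<le> B"
    and t: "t \<in> {a..b}" and r: "r \<in> {a..b}"
  shows "norm (g r - g t - (r - t) *\<^sub>R g' t) \<le> B * (norm (r - t))\<^sup>2"
proof -
  let ?S = "closed_segment t r"
  have S: "?S \<subseteq> {a..b}" using t r by (auto simp: closed_segment_eq_real_ivl split: if_splits)
  have "0 \<le> B" using B[OF t] norm_ge_zero order_trans by blast
  have "norm (g' x - g' t) \<le> norm (r - t) * B" if x: "x \<in> ?S" for x
  proof -
    have "norm (g' x - g' t) \<le> B * norm (x - t)"
    proof (rule differentiable_bound[of "{a..b}" g' "\<lambda>x h. h *\<^sub>R g'' x"])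
      show "(g' has_derivative (\<lambda>h. h *\<^sub>R g'' y)) (at y within {a..b})" if "y \<in> {a..b}" for y
        using g'[OF that] by (simp add: has_vector_derivative_def)
      show "onorm (\<lambda>h. h *\<^sub>R g'' y) \<le> B" if "y \<in> {a..b}" for y
      proof (rule onorm_le)
        show "norm (h *\<^sub>R g'' y) \<le> B * norm h" for h
          using mult_right_mono[OF B[OF that], of "\<bar>h\<bar>"] by (simp add: mult.commute)
      qed
    qed (use S t x in auto)
    also have "\<dots> \<le> B * norm (r - t)"
      using x \<open>0 \<le> B\<close> by (intro mult_left_mono) (auto simp: closed_segment_eq_real_ivl split: if_splits)
    finally show ?thesis by (simp add: mult.commute)
  qed
  moreover have "(g has_vector_derivative g' x) (at x within ?S)" if "x \<in> ?S" for x
    using has_vector_derivative_within_subset[OF g S] that S by blast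
  ultimately have "norm (g r - g t - (r - t) *\<^sub>R g' t) \<le> norm (r - t) * (norm (r - t) * B)"
    by (intro vector_differentiable_bound_linearization[of ?S]) auto
  then show ?thesis by (simp add: power2_eq_square mult_ac)
qed

context causal_tempered
begin

text \<open>A remainder that is quadratically small in every weighted seminorm stays so after
  pairing, by \<open>pairing_bound\<close>. \<open>L\<close> is the identity for a complex parameter
  and \<open>of_real\<close> for a real one; \<open>A\<close> is the derivative of the family at
  \<open>t\<close>.\<close>

lemma pairing_has_derivative:
  fixes \<Phi> :: "'p::real_normed_vector \<Rightarrow> real \<Rightarrow> complex"
  assumes L: "bounded_linear L" and e: "e > 0"
    and \<Phi>: "\<And>r. norm (r - t) < e \<Longrightarrow> \<Phi> r \<in> right_decaying" and A: "A \<in> right_decaying"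
    and quad: "\<And>j k. \<exists>B. \<forall>r x. norm (r - t) < e \<longrightarrow> x \<ge> -2 \<longrightarrow>
      (1 + \<bar>x\<bar>) ^ j * norm (nderiv k (\<Phi> r) x - nderiv k (\<Phi> t) x - L (r - t) * nderiv k A x) \<le> B * (norm (r - t))\<^sup>2"
  shows "((\<lambda>r. pairing (\<Phi> r)) has_derivative (\<lambda>h. L h * pairing A)) (at t)"
proof -
  obtain C m where C: "C > 0" "\<forall>g B. g \<in> right_decaying \<longrightarrow>
      (\<forall>k\<le>m. \<forall>x\<ge>-2. (1 + \<bar>x\<bar>) ^ m * norm (nderiv k g x) \<le> B) \<longrightarrow> norm (pairing g) \<le> C * B"
    by (rule pairing_bound)
  have "\<forall>k. \<exists>B. \<forall>r x. norm (r - t) < e \<longrightarrow> x \<ge> -2 \<longrightarrow>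
      (1 + \<bar>x\<bar>) ^ m * norm (nderiv k (\<Phi> r) x - nderiv k (\<Phi> t) x - L (r - t) * nderiv k A x) \<le> B * (norm (r - t))\<^sup>2"
    using quad by blast
  from choice[OF this] obtain B where B: "\<forall>k r x. norm (r - t) < e \<longrightarrow> x \<ge> -2 \<longrightarrow>
      (1 + \<bar>x\<bar>) ^ m * norm (nderiv k (\<Phi> r) x - nderiv k (\<Phi> t) x - L (r - t) * nderiv k A x) \<le> B k * (norm (r - t))\<^sup>2" ..
  define M where "M = Max (B ` {..m})"
  show ?thesis
  proof (rule has_derivative_quadratic[OF _ e])
    show "bounded_linear (\<lambda>h. L h * pairing A)" by (rule bounded_linear_mult_const[OF L])
    fix r assume r: "norm (r - t) < e"
    have t: "\<Phi> t \<in> right_decaying" using \<Phi>[of t] e by simp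
    let ?g = "\<lambda>x. \<Phi> r x - \<Phi> t x"
    have g: "?g \<in> right_decaying" by (rule right_decaying_diff[OF \<Phi>[OF r] t])
    have LA: "(\<lambda>x. L (r - t) * A x) \<in> right_decaying" by (rule right_decaying_cmult[OF A])
    have "norm (pairing (\<lambda>x. ?g x - L (r - t) * A x)) \<le> C * (M * (norm (r - t))\<^sup>2)"
    proof (rule C(2)[rule_format, OF right_decaying_diff[OF g LA]])
      fix k x assume k: "k \<le> m" and x: "(x::real) \<ge> -2"
      have eq: "nderiv k (\<lambda>x. ?g x - L (r - t) * A x) x =
          nderiv k (\<Phi> r) x - nderiv k (\<Phi> t) x - L (r - t) * nderiv k A x"
        using r t g LA A \<Phi>[OF r]
        by (simp add: nderiv_diff[OF right_decaying_smooth right_decaying_smooth]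
            nderiv_cmult[OF right_decaying_smooth])
      have "B k \<le> M" unfolding M_def using k by (intro Max_ge) auto
      then have "B k * (norm (r - t))\<^sup>2 \<le> M * (norm (r - t))\<^sup>2" by (intro mult_right_mono) auto
      then show "(1 + \<bar>x\<bar>) ^ m * norm (nderiv k (\<lambda>x. ?g x - L (r - t) * A x) x) \<le> M * (norm (r - t))\<^sup>2"
        unfolding eq using B[rule_format, OF r x, of k] by linarith
    qed
    then show "norm (pairing (\<Phi> r) - pairing (\<Phi> t) - L (r - t) * pairing A) \<le> C * M * (norm (r - t))\<^sup>2"
      unfolding pairing_diff[OF g LA] pairing_diff[OF \<Phi>[OF r] t] pairing_cmult[OF A] by (simp only: mult.assoc)
  qed
qed

end

text \<open>This function is the derivative of \<open>exp (- s * x)\<close> with respect to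
  \<open>s\<close>. In the formula the truncated exponent \<open>k - 1\<close> at
  \<open>k = 0\<close> is harmless, since it is multiplied by \<open>of_nat k\<close>.\<close>

lemma
  shows smooth_mult_exp: "smooth (\<lambda>x. - of_real x * exp (- s * of_real x))"
    and nderiv_mult_exp: "nderiv k (\<lambda>x. - of_real x * exp (- s * of_real x)) =
      (\<lambda>x. - (of_nat k * (- s) ^ (k - 1) + of_real x * (- s) ^ k) * exp (- s * of_real x))"
proof -
  let ?D = "\<lambda>k x. - (of_nat k * (- s) ^ (k - 1) + of_real x * (- s) ^ k) * exp (- s * of_real x)"
  have "(?D k has_vector_derivative ?D (Suc k) x) (at x)" for k and x :: real
  proof -
    have p: "of_nat k * (- s) ^ (k - 1) * s = - (of_nat k * (- s) ^ k)" by (cases k) auto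
    have "((\<lambda>w. - (of_nat k * (- s) ^ (k - 1) + w * (- s) ^ k) * exp (- s * w)) has_field_derivative
        - ((- s) ^ k) * exp (- s * of_real x) +
        (of_nat k * (- s) ^ (k - 1) * s + of_real x * (- s) ^ k * s) * exp (- s * of_real x)) (at (of_real x))"
      by (rule derivative_eq_intros refl | simp add: algebra_simps)+
    then have "((\<lambda>w. - (of_nat k * (- s) ^ (k - 1) + w * (- s) ^ k) * exp (- s * w)) has_field_derivative
        ?D (Suc k) x) (at (of_real x))"
      unfolding p by (simp add: algebra_simps)
    then show ?thesis by (rule has_vector_derivative_real_field)
  qed
  note * = smooth_tower[where D="?D", OF _ this]
  show "smooth (\<lambda>x. - of_real x * exp (- s * of_real x))" by (rule *) (simp add: fun_eq_iff)
  show "nderiv k (\<lambda>x. - of_real x * exp (- s * of_real x)) = ?D k" by (rule *) (simp add: fun_eq_iff)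
qed

text \<open>Gives one decay rate \<open>\<sigma>\<close> for all \<open>z\<close> in a region. For
  negative \<open>x\<close> the inequality \<open>\<sigma> \<le> Re z\<close> works the wrong way,
  but because \<open>x \<ge> -2\<close> the loss is at most \<open>exp (2 * R)\<close>.\<close>

lemma exp_times_le:
  fixes x :: real
  assumes "0 < \<sigma>" "\<sigma> \<le> Re z" "norm z \<le> R" "x \<ge> -2"
  shows "exp (- Re z * x) \<le> exp (2 * R) * exp (- \<sigma> * x)"
proof -
  have "(Re z - \<sigma>) * (- x) \<le> (Re z - \<sigma>) * 2" using assms by (intro mult_left_mono) auto
  moreover have "Re z \<le> R" using assms(3) complex_Re_le_cmod[of z] by linarith
  ultimately have "- Re z * x \<le> 2 * R - \<sigma> * x" using assms(1) by (simp add: algebra_simps)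
  then show ?thesis by (simp add: exp_add[symmetric])
qed

lemma mult_exp_right_decaying:
  assumes "Re s > 0" shows "(\<lambda>x. - of_real x * exp (- s * of_real x)) \<in> right_decaying"
  unfolding right_decaying_def
proof safe
  show "smooth (\<lambda>x. - of_real x * exp (- s * of_real x))" by (rule smooth_mult_exp)
  fix j k
  \<comment> \<open>The additional power of the weight absorbs the factor \<open>x\<close>.\<close>
  obtain C where C: "C > 0" "\<forall>x\<ge>-2. (1 + \<bar>x\<bar>) ^ Suc j * exp (- Re s * x) \<le> C"
    by (rule power_times_exp_bounded[OF assms])
  let ?K = "real k * norm s ^ (k - 1) + norm s ^ k"
  have "(1 + \<bar>x\<bar>) ^ j * norm (nderiv k (\<lambda>x. - of_real x * exp (- s * of_real x)) x) \<le> ?K * C" if "x \<ge> -2" for x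
  proof -
    have "norm (of_nat k * (- s) ^ (k - 1) + of_real x * (- s) ^ k) \<le> real k * norm s ^ (k - 1) + \<bar>x\<bar> * norm s ^ k"
      by (rule order_trans[OF norm_triangle_ineq]) (simp add: norm_mult norm_power)
    also have "\<dots> \<le> (1 + \<bar>x\<bar>) * ?K" by (simp add: algebra_simps)
    finally have "norm (nderiv k (\<lambda>x. - of_real x * exp (- s * of_real x)) x) \<le> (1 + \<bar>x\<bar>) * ?K * exp (- Re s * x)"
      unfolding nderiv_mult_exp norm_mult norm_minus_cancel norm_exp_mult_of_real uminus_complex.sel
      by (intro mult_right_mono) auto
    then have "(1 + \<bar>x\<bar>) ^ j * norm (nderiv k (\<lambda>x. - of_real x * exp (- s * of_real x)) x) \<le>
        (1 + \<bar>x\<bar>) ^ j * ((1 + \<bar>x\<bar>) * ?K * exp (- Re s * x))"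
      by (intro mult_left_mono) auto
    also have "\<dots> = ?K * ((1 + \<bar>x\<bar>) ^ Suc j * exp (- Re s * x))" by (simp add: mult_ac)
    also have "\<dots> \<le> ?K * C" using C(2) that by (intro mult_left_mono) auto
    finally show ?thesis .
  qed
  then show "\<exists>B. \<forall>x\<ge>-2. (1 + \<bar>x\<bar>) ^ j * norm (nderiv k (\<lambda>x. - of_real x * exp (- s * of_real x)) x) \<le> B" by blast
qed

lemma exp_taylor_quadratic:
  fixes z w :: complex and x R \<sigma> :: real
  assumes z: "z \<in> S" and w: "w \<in> S" and S: "convex S" "\<And>z. z \<in> S \<Longrightarrow> \<sigma> \<le> Re z \<and> norm z \<le> R"
    and R: "R \<ge> 1" and \<sigma>: "\<sigma> > 0" and x: "x \<ge> -2"
  shows "norm (nderiv k (\<lambda>x. exp (- z * of_real x)) x - nderiv k (\<lambda>x. exp (- w * of_real x)) x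
      - (z - w) * nderiv k (\<lambda>x. - of_real x * exp (- w * of_real x)) x)
    \<le> (R ^ k * (real k + 1)\<^sup>2 * exp (2 * R)) * ((1 + \<bar>x\<bar>)\<^sup>2 * exp (- \<sigma> * x)) * (norm (z - w))\<^sup>2"
proof -
  let ?B = "(R ^ k * (real k + 1)\<^sup>2 * exp (2 * R)) * ((1 + \<bar>x\<bar>)\<^sup>2 * exp (- \<sigma> * x))"
  \<comment> \<open>\<open>p0\<close> is the \<open>k\<close>-th derivative in \<open>x\<close> seen
    as a function of the frequency; \<open>p1\<close> and \<open>p2\<close> are its next two
    derivatives in the frequency. That \<open>p1\<close> agrees with \<open>nderiv_mult_exp\<close>
    means that both kinds of differentiation commute.\<close>
  define p0 :: "complex \<Rightarrow> complex" where "p0 z = (- z) ^ k * exp (- z * of_real x)" for z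
  define p1 :: "complex \<Rightarrow> complex" where "p1 z = - (of_nat k * (- z) ^ (k - 1) + of_real x * (- z) ^ k) * exp (- z * of_real x)" for z
  define p2 :: "complex \<Rightarrow> complex" where "p2 z = (of_nat k * of_nat (k - 1) * (- z) ^ (k - 1 - 1) + 2 * of_real x * of_nat k * (- z) ^ (k - 1)
      + (of_real x)\<^sup>2 * (- z) ^ k) * exp (- z * of_real x)" for z
  define f where "f i = (if i = 0 then p0 else if i = 1 then p1 else p2)" for i :: nat
  have d0: "(p0 has_field_derivative p1 z) (at z within S)" for z
    unfolding p0_def[abs_def] p1_def
    by (rule derivative_eq_intros refl | simp add: algebra_simps)+
  have d1: "(p1 has_field_derivative p2 z) (at z within S)" for z
    unfolding p1_def[abs_def] p2_def
    by (rule derivative_eq_intros refl | simp add: algebra_simps power2_eq_square)+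
  have "norm (f 0 z - (\<Sum>i\<le>1. f i w * (z - w) ^ i / fact i)) \<le> ?B * norm (z - w) ^ Suc 1 / fact 1"
  proof (rule complex_Taylor[OF S(1) _ _ w z])
    show "(f i has_field_derivative f (Suc i) y) (at y within S)" if "i \<le> 1" for i y
      using that d0 d1 by (cases i) (auto simp: f_def)
    show "norm (f (Suc 1) y) \<le> ?B" if y: "y \<in> S" for y
    proof -
      have pw: "norm y ^ i \<le> R ^ k" if "i \<le> k" for i
      proof -
        have "norm y ^ i \<le> R ^ i" using S(2)[OF y] by (intro power_mono) auto
        also have "\<dots> \<le> R ^ k" using R that by (intro power_increasing) auto
        finally show ?thesis .
      qed
      have kk: "real k * real (k - 1) \<le> real k * real k" by (intro mult_left_mono) auto
      have "norm (of_nat k * of_nat (k - 1) * (- y) ^ (k - 1 - 1) + 2 * of_real x * of_nat k * (- y) ^ (k - 1)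
          + (of_real x)\<^sup>2 * (- y) ^ k) \<le> real k * real (k - 1) * norm y ^ (k - 1 - 1) +
          2 * \<bar>x\<bar> * real k * norm y ^ (k - 1) + \<bar>x\<bar>\<^sup>2 * norm y ^ k"
        by (intro order_trans[OF norm_triangle_ineq] add_mono) (simp_all add: norm_mult norm_power)
      also have "\<dots> \<le> real k * real k * R ^ k + 2 * \<bar>x\<bar> * real k * R ^ k + \<bar>x\<bar>\<^sup>2 * R ^ k"
        using R by (intro add_mono mult_mono pw kk) auto
      \<comment> \<open>The three coefficients of \<open>p2\<close> form a perfect square once all
        powers of the norm are replaced by \<open>R ^ k\<close>, which \<open>R \<ge> 1\<close>
        permits.\<close>
      also have "\<dots> = R ^ k * (real k + \<bar>x\<bar>)\<^sup>2" by (simp add: power2_eq_square algebra_simps)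
      also have "\<dots> \<le> R ^ k * ((real k + 1) * (1 + \<bar>x\<bar>))\<^sup>2"
        using R by (intro mult_left_mono power_mono) (auto simp: algebra_simps)
      finally have "norm (p2 y) \<le> (R ^ k * ((real k + 1) * (1 + \<bar>x\<bar>))\<^sup>2) * (exp (2 * R) * exp (- \<sigma> * x))"
        unfolding p2_def norm_mult[of _ "exp _"] norm_exp_mult_of_real uminus_complex.sel
        using exp_times_le[OF \<sigma> _ _ x, of y R] S(2)[OF y] R
        by (intro mult_mono) auto
      then show ?thesis by (simp add: f_def power_mult_distrib mult_ac)
    qed
  qed
  then have "norm (p0 z - p0 w - p1 w * (z - w)) \<le> ?B * (norm (z - w))\<^sup>2"
    by (simp add: f_def power2_eq_square algebra_simps)
  then show ?thesis
    unfolding nderiv_exp nderiv_mult_exp p0_def p1_def by (simp add: mult_ac)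
qed

context causal_tempered
begin

lemma pairing_exp_has_field_derivative:
  assumes s: "Re s > 0"
  shows "((\<lambda>z. pairing (\<lambda>x. exp (- z * of_real x))) has_field_derivative
    pairing (\<lambda>x. - of_real x * exp (- s * of_real x))) (at s)"
proof -
  \<comment> \<open>Half of \<open>Re s\<close> keeps the ball around \<open>s\<close> inside
    \<open>Re z \<ge> \<sigma>\<close>, so one decay rate serves all nearby frequencies; the
    \<open>1\<close> in \<open>R\<close> secures \<open>R \<ge> 1\<close>.\<close>
  define \<sigma> where "\<sigma> = Re s / 2"
  define R where "R = norm s + \<sigma> + 1"
  have \<sigma>: "\<sigma> > 0" using s by (simp add: \<sigma>_def)
  have R: "R \<ge> 1" using \<sigma> by (simp add: R_def)
  have S: "\<sigma> \<le> Re z \<and> norm z \<le> R" if "z \<in> ball s \<sigma>" for z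
  proof -
    have "norm (z - s) < \<sigma>" using that by (simp add: dist_norm norm_minus_commute)
    moreover have "\<bar>Re (z - s)\<bar> \<le> norm (z - s)" by (rule abs_Re_le_cmod)
    moreover have "norm z \<le> norm s + norm (z - s)" using norm_triangle_ineq[of s "z - s"] by simp
    ultimately show ?thesis by (simp add: \<sigma>_def R_def)
  qed
  have "((\<lambda>z. pairing (\<lambda>x. exp (- z * of_real x))) has_derivative
      (\<lambda>h. h * pairing (\<lambda>x. - of_real x * exp (- s * of_real x)))) (at s)"
  proof (rule pairing_has_derivative[OF bounded_linear_ident \<sigma>])
    show "(\<lambda>x. exp (- z * of_real x)) \<in> right_decaying" if "norm (z - s) < \<sigma>" for z
    proof (rule exp_right_decaying)
      have "z \<in> ball s \<sigma>" using that by (simp add: dist_norm norm_minus_commute)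
      from S[OF this] show "Re z > 0" using \<sigma> by linarith
    qed
    show "(\<lambda>x. - of_real x * exp (- s * of_real x)) \<in> right_decaying" by (rule mult_exp_right_decaying[OF s])
    fix j k
    obtain C where C: "C > 0" "\<forall>x\<ge>-2. (1 + \<bar>x\<bar>) ^ (j + 2) * exp (- \<sigma> * x) \<le> C"
      by (rule power_times_exp_bounded[OF \<sigma>])
    let ?K = "R ^ k * (real k + 1)\<^sup>2 * exp (2 * R)"
    have "(1 + \<bar>x\<bar>) ^ j * norm (nderiv k (\<lambda>x. exp (- z * of_real x)) x - nderiv k (\<lambda>x. exp (- s * of_real x)) x
          - (z - s) * nderiv k (\<lambda>x. - of_real x * exp (- s * of_real x)) x) \<le> ?K * C * (norm (z - s))\<^sup>2"
      (is "_ * ?n \<le> _") if z: "norm (z - s) < \<sigma>" and x: "x \<ge> -2" for z x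
    proof -
      have "?n \<le> ?K * ((1 + \<bar>x\<bar>)\<^sup>2 * exp (- \<sigma> * x)) * (norm (z - s))\<^sup>2"
        by (rule exp_taylor_quadratic[OF _ _ convex_ball S R \<sigma> x])
          (use z \<sigma> in \<open>auto simp: dist_norm norm_minus_commute\<close>)
      then have "(1 + \<bar>x\<bar>) ^ j * ?n \<le> (1 + \<bar>x\<bar>) ^ j * (?K * ((1 + \<bar>x\<bar>)\<^sup>2 * exp (- \<sigma> * x)) * (norm (z - s))\<^sup>2)"
        by (intro mult_left_mono) auto
      also have "\<dots> = ?K * ((1 + \<bar>x\<bar>) ^ (j + 2) * exp (- \<sigma> * x)) * (norm (z - s))\<^sup>2"
        by (simp add: power_add power2_eq_square mult_ac)
      also have "\<dots> \<le> ?K * C * (norm (z - s))\<^sup>2"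
        using C(2) x R by (intro mult_right_mono mult_left_mono) auto
      finally show ?thesis .
    qed
    then show "\<exists>B. \<forall>z x. norm (z - s) < \<sigma> \<longrightarrow> x \<ge> -2 \<longrightarrow> (1 + \<bar>x\<bar>) ^ j *
      norm (nderiv k (\<lambda>x. exp (- z * of_real x)) x - nderiv k (\<lambda>x. exp (- s * of_real x)) x
          - (z - s) * nderiv k (\<lambda>x. - of_real x * exp (- s * of_real x)) x) \<le> B * (norm (z - s))\<^sup>2"
      by blast
  qed
  then show ?thesis by (simp add: has_field_derivative_def mult_commute_abs)
qed

lemma laplace_holomorphic: "laplace Y holomorphic_on {s. Re s > 0}"
proof -
  have "(\<lambda>z. pairing (\<lambda>x. exp (- z * of_real x))) holomorphic_on {s. Re s > 0}"
    unfolding holomorphic_on_def field_differentiable_def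
    using pairing_exp_has_field_derivative has_field_derivative_at_within by blast
  then show ?thesis
    by (rule holomorphic_transform) (simp add: laplace_eq_pairing)
qed

end

subsection \<open>Regularization by test functions\<close>

text \<open>Bridge from the Lebesgue integrals of the definitions to the gauge integral, where
  Leibniz' rule and the fundamental theorem of calculus are applied.\<close>

lemma
  fixes h :: "real \<Rightarrow> complex"
  assumes h: "continuous_on {a..b} h" and 0: "\<And>x. x \<notin> {a..b} \<Longrightarrow> h x = 0"
  shows integrable_compact_supp: "integrable lborel h"
    and integral_compact_supp: "integral\<^sup>L lborel h = integral {a..b} h"
proof -
  have eq: "(\<lambda>x. indicator {a..b} x *\<^sub>R h x) = h"
    using 0 by (auto simp: indicator_def fun_eq_iff)
  have int: "set_integrable lborel {a..b} h" by (rule borel_integrable_atLeastAtMost'[OF h])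
  show "integrable lborel h" using int unfolding set_integrable_def eq .
  show "integral\<^sup>L lborel h = integral {a..b} h"
    using set_borel_integral_eq_integral(2)[OF int] unfolding set_lebesgue_integral_def eq .
qed

lemma test_integrable:
  fixes f :: "real \<Rightarrow> complex"
  assumes f: "f \<in> test_functions" and g: "continuous_on UNIV g"
  shows "integrable lborel (\<lambda>x. f x * g x)"
proof -
  obtain M where M: "M > 0" "\<forall>k x. \<bar>x\<bar> \<ge> M \<longrightarrow> nderiv k f x = 0"
    by (rule test_function_bounds[OF f])
  show ?thesis
  proof (rule integrable_compact_supp)
    show "continuous_on {-M..M} (\<lambda>x. f x * g x)"
      by (intro continuous_on_mult smooth_continuous test_smooth[OF f] continuous_on_subset[OF g]) auto
    show "f x * g x = 0" if "x \<notin> {-M..M}" for x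
      using M(2)[rule_format, of x 0] that by auto
  qed
qed

context
  fixes f \<theta> :: "real \<Rightarrow> complex"
  assumes f: "smooth f" and \<theta>: "smooth \<theta>"
begin

lemma continuous_on_translate_nderiv: "continuous_on S (\<lambda>p. nderiv k f (snd p - fst p))"
  by (intro continuous_on_compose2[OF smooth_continuous_nderiv[OF f, of UNIV]] continuous_intros) auto

text \<open>Differentiation under the integral sign in the translation \<open>x\<close>. The upper
  limit \<open>r\<close> stays free because it later becomes the variable of
  differentiation.\<close>

lemma
  shows smooth_integral_translate: "smooth (\<lambda>x. integral {a..r} (\<lambda>\<tau>. f (\<tau> - x) * \<theta> \<tau>))"
    and nderiv_integral_translate: "nderiv k (\<lambda>x. integral {a..r} (\<lambda>\<tau>. f (\<tau> - x) * \<theta> \<tau>)) =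
      (\<lambda>x. integral {a..r} (\<lambda>\<tau>. (-1) ^ k * nderiv k f (\<tau> - x) * \<theta> \<tau>))"
proof -
  let ?D = "\<lambda>k x. integral {a..r} (\<lambda>\<tau>. (-1) ^ k * nderiv k f (\<tau> - x) * \<theta> \<tau>)"
  have "(?D k has_vector_derivative ?D (Suc k) x) (at x)" for k x
  proof -
    have "((\<lambda>x. integral (cbox a r) (\<lambda>\<tau>. (-1) ^ k * nderiv k f (\<tau> - x) * \<theta> \<tau>)) has_vector_derivative
        integral (cbox a r) (\<lambda>\<tau>. (-1) ^ Suc k * nderiv (Suc k) f (\<tau> - x) * \<theta> \<tau>)) (at x within UNIV)"
    proof (rule leibniz_rule_vector_derivative)
      show "((\<lambda>x. (-1) ^ k * nderiv k f (\<tau> - x) * \<theta> \<tau>) has_vector_derivative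
          (-1) ^ Suc k * nderiv (Suc k) f (\<tau> - x) * \<theta> \<tau>) (at x within UNIV)" for x \<tau>
      proof -
        have "((\<lambda>x. \<tau> - x) has_vector_derivative -1) (at x)"
          by (auto intro!: derivative_eq_intros)
        from vector_diff_chain_at[OF this smooth_nderiv[OF f, of k]]
        have "((\<lambda>x. nderiv k f (\<tau> - x)) has_vector_derivative - nderiv (Suc k) f (\<tau> - x)) (at x)"
          by (simp add: o_def)
        from has_vector_derivative_mult_left[OF has_vector_derivative_mult_right[OF this, of "(-1) ^ k"], of "\<theta> \<tau>"]
        show ?thesis by simp
      qed
      show "(\<lambda>\<tau>. (-1) ^ k * nderiv k f (\<tau> - x) * \<theta> \<tau>) integrable_on cbox a r" for x
        by (intro integrable_continuous continuous_intros smooth_continuous[OF \<theta>]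
            continuous_on_compose2[OF smooth_continuous_nderiv[OF f, of UNIV]]) auto
      have "continuous_on (UNIV \<times> cbox a r) (\<lambda>p. (-1) ^ Suc k * nderiv (Suc k) f (snd p - fst p) * \<theta> (snd p))"
        by (intro continuous_on_mult continuous_on_translate_nderiv continuous_on_const
            continuous_on_compose2[OF smooth_continuous[OF \<theta>, of UNIV]] continuous_on_snd continuous_on_id) auto
      then show "continuous_on (UNIV \<times> cbox a r) (\<lambda>(x, \<tau>). (-1) ^ Suc k * nderiv (Suc k) f (\<tau> - x) * \<theta> \<tau>)"
        by (simp add: case_prod_beta)
    qed auto
    then show ?thesis by simp
  qed
  note * = smooth_tower[where D="?D", OF _ this]
  show "smooth (\<lambda>x. integral {a..r} (\<lambda>\<tau>. f (\<tau> - x) * \<theta> \<tau>))" by (rule *) (simp add: fun_eq_iff)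
  show "nderiv k (\<lambda>x. integral {a..r} (\<lambda>\<tau>. f (\<tau> - x) * \<theta> \<tau>)) = ?D k" by (rule *) (simp add: fun_eq_iff)
qed

end

context causal_tempered
begin

lemma pairing_translate_derivative:
  assumes f: "f \<in> test_functions"
  shows "((\<lambda>t. pairing (\<lambda>x. f (t - x))) has_vector_derivative pairing (\<lambda>x. nderiv 1 f (t - x))) (at t)"
proof -
  note sf = test_smooth[OF f]
  obtain M where M: "M > 0" "\<forall>k x. \<bar>x\<bar> \<ge> M \<longrightarrow> nderiv k f x = 0"
    by (rule test_function_bounds[OF f])
  have "((\<lambda>t. pairing (\<lambda>x. f (t - x))) has_derivative (\<lambda>h. of_real h * pairing (\<lambda>x. nderiv 1 f (t - x)))) (at t)"
  proof (rule pairing_has_derivative[OF bounded_linear_of_real zero_less_one])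
    show "(\<lambda>x. f (r - x)) \<in> right_decaying" for r using test_reflect[OF f] test_right_decaying by blast
    show "(\<lambda>x. nderiv 1 f (t - x)) \<in> right_decaying"
      using test_reflect[OF nderiv_test[OF f]] test_right_decaying by blast
    fix j k
    obtain B where B: "B > 0" "\<forall>x. norm (nderiv (k + 2) f x) \<le> B"
      by (rule test_function_nderiv_bounded[OF f])
    \<comment> \<open>If \<open>|x| \<ge> K - 1\<close>, then \<open>|r - t| < 1\<close> puts both
      \<open>r - x\<close> and \<open>t - x\<close> outside \<open>(-M, M)\<close>, where
      \<open>f\<close> and its derivatives vanish; otherwise the weight is at most
      \<open>K ^ j\<close>.\<close>
    define K where "K = 2 + M + \<bar>t\<bar>"
    have "(1 + \<bar>x\<bar>) ^ j * norm (nderiv k (\<lambda>x. f (r - x)) x - nderiv k (\<lambda>x. f (t - x)) x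
        - of_real (r - t) * nderiv k (\<lambda>x. nderiv 1 f (t - x)) x) \<le> K ^ j * B * (norm (r - t))\<^sup>2"
      if r: "norm (r - t) < 1" for r x
    proof -
      have eq: "nderiv k (\<lambda>x. f (r - x)) x - nderiv k (\<lambda>x. f (t - x)) x
        - of_real (r - t) * nderiv k (\<lambda>x. nderiv 1 f (t - x)) x = (-1) ^ k *
        (nderiv k f (r - x) - nderiv k f (t - x) - of_real (r - t) * nderiv (Suc k) f (t - x))"
        by (simp add: nderiv_reflect[OF sf] nderiv_reflect[OF smooth_nderiv_smooth[OF sf]]
            nderiv_add_index algebra_simps)
      show ?thesis
      proof (cases "\<bar>x\<bar> < K - 1")
        case False
        then have "\<bar>r - x\<bar> \<ge> M" "\<bar>t - x\<bar> \<ge> M" using r by (auto simp: K_def)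
        then show ?thesis using M(2) B(1) M(1) unfolding eq by (simp add: K_def)
      next
        case True
        have "norm (nderiv k f (r - x) - nderiv k f (t - x) - ((r - x) - (t - x)) *\<^sub>R nderiv (Suc k) f (t - x))
            \<le> B * (norm ((r - x) - (t - x)))\<^sup>2"
        proof (rule vector_taylor_quadratic[where g'' = "nderiv (k + 2) f" and a = "min (r - x) (t - x)" and b = "max (r - x) (t - x)"])
          show "(nderiv k f has_vector_derivative nderiv (Suc k) f y) (at y within A)" for y A
            by (rule smooth_nderiv[OF sf])
          show "(nderiv (Suc k) f has_vector_derivative nderiv (k + 2) f y) (at y within A)" for y A
            using smooth_nderiv[OF sf, of "Suc k"] by simp
        qed (use B in auto)
        then have "norm (nderiv k f (r - x) - nderiv k f (t - x) - of_real (r - t) * nderiv (Suc k) f (t - x))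
            \<le> B * (norm (r - t))\<^sup>2" by (simp add: scaleR_conv_of_real)
        moreover have "(1 + \<bar>x\<bar>) ^ j \<le> K ^ j" using True by (intro power_mono) auto
        ultimately have "(1 + \<bar>x\<bar>) ^ j * norm (nderiv k f (r - x) - nderiv k f (t - x) - of_real (r - t) * nderiv (Suc k) f (t - x))
            \<le> K ^ j * (B * (norm (r - t))\<^sup>2)" using M(1) by (intro mult_mono) (auto simp: K_def)
        then show ?thesis unfolding eq by (simp add: norm_mult norm_power mult_ac)
      qed
    qed
    then show "\<exists>B. \<forall>r x. norm (r - t) < 1 \<longrightarrow> x \<ge> -2 \<longrightarrow> (1 + \<bar>x\<bar>) ^ j * norm (nderiv k (\<lambda>x. f (r - x)) x
        - nderiv k (\<lambda>x. f (t - x)) x - of_real (r - t) * nderiv k (\<lambda>x. nderiv 1 f (t - x)) x) \<le> B * (norm (r - t))\<^sup>2"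
      by blast
  qed
  then show ?thesis by (simp add: has_vector_derivative_def scaleR_conv_of_real)
qed

lemma
  assumes f: "f \<in> test_functions"
  shows smooth_pairing_translate: "smooth (\<lambda>t. pairing (\<lambda>x. f (t - x)))"
    and nderiv_pairing_translate: "nderiv k (\<lambda>t. pairing (\<lambda>x. f (t - x))) = (\<lambda>t. pairing (\<lambda>x. nderiv k f (t - x)))"
proof -
  have "((\<lambda>t. pairing (\<lambda>x. nderiv k f (t - x))) has_vector_derivative pairing (\<lambda>x. nderiv (Suc k) f (t - x))) (at t)" for k t
    using pairing_translate_derivative[OF nderiv_test[OF f, of k]] by (simp add: nderiv_add_index)
  note * = smooth_tower[where D="\<lambda>k t. pairing (\<lambda>x. nderiv k f (t - x))", OF _ this]
  show "smooth (\<lambda>t. pairing (\<lambda>x. f (t - x)))" by (rule *) simp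
  show "nderiv k (\<lambda>t. pairing (\<lambda>x. f (t - x))) = (\<lambda>t. pairing (\<lambda>x. nderiv k f (t - x)))" by (rule *) simp
qed

text \<open>Both sides, as functions of the upper limit of integration, have the same derivative,
  so no Riemann sums are needed to exchange the pairing with the integral.\<close>

lemma pairing_integral_translate:
  assumes f: "f \<in> test_functions" and \<theta>: "\<theta> \<in> test_functions" and N: "N > 0" "\<forall>x. \<bar>x\<bar> \<ge> N \<longrightarrow> \<theta> x = 0"
  shows "(\<lambda>x. integral {-N-2..N+1} (\<lambda>\<tau>. f (\<tau> - x) * \<theta> \<tau>)) \<in> test_functions"
    and "pairing (\<lambda>x. integral {-N-2..N+1} (\<lambda>\<tau>. f (\<tau> - x) * \<theta> \<tau>)) =
      integral {-N-1..N+1} (\<lambda>\<tau>. pairing (\<lambda>x. f (\<tau> - x)) * \<theta> \<tau>)"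
proof -
  note sf = test_smooth[OF f] and s\<theta> = test_smooth[OF \<theta>]
  obtain M where M: "M > 0" "\<forall>k x. \<bar>x\<bar> \<ge> M \<longrightarrow> nderiv k f x = 0"
    by (rule test_function_bounds[OF f])
  \<comment> \<open>Differentiation in \<open>r\<close> takes place on \<open>[-N-1, N+1]\<close>,
    and neighbours with \<open>|r - t| < 1\<close> stay in \<open>[-N-2, N+2]\<close>. The integrand
    vanishes on \<open>[-N-2, -N-1]\<close>, so \<open>J (-N-1) = 0\<close> is the initial value.
    For \<open>|x| \<ge> K - 1\<close> and times in the larger interval,
    \<open>f (\<tau> - x)\<close> is zero.\<close>
  define J where "J r x = integral {-N-2..r} (\<lambda>\<tau>. f (\<tau> - x) * \<theta> \<tau>)" for r x
  define K where "K = M + N + 3"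
  have nJ: "nderiv k (J r) x = integral {-N-2..r} (\<lambda>\<tau>. (-1) ^ k * nderiv k f (\<tau> - x) * \<theta> \<tau>)" for k r x
    unfolding J_def[abs_def] nderiv_integral_translate[OF sf s\<theta>] ..
  have nJ0: "nderiv k (J r) x = 0" if "\<bar>x\<bar> \<ge> K - 1" "r \<le> N + 2" for k r x
  proof -
    have "integral {-N-2..r} (\<lambda>\<tau>. (-1) ^ k * nderiv k f (\<tau> - x) * \<theta> \<tau>) = integral {-N-2..r} (\<lambda>\<tau>. 0)"
    proof (rule integral_cong)
      fix \<tau> assume "\<tau> \<in> {-N-2..r}"
      then have "\<bar>\<tau> - x\<bar> \<ge> M" using that by (auto simp: K_def)
      then show "(-1) ^ k * nderiv k f (\<tau> - x) * \<theta> \<tau> = 0" using M(2) by simp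
    qed
    then show ?thesis unfolding nJ by simp
  qed
  have Jtest: "J r \<in> test_functions" if "r \<le> N + 2" for r
  proof (rule test_functionI_abs[of _ "K - 1"])
    show "smooth (J r)" unfolding J_def[abs_def] by (rule smooth_integral_translate[OF sf s\<theta>])
    show "J r x = 0" if "\<bar>x\<bar> \<ge> K - 1" for x using nJ0[OF that \<open>r \<le> N + 2\<close>, of 0] by simp
  qed
  from Jtest[of "N + 1"] show "(\<lambda>x. integral {-N-2..N+1} (\<lambda>\<tau>. f (\<tau> - x) * \<theta> \<tau>)) \<in> test_functions"
    by (simp add: J_def[abs_def])
  have deriv: "((\<lambda>r. pairing (J r)) has_vector_derivative pairing (\<lambda>x. f (t - x)) * \<theta> t) (at t)"
    if t: "t \<in> {-N-1..N+1}" for t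
  proof -
    let ?A = "\<lambda>x. \<theta> t * f (t - x)"
    have A: "?A \<in> test_functions" by (rule test_cmult[OF test_reflect[OF f]])
    have "((\<lambda>r. pairing (J r)) has_derivative (\<lambda>h. of_real h * pairing ?A)) (at t)"
    proof (rule pairing_has_derivative[OF bounded_linear_of_real zero_less_one])
      show "J r \<in> right_decaying" if "norm (r - t) < 1" for r
        using Jtest[of r] that t test_right_decaying by (auto simp: abs_less_iff)
      show "?A \<in> right_decaying" using A test_right_decaying by blast
      fix j k
      obtain B1 where B1: "B1 > 0" "\<forall>x. norm (nderiv (Suc k) f x) \<le> B1"
        by (rule test_function_nderiv_bounded[OF f])
      obtain B0 where B0: "B0 > 0" "\<forall>x. norm (nderiv k f x) \<le> B0"
        by (rule test_function_nderiv_bounded[OF f])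
      obtain C1 where C1: "C1 > 0" "\<forall>x. norm (nderiv 1 \<theta> x) \<le> C1"
        by (rule test_function_nderiv_bounded[OF \<theta>])
      obtain C0 where C0: "C0 > 0" "\<forall>x. norm (nderiv 0 \<theta> x) \<le> C0"
        by (rule test_function_nderiv_bounded[OF \<theta>])
      define B where "B = B1 * C0 + B0 * C1"
      have "(1 + \<bar>x\<bar>) ^ j * norm (nderiv k (J r) x - nderiv k (J t) x - of_real (r - t) * nderiv k ?A x)
          \<le> K ^ j * B * (norm (r - t))\<^sup>2" if r: "norm (r - t) < 1" for r x
      proof -
        have rb: "r \<in> {-N-2..N+2}" "t \<in> {-N-2..N+2}" using r t by (auto simp: abs_less_iff)
        have nA: "nderiv k ?A x = (-1) ^ k * nderiv k f (t - x) * \<theta> t"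
          by (simp add: nderiv_cmult[OF smooth_reflect[OF sf]] nderiv_reflect[OF sf])
        show ?thesis
        proof (cases "\<bar>x\<bar> < K - 1")
          case False
          then have "\<bar>t - x\<bar> \<ge> M" using rb by (auto simp: K_def)
          then show ?thesis using M(2) nJ0[of x r k] nJ0[of x t k] False rb nA
            B1(1) B0(1) C1(1) C0(1) M(1) N(1) by (simp add: B_def K_def)
        next
          case True
          let ?g' = "\<lambda>\<tau>. (-1) ^ k * nderiv k f (\<tau> - x) * \<theta> \<tau>"
          let ?g'' = "\<lambda>\<tau>. (-1) ^ k * nderiv k f (\<tau> - x) * nderiv 1 \<theta> \<tau> + (-1) ^ k * nderiv (Suc k) f (\<tau> - x) * \<theta> \<tau>"
          have g': "(?g' has_vector_derivative ?g'' y) (at y within S)" for y S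
          proof -
            have "((\<lambda>\<tau>. nderiv k f (\<tau> + - x)) has_vector_derivative nderiv (Suc k) f (y + - x)) (at y within S)"
              using smooth_nderiv[OF smooth_shift[OF sf, of "- x"], of k y S] by (simp only: nderiv_shift[OF sf])
            then have 1: "((\<lambda>\<tau>. nderiv k f (\<tau> - x)) has_vector_derivative nderiv (Suc k) f (y - x)) (at y within S)"
              by simp
            have 2: "(\<theta> has_vector_derivative nderiv 1 \<theta> y) (at y within S)"
              using smooth_nderiv[OF s\<theta>, of 0] by simp
            show ?thesis
              by (rule has_vector_derivative_mult[OF has_vector_derivative_mult_right[OF 1] 2])
          qed
          have "continuous_on {-N-2..N+2} ?g'"
            unfolding continuous_on_eq_continuous_within
            by (intro ballI has_vector_derivative_continuous[OF g'])
          \<comment> \<open>As a function of the upper limit, \<open>nderiv k (J r) x\<close> has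
            first derivative \<open>?g'\<close> and second derivative \<open>?g''\<close>, the
            latter bounded independently of \<open>x\<close>; this yields the quadratic
            remainder.\<close>
          note g = integral_has_vector_derivative[OF this]
          have "norm (nderiv k (J r) x - nderiv k (J t) x - (r - t) *\<^sub>R ?g' t) \<le> B * (norm (r - t))\<^sup>2"
            unfolding nJ
          proof (rule vector_taylor_quadratic[OF g g' _ rb(2,1)])
            fix y
            have "norm (?g'' y) \<le> norm ((-1) ^ k * nderiv k f (y - x) * nderiv 1 \<theta> y) + norm ((-1) ^ k * nderiv (Suc k) f (y - x) * \<theta> y)"
              by (rule norm_triangle_ineq)
            also have "\<dots> \<le> B0 * C1 + B1 * C0"
              using B0 B1 C0 C1 by (auto simp: norm_mult norm_power intro!: add_mono mult_mono)
            finally show "norm (?g'' y) \<le> B" by (simp add: B_def)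
          qed
          moreover have "(1 + \<bar>x\<bar>) ^ j \<le> K ^ j" using True by (intro power_mono) auto
          ultimately have "(1 + \<bar>x\<bar>) ^ j * norm (nderiv k (J r) x - nderiv k (J t) x - (r - t) *\<^sub>R ?g' t)
              \<le> K ^ j * (B * (norm (r - t))\<^sup>2)" using M(1) N(1) by (intro mult_mono) (auto simp: K_def)
          then show ?thesis unfolding nA by (simp only: scaleR_conv_of_real mult.assoc)
        qed
      qed
      then show "\<exists>B. \<forall>r x. norm (r - t) < 1 \<longrightarrow> x \<ge> -2 \<longrightarrow> (1 + \<bar>x\<bar>) ^ j *
          norm (nderiv k (J r) x - nderiv k (J t) x - of_real (r - t) * nderiv k ?A x) \<le> B * (norm (r - t))\<^sup>2"
        by blast
    qed
    moreover have "pairing ?A = pairing (\<lambda>x. f (t - x)) * \<theta> t"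
      using pairing_cmult[of "\<lambda>x. f (t - x)" "\<theta> t"] test_reflect[OF f] test_right_decaying by (auto simp: mult.commute)
    ultimately show ?thesis by (simp add: has_vector_derivative_def scaleR_conv_of_real)
  qed
  have "((\<lambda>t. pairing (\<lambda>x. f (t - x)) * \<theta> t) has_integral pairing (J (N + 1)) - pairing (J (-N-1))) {-N-1..N+1}"
    by (rule fundamental_theorem_of_calculus[OF _ has_vector_derivative_at_within[OF deriv]]) (use N(1) in auto)
  moreover have "J (-N-1) = (\<lambda>x. 0)"
  proof
    fix x
    have "J (-N-1) x = integral {-N-2..-N-1} (\<lambda>\<tau>. 0)"
      unfolding J_def by (rule integral_cong) (use N in auto)
    then show "J (-N-1) x = 0" by simp
  qed
  moreover have "pairing (\<lambda>x. 0) = 0"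
    using pairing_cmult[of "\<lambda>x. 0" 0] test_zero test_right_decaying by auto
  ultimately have "((\<lambda>t. pairing (\<lambda>x. f (t - x)) * \<theta> t) has_integral pairing (J (N + 1))) {-N-1..N+1}" by simp
  then show "pairing (\<lambda>x. integral {-N-2..N+1} (\<lambda>\<tau>. f (\<tau> - x) * \<theta> \<tau>)) =
      integral {-N-1..N+1} (\<lambda>\<tau>. pairing (\<lambda>x. f (\<tau> - x)) * \<theta> \<tau>)"
    by (simp add: J_def[abs_def] integral_unique)
qed

text \<open>The correlation of \<open>f\<close> and \<open>\<theta>\<close> is what \<open>Y\<close>
  receives when \<open>Y * f\<close> is tested with \<open>\<theta>\<close>. Moving the pairing
  under the integral exhibits \<open>Y * f\<close> as the function
  \<open>\<lambda>\<tau>. pairing (\<lambda>x. f (\<tau> - x))\<close>.\<close>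

lemma
  assumes f: "f \<in> test_functions" and \<theta>: "\<theta> \<in> test_functions"
  shows correlation_test: "(\<lambda>x. \<integral>y. f y * \<theta> (x + y) \<partial>lborel) \<in> test_functions"
    and pairing_correlation: "pairing (\<lambda>x. \<integral>y. f y * \<theta> (x + y) \<partial>lborel) =
      (\<integral>\<tau>. pairing (\<lambda>x. f (\<tau> - x)) * \<theta> \<tau> \<partial>lborel)"
proof -
  obtain N where N: "N > 0" "\<forall>k x. \<bar>x\<bar> \<ge> N \<longrightarrow> nderiv k \<theta> x = 0"
    by (rule test_function_bounds[OF \<theta>])
  have N': "\<forall>x. \<bar>x\<bar> \<ge> N \<longrightarrow> \<theta> x = 0" using N(2) by (metis nderiv_0)
  have eq: "(\<integral>y. f y * \<theta> (x + y) \<partial>lborel) = integral {-N-2..N+1} (\<lambda>\<tau>. f (\<tau> - x) * \<theta> \<tau>)" for x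
  proof -
    have "(\<integral>y. f y * \<theta> (x + y) \<partial>lborel) = (\<integral>\<tau>. f (\<tau> - x) * \<theta> \<tau> \<partial>lborel)"
      using lborel_integral_real_affine[of 1 "\<lambda>y. f y * \<theta> (x + y)" "- x"] by (simp add: algebra_simps)
    also have "\<dots> = integral {-N-2..N+1} (\<lambda>\<tau>. f (\<tau> - x) * \<theta> \<tau>)"
    proof (rule integral_compact_supp)
      show "continuous_on {-N-2..N+1} (\<lambda>\<tau>. f (\<tau> - x) * \<theta> \<tau>)"
        by (intro continuous_intros smooth_continuous[OF test_smooth[OF \<theta>]]
            continuous_on_compose2[OF smooth_continuous[OF test_smooth[OF f], of UNIV]]) auto
      show "f (\<tau> - x) * \<theta> \<tau> = 0" if "\<tau> \<notin> {-N-2..N+1}" for \<tau>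
        using N(1) N'[rule_format, of \<tau>] that by auto
    qed
    finally show ?thesis .
  qed
  show "(\<lambda>x. \<integral>y. f y * \<theta> (x + y) \<partial>lborel) \<in> test_functions"
    unfolding eq by (rule pairing_integral_translate(1)[OF f \<theta> N(1) N'])
  have "(\<integral>\<tau>. pairing (\<lambda>x. f (\<tau> - x)) * \<theta> \<tau> \<partial>lborel) = integral {-N-1..N+1} (\<lambda>\<tau>. pairing (\<lambda>x. f (\<tau> - x)) * \<theta> \<tau>)"
  proof (rule integral_compact_supp)
    show "continuous_on {-N-1..N+1} (\<lambda>\<tau>. pairing (\<lambda>x. f (\<tau> - x)) * \<theta> \<tau>)"
      by (intro continuous_on_mult smooth_continuous smooth_pairing_translate f test_smooth[OF \<theta>])
    show "pairing (\<lambda>x. f (\<tau> - x)) * \<theta> \<tau> = 0" if "\<tau> \<notin> {-N-1..N+1}" for \<tau>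
      using N(1) N'[rule_format, of \<tau>] that by auto
  qed
  then show "pairing (\<lambda>x. \<integral>y. f y * \<theta> (x + y) \<partial>lborel) = (\<integral>\<tau>. pairing (\<lambda>x. f (\<tau> - x)) * \<theta> \<tau> \<partial>lborel)"
    unfolding eq using pairing_integral_translate(2)[OF f \<theta> N(1) N'] by simp
qed

end

subsection \<open>Convolution with a test function\<close>

lemma Basis_plane: "(Basis :: (real \<times> real) set) = {(1, 0), (0, 1)}"
  by (auto simp: Basis_prod_def)

context
  fixes f g :: "real \<Rightarrow> complex"
  assumes f: "smooth f" and g: "smooth g"
begin

lemma product_has_derivative:
  "((\<lambda>p. nderiv a f (fst p) * nderiv b g (snd p)) has_derivative
     (\<lambda>h. fst h *\<^sub>R (nderiv (Suc a) f (fst p) * nderiv b g (snd p)) +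
       snd h *\<^sub>R (nderiv a f (fst p) * nderiv (Suc b) g (snd p)))) (at p)"
proof -
  have 1: "((\<lambda>p. nderiv a f (fst p)) has_derivative (\<lambda>h. fst h *\<^sub>R nderiv (Suc a) f (fst p))) (at p)"
    by (rule has_derivative_compose[OF has_derivative_fst[OF has_derivative_ident]
          smooth_nderiv[OF f, unfolded has_vector_derivative_def]])
  have 2: "((\<lambda>p. nderiv b g (snd p)) has_derivative (\<lambda>h. snd h *\<^sub>R nderiv (Suc b) g (snd p))) (at p)"
    by (rule has_derivative_compose[OF has_derivative_snd[OF has_derivative_ident]
          smooth_nderiv[OF g, unfolded has_vector_derivative_def]])
  show ?thesis
    by (rule has_derivative_eq_rhs[OF has_derivative_mult[OF 1 2]]) (simp add: fun_eq_iff add.commute)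
qed

text \<open>For a tensor product only the number of occurrences of each direction matters; thereby
  the uniform derivative bounds for \<open>cut\<close> carry over to the plane.\<close>

lemma partials_product:
  assumes "set bs \<subseteq> Basis"
  shows "partials bs (\<lambda>p. f (fst p) * g (snd p)) = (\<lambda>p. nderiv (count_list bs (1, 0)) f (fst p) * nderiv (count_list bs (0, 1)) g (snd p))"
  using assms
proof (induction bs)
  case (Cons b bs)
  let ?a = "count_list bs (1, 0)" and ?b = "count_list bs (0, 1)"
  have "b = (1, 0) \<or> b = (0, 1)" using Cons.prems by (auto simp: Basis_plane)
  moreover have "partials (b # bs) (\<lambda>p. f (fst p) * g (snd p)) p =
      fst b *\<^sub>R (nderiv (Suc ?a) f (fst p) * nderiv ?b g (snd p)) +
      snd b *\<^sub>R (nderiv ?a f (fst p) * nderiv (Suc ?b) g (snd p))" for p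
    using fun_cong[OF frechet_derivative_at[OF product_has_derivative[of ?a ?b p]], of b] Cons by simp
  ultimately show ?case by (auto simp: fun_eq_iff)
qed simp

lemma smooth_product: "smooth (\<lambda>p. f (fst p) * g (snd p))"
  unfolding smooth_def
proof (intro allI impI)
  fix bs :: "(real \<times> real) list" and x
  assume "set bs \<subseteq> Basis"
  then show "partials bs (\<lambda>p. f (fst p) * g (snd p)) differentiable at x"
    unfolding partials_product[OF \<open>set bs \<subseteq> Basis\<close>] differentiable_def using product_has_derivative by blast
qed

end

text \<open>Without such a sequence \<open>conv_limit\<close> would hold for every \<open>l\<close> and \<open>conv\<close> would be a junk value.\<close>

lemma tends_to_one_plateau:
  "tends_to_one (\<lambda>k p. plateau k (fst p) * plateau k (snd p))"
  unfolding tends_to_one_def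
proof (intro conjI allI impI)
  have sm: "smooth (plateau k)" for k unfolding plateau_def by (rule smooth_cut)
  show "(\<lambda>p. plateau k (fst p) * plateau k (snd p)) \<in> test_functions" for k
  proof -
    let ?I = "{- real k - 1..real k + 1}"
    have "fun_supp (\<lambda>p. plateau k (fst p) * plateau k (snd p)) \<subseteq> ?I \<times> ?I"
    proof (rule closure_subset_closed)
      have z: "plateau k x = 0" if "x \<notin> ?I" for x
        unfolding plateau_def by (rule cut_0) (use that in auto)
      show "{p. plateau k (fst p) * plateau k (snd p) \<noteq> 0} \<subseteq> ?I \<times> ?I"
      proof
        fix p assume "p \<in> {p. plateau k (fst p) * plateau k (snd p) \<noteq> 0}"
        then have "fst p \<in> ?I" "snd p \<in> ?I" using z[of "fst p"] z[of "snd p"] by force+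
        then show "p \<in> ?I \<times> ?I" by (simp add: mem_Times_iff)
      qed
    qed (intro closed_Times closed_atLeastAtMost)
    moreover have "compact (?I \<times> ?I)" by (intro compact_Times compact_Icc)
    ultimately have "compact (fun_supp (\<lambda>p. plateau k (fst p) * plateau k (snd p)))"
      using compact_Int_closed[of "?I \<times> ?I" "fun_supp (\<lambda>p. plateau k (fst p) * plateau k (snd p))"]
      by (simp add: fun_supp_def inf.absorb2)
    then show ?thesis using smooth_product[OF sm sm] by (simp add: test_functions_def)
  qed
  show "\<forall>\<^sub>F k in sequentially. \<forall>p\<in>K. plateau k (fst p) * plateau k (snd p) = 1" if K: "compact K" for K
  proof -
    obtain M where M: "\<forall>p\<in>K. norm p \<le> M"
      using compact_imp_bounded[OF K] unfolding bounded_iff by blast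
    obtain n :: nat where n: "M \<le> real n" using real_arch_simple by blast
    have "plateau k (fst p) * plateau k (snd p) = 1" if "k \<ge> n" "p \<in> K" for k p
    proof -
      have "\<bar>fst p\<bar> \<le> norm p" "\<bar>snd p\<bar> \<le> norm p" using norm_fst_le[of "fst p" "snd p"] norm_snd_le[of "snd p" "fst p"] by auto
      moreover have "norm p \<le> real k" using M[rule_format, OF that(2)] n that(1) by linarith
      ultimately show ?thesis by (simp add: plateau_1)
    qed
    then show ?thesis unfolding eventually_sequentially by blast
  qed
  show "\<exists>C. \<forall>k p. norm (partials bs (\<lambda>p. plateau k (fst p) * plateau k (snd p)) p) \<le> C"
    if bs: "set bs \<subseteq> Basis" for bs
  proof -
    let ?a = "count_list bs (1, 0)" and ?b = "count_list bs (0, 1)"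
    obtain A where A: "A \<ge> 0" "\<forall>a b x. norm (nderiv ?a (cut a b) x) \<le> A" using cut_nderiv_bounded[of ?a] by blast
    obtain B where B: "B \<ge> 0" "\<forall>a b x. norm (nderiv ?b (cut a b) x) \<le> B" using cut_nderiv_bounded[of ?b] by blast
    have "norm (partials bs (\<lambda>p. plateau k (fst p) * plateau k (snd p)) p) \<le> A * B" for k p
      unfolding partials_product[OF sm sm bs] norm_mult unfolding plateau_def
      using A B by (intro mult_mono) auto
    then show ?thesis by blast
  qed
qed

text \<open>\<open>dist_of_fun f\<close> is \<open>undefined\<close> off the test functions, so the
  inner argument of \<open>tensor\<close> has to be shown to be a test function for each fixed
  \<open>x\<close>.\<close>

lemma smooth_section:
  fixes \<eta> :: "real \<times> real \<Rightarrow> complex"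
  assumes "smooth \<eta>" shows "smooth (\<lambda>y. \<eta> (x, y))"
proof (rule smooth_towerI[where D = "\<lambda>k y. partials (replicate k (0, 1)) \<eta> (x, y)"])
  fix k y
  let ?P = "partials (replicate k (0, 1)) \<eta>"
  have "?P differentiable at (x, y)"
    using assms[unfolded smooth_def, rule_format, of "replicate k (0, 1)" "(x, y)"]
    by (simp add: Basis_plane set_replicate_conv_if)
  then have P: "(?P has_derivative frechet_derivative ?P (at (x, y))) (at (x, y))"
    by (simp add: frechet_derivative_works)
  have "((\<lambda>y. (x, y)) has_derivative (\<lambda>h. (0, h))) (at y)"
    by (rule has_derivative_Pair[OF has_derivative_const has_derivative_ident])
  from has_derivative_compose[OF this P]
  have "((\<lambda>y. ?P (x, y)) has_derivative (\<lambda>h. frechet_derivative ?P (at (x, y)) (0, h))) (at y)" .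
  moreover have "(\<lambda>h. frechet_derivative ?P (at (x, y)) (0, h)) = (\<lambda>h. h *\<^sub>R frechet_derivative ?P (at (x, y)) (0, 1))"
  proof
    fix h
    show "frechet_derivative ?P (at (x, y)) (0, h) = h *\<^sub>R frechet_derivative ?P (at (x, y)) (0, 1)"
      using linear_cmul[OF has_derivative_linear[OF P], of h "(0, 1)"] by simp
  qed
  ultimately show "((\<lambda>y. ?P (x, y)) has_vector_derivative partials (replicate (Suc k) (0, 1)) \<eta> (x, y)) (at y)"
    by (simp only: has_vector_derivative_def replicate_Suc partials.simps)
qed simp

lemma test_shift:
  fixes f :: "real \<Rightarrow> complex"
  assumes "f \<in> test_functions" shows "(\<lambda>y. f (x + y)) \<in> test_functions"
proof -
  have "(\<lambda>y. f (0 - (- x - y))) = (\<lambda>y. f (x + y))" by (simp add: add.commute)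
  then show ?thesis using test_reflect[OF test_reflect[OF assms, of 0], of "- x"] by simp
qed

text \<open>\<open>f y * \<phi> (x + y)\<close> can be nonzero only for \<open>|y| < M\<close> and
  \<open>|x + y| < N\<close>, hence on a compact rectangle. Once the cut-off equals \<open>1\<close>
  there it is invisible, and the sequence is eventually constant.\<close>

lemma tensor_cutoff_eventually:
  assumes f: "f \<in> test_functions" and \<phi>: "\<phi> \<in> test_functions" and \<eta>: "tends_to_one \<eta>"
  shows "\<forall>\<^sub>F k in sequentially. tensor Y (dist_of_fun f) (\<lambda>(x, y). \<eta> k (x, y) * \<phi> (x + y)) =
    Y (\<lambda>x. \<integral>y. f y * \<phi> (x + y) \<partial>lborel)"
proof -
  obtain M where M: "M > 0" "\<forall>k x. \<bar>x\<bar> \<ge> M \<longrightarrow> nderiv k f x = 0"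
    by (rule test_function_bounds[OF f])
  obtain N where N: "N > 0" "\<forall>k x. \<bar>x\<bar> \<ge> N \<longrightarrow> nderiv k \<phi> x = 0"
    by (rule test_function_bounds[OF \<phi>])
  let ?K = "{- (M + N)..M + N} \<times> {-M..M}"
  have "compact ?K" by (intro compact_Times compact_Icc)
  then have "\<forall>\<^sub>F k in sequentially. \<forall>p\<in>?K. \<eta> k p = 1" using \<eta> unfolding tends_to_one_def by blast
  then show ?thesis
  proof eventually_elim
    case (elim k)
    have mem: "(\<lambda>y. \<eta> k (x, y) * \<phi> (x + y)) \<in> test_functions" for x
    proof (rule test_mult_left[OF test_shift[OF \<phi>]])
      have "\<eta> k \<in> test_functions" using \<eta> unfolding tends_to_one_def by blast
      then show "smooth (\<lambda>y. \<eta> k (x, y))" by (intro smooth_section) (simp add: test_functions_def)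
    qed
    have "f y * (\<eta> k (x, y) * \<phi> (x + y)) = f y * \<phi> (x + y)" for x y
    proof (cases "\<bar>y\<bar> < M \<and> \<bar>x + y\<bar> < N")
      case True
      then have "(x, y) \<in> ?K" by auto
      then show ?thesis using elim by simp
    next
      case False
      then show ?thesis using M(2)[rule_format, of y 0] N(2)[rule_format, of "x + y" 0] by auto
    qed
    then have "dist_of_fun f (\<lambda>y. \<eta> k (x, y) * \<phi> (x + y)) = (\<integral>y. f y * \<phi> (x + y) \<partial>lborel)" for x
      unfolding dist_of_fun_def restrict_apply'[OF mem] by (simp only:)
    then show ?case by (simp add: tensor_def)
  qed
qed

lemma conv_limit_dist_of_fun:
  assumes f: "f \<in> test_functions" and \<phi>: "\<phi> \<in> test_functions"
  shows "conv_limit Y (dist_of_fun f) \<phi> l \<longleftrightarrow> l = Y (\<lambda>x. \<integral>y. f y * \<phi> (x + y) \<partial>lborel)"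
proof -
  have *: "(\<lambda>k. tensor Y (dist_of_fun f) (\<lambda>(x, y). \<eta> k (x, y) * \<phi> (x + y))) \<longlonglongrightarrow>
      Y (\<lambda>x. \<integral>y. f y * \<phi> (x + y) \<partial>lborel)" if "tends_to_one \<eta>" for \<eta>
    by (rule tendsto_eventually[OF tensor_cutoff_eventually[OF f \<phi> that]])
  show ?thesis
  proof
    assume "conv_limit Y (dist_of_fun f) \<phi> l"
    then have "(\<lambda>k. tensor Y (dist_of_fun f) (\<lambda>(x, y). (plateau k (fst (x, y)) * plateau k (snd (x, y))) * \<phi> (x + y))) \<longlonglongrightarrow> l"
      using tends_to_one_plateau unfolding conv_limit_def by (elim allE impE)
    from LIMSEQ_unique[OF this *[OF tends_to_one_plateau]]
    show "l = Y (\<lambda>x. \<integral>y. f y * \<phi> (x + y) \<partial>lborel)" .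
  qed (use * in \<open>simp add: conv_limit_def\<close>)
qed

lemma conv_dist_of_fun:
  assumes "f \<in> test_functions" "\<phi> \<in> test_functions"
  shows "conv Y (dist_of_fun f) \<phi> = Y (\<lambda>x. \<integral>y. f y * \<phi> (x + y) \<partial>lborel)"
  unfolding conv_def restrict_apply'[OF assms(2)]
  by (rule the_equality) (simp_all add: conv_limit_dist_of_fun[OF assms])

lemma dist_of_fun_distribution:
  assumes f: "f \<in> test_functions" shows "dist_of_fun f \<in> distributions"
  unfolding distributions_def
proof (intro CollectI conjI allI impI)
  have int: "integrable lborel (\<lambda>x. f x * \<phi> x)" if "\<phi> \<in> test_functions" for \<phi>
    by (rule test_integrable[OF f smooth_continuous[OF test_smooth[OF that]]])
  show "dist_of_fun f \<in> extensional test_functions" by (simp add: dist_of_fun_def)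
  show "linear_functional_on test_functions (dist_of_fun f)"
    unfolding linear_functional_on_def
  proof (intro conjI ballI allI)
    show "dist_of_fun f (\<lambda>x. \<phi> x + \<psi> x) = dist_of_fun f \<phi> + dist_of_fun f \<psi>"
      if "\<phi> \<in> test_functions" "\<psi> \<in> test_functions" for \<phi> \<psi>
      using that test_add[OF that] Bochner_Integration.integral_add[OF int int, OF that]
      by (simp add: dist_of_fun_def ring_distribs)
    show "dist_of_fun f (\<lambda>x. a * \<phi> x) = a * dist_of_fun f \<phi>" if "\<phi> \<in> test_functions" for a \<phi>
      using that test_cmult[OF that, of a] by (simp add: dist_of_fun_def mult.left_commute)
  qed
  have nf: "integrable lborel (\<lambda>x. norm (f x))"
    using integrable_norm[OF test_integrable[OF f continuous_on_const, of 1]] by simp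
  show "\<exists>C m. \<forall>\<phi>\<in>test_functions. fun_supp \<phi> \<subseteq> K \<longrightarrow>
      norm (dist_of_fun f \<phi>) \<le> C * (\<Sum>k\<le>m. SUP x. norm (nderiv k \<phi> x))" for K
  proof (intro exI ballI impI)
    fix \<phi> :: "real \<Rightarrow> complex" assume \<phi>: "\<phi> \<in> test_functions"
    obtain B where B: "B > 0" "\<forall>x. norm (nderiv 0 \<phi> x) \<le> B" by (rule test_function_nderiv_bounded[OF \<phi>])
    have le: "norm (\<phi> x) \<le> (SUP x. norm (\<phi> x))" for x
      using B(2) by (intro cSUP_upper bdd_aboveI2[of _ _ B]) auto
    have "norm (dist_of_fun f \<phi>) \<le> (\<integral>x. norm (f x) * (SUP x. norm (\<phi> x)) \<partial>lborel)"
      unfolding dist_of_fun_def restrict_apply'[OF \<phi>]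
      by (intro Bochner_Integration.integral_norm_bound_integral int[OF \<phi>] integrable_mult_left nf)
        (auto simp: norm_mult intro!: mult_left_mono le)
    then show "norm (dist_of_fun f \<phi>) \<le> (\<integral>x. norm (f x) \<partial>lborel) * (\<Sum>k\<le>0. SUP x. norm (nderiv k \<phi> x))"
      by simp
  qed
qed

text \<open>Needed for \<open>real_operator\<close>, which speaks only about the domain of the
  convolution.\<close>

lemma dist_of_fun_conv_domain:
  assumes "f \<in> test_functions" shows "dist_of_fun f \<in> conv_domain Y"
  unfolding conv_domain_def using dist_of_fun_distribution[OF assms] conv_limit_dist_of_fun[OF assms] by blast

subsection \<open>Integrals over a half-line\<close>

lemma continuous_L1_loc: "continuous_on UNIV f \<Longrightarrow> f \<in> L1_loc"
  unfolding L1_loc_def set_integrable_def mem_Collect_eq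
  by (intro allI impI borel_integrable_compact[OF _ continuous_on_subset[OF _ subset_UNIV]])

lemma test_L1_loc: "f \<in> test_functions \<Longrightarrow> f \<in> L1_loc"
  by (rule continuous_L1_loc[OF smooth_continuous[OF test_smooth]])

lemma L1_loc_mult_test:
  assumes g: "g \<in> L1_loc" and \<theta>: "\<theta> \<in> test_functions"
  shows "integrable lborel (\<lambda>x. g x * \<theta> x)"
proof -
  obtain M where M: "M > 0" "\<forall>k x. \<bar>x\<bar> \<ge> M \<longrightarrow> nderiv k \<theta> x = 0"
    by (rule test_function_bounds[OF \<theta>])
  obtain B where B: "B > 0" "\<forall>x. norm (nderiv 0 \<theta> x) \<le> B" by (rule test_function_nderiv_bounded[OF \<theta>])
  have int: "integrable lborel (\<lambda>x. indicator {-M..M} x *\<^sub>R g x)"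
    using g unfolding L1_loc_def set_integrable_def by blast
  have eq: "(\<lambda>x. g x * \<theta> x) = (\<lambda>x. (indicator {-M..M} x *\<^sub>R g x) * \<theta> x)"
  proof
    fix x
    show "g x * \<theta> x = (indicator {-M..M} x *\<^sub>R g x) * \<theta> x"
      using M(2)[rule_format, of x 0] by (cases "\<bar>x\<bar> \<ge> M") (auto simp: indicator_def)
  qed
  show ?thesis
    unfolding eq
  proof (rule Bochner_Integration.integrable_bound)
    show "integrable lborel (\<lambda>x. B *\<^sub>R (indicator {-M..M} x *\<^sub>R g x))" by (rule integrable_scaleR_right[OF int])
    have "\<theta> \<in> borel_measurable lborel"
      using borel_measurable_continuous_onI[OF smooth_continuous[OF test_smooth[OF \<theta>]]] by simp
    then show "(\<lambda>x. (indicator {-M..M} x *\<^sub>R g x) * \<theta> x) \<in> borel_measurable lborel"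
      by (intro borel_measurable_times borel_measurable_integrable[OF int])
    show "AE x in lborel. norm ((indicator {-M..M} x *\<^sub>R g x) * \<theta> x) \<le> norm (B *\<^sub>R (indicator {-M..M} x *\<^sub>R g x))"
    proof (rule AE_I2)
      fix x
      have "norm (indicator {-M..M} x *\<^sub>R g x) * norm (\<theta> x) \<le> norm (indicator {-M..M} x *\<^sub>R g x) * B"
        using B(2)[rule_format, of x] by (intro mult_left_mono) auto
      then show "norm ((indicator {-M..M} x *\<^sub>R g x) * \<theta> x) \<le> norm (B *\<^sub>R (indicator {-M..M} x *\<^sub>R g x))"
        using B(1) by (simp add: norm_mult mult_ac)
    qed
  qed
qed

text \<open>The argument of \<open>step\<close> is \<open>n * (b - x) + 1\<close>: for
  \<open>n > 0\<close> the value is \<open>1\<close> up to and including \<open>b\<close> and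
  \<open>0\<close> from \<open>b + 1 / n\<close> on, so the pointwise limit is exactly the indicator
  of \<open>{..b}\<close>.\<close>

definition upper_cutoff :: "nat \<Rightarrow> real \<Rightarrow> real \<Rightarrow> complex" where
  "upper_cutoff n b x = step (- real n * x + (real n * b + 1))"

lemma smooth_upper_cutoff: "smooth (upper_cutoff n b)"
  unfolding upper_cutoff_def[abs_def] by (rule smooth_affine[OF smooth_step])

text \<open>Links tests with smooth functions to the sharp half-line integrals of passivity. Local
  integrability of \<open>g\<close> is enough because \<open>\<theta>\<close> has compact support
  and the cut-offs are uniformly bounded.\<close>

lemma upper_cutoff_limit:
  assumes g: "g \<in> L1_loc" and \<theta>: "\<theta> \<in> test_functions"
  shows "(\<lambda>n. \<integral>x. g x * (\<theta> x * upper_cutoff n b x) \<partial>lborel) \<longlonglongrightarrow> (LINT x:{..b}|lborel. g x * \<theta> x)"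
  unfolding set_lebesgue_integral_def
proof -
  have int: "integrable lborel (\<lambda>x. g x * \<theta> x)" by (rule L1_loc_mult_test[OF g \<theta>])
  obtain B where B: "\<forall>x. norm (nderiv 0 step x) \<le> B" using step_nderiv_bounded by blast
  then have B': "norm (step x) \<le> B" for x by simp
  have B0: "B \<ge> 0" using order_trans[OF norm_ge_zero B'] .
  show "(\<lambda>n. \<integral>x. g x * (\<theta> x * upper_cutoff n b x) \<partial>lborel) \<longlonglongrightarrow> (\<integral>x. indicator {..b} x *\<^sub>R (g x * \<theta> x) \<partial>lborel)"
  proof (rule integral_dominated_convergence[where w = "\<lambda>x. norm (B *\<^sub>R (g x * \<theta> x))"])
    have "upper_cutoff n b \<in> borel_measurable lborel" for n
      using borel_measurable_continuous_onI[OF smooth_continuous[OF smooth_upper_cutoff]] by simp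
    then show "(\<lambda>x. g x * (\<theta> x * upper_cutoff n b x)) \<in> borel_measurable lborel" for n
      unfolding mult.assoc[symmetric] by (intro borel_measurable_times borel_measurable_integrable[OF int])
    show "(\<lambda>x. indicator {..b} x *\<^sub>R (g x * \<theta> x)) \<in> borel_measurable lborel"
      by (intro borel_measurable_scaleR borel_measurable_indicator borel_measurable_integrable[OF int]) simp
    show "integrable lborel (\<lambda>x. norm (B *\<^sub>R (g x * \<theta> x)))"
      by (intro integrable_norm integrable_scaleR_right int)
    show "AE x in lborel. (\<lambda>n. g x * (\<theta> x * upper_cutoff n b x)) \<longlonglongrightarrow> indicator {..b} x *\<^sub>R (g x * \<theta> x)"
    proof (rule AE_I2)
      fix x
      have "(\<lambda>n. upper_cutoff n b x) \<longlonglongrightarrow> indicator {..b} x"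
      proof (cases "x \<le> b")
        case True
        have "- real n * x + (real n * b + 1) \<ge> 1" for n
          using mult_left_mono[OF True, of "real n"] by simp
        then show ?thesis using True by (simp add: upper_cutoff_def step_1 indicator_def)
      next
        case False
        obtain n0 :: nat where n0: "1 / (x - b) \<le> real n0" using real_arch_simple by blast
        have "upper_cutoff n b x = 0" if "n \<ge> n0" for n
        proof -
          have "1 / (x - b) \<le> real n" using n0 that by linarith
          then have "1 \<le> real n * (x - b)" using False by (simp add: pos_divide_le_eq)
          then show ?thesis by (simp add: upper_cutoff_def step_0 algebra_simps)
        qed
        then have "\<forall>\<^sub>F n in sequentially. upper_cutoff n b x = indicator {..b} x"
          using False unfolding eventually_sequentially by auto
        then show ?thesis by (rule tendsto_eventually)
      qed
      then have "(\<lambda>n. g x * \<theta> x * upper_cutoff n b x) \<longlonglongrightarrow> g x * \<theta> x * indicator {..b} x"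
        by (intro tendsto_mult tendsto_const)
      then show "(\<lambda>n. g x * (\<theta> x * upper_cutoff n b x)) \<longlonglongrightarrow> indicator {..b} x *\<^sub>R (g x * \<theta> x)"
        by (cases "x \<le> b") (simp_all add: mult.assoc)
    qed
    show "AE x in lborel. norm (g x * (\<theta> x * upper_cutoff n b x)) \<le> norm (B *\<^sub>R (g x * \<theta> x))" for n
    proof (rule AE_I2)
      fix x
      have "norm (g x * \<theta> x) * norm (upper_cutoff n b x) \<le> norm (g x * \<theta> x) * B"
        unfolding upper_cutoff_def by (intro mult_left_mono B') auto
      then show "norm (g x * (\<theta> x * upper_cutoff n b x)) \<le> norm (B *\<^sub>R (g x * \<theta> x))"
        using B0 by (simp add: norm_mult mult_ac)
    qed
  qed
qed

text \<open>Steep cut-offs give equality of all half-line integrals, and differentiating in the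
  endpoint recovers the values at \<open>b\<close>, where the localizing \<open>cut\<close> equals
  \<open>1\<close>. Tests are restricted to real values because \<open>pairing_real\<close> has
  information about those only.\<close>

lemma continuous_eq_if_weakly_eq:
  fixes g h :: "real \<Rightarrow> complex"
  assumes g: "continuous_on UNIV g" and h: "continuous_on UNIV h"
    and eq: "\<And>\<theta>. \<theta> \<in> test_functions \<Longrightarrow> (\<And>x. \<theta> x \<in> \<real>) \<Longrightarrow> (\<integral>x. g x * \<theta> x \<partial>lborel) = (\<integral>x. h x * \<theta> x \<partial>lborel)"
  shows "g = h"
proof
  fix b
  let ?\<theta> = "cut (b - 2) (b + 3)"
  have half: "(LINT x:{..c}|lborel. g x * ?\<theta> x) = (LINT x:{..c}|lborel. h x * ?\<theta> x)" for c
  proof (rule LIMSEQ_unique[OF upper_cutoff_limit[OF continuous_L1_loc[OF g] cut_test]])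
    have "(\<integral>x. g x * (?\<theta> x * upper_cutoff n c x) \<partial>lborel) = (\<integral>x. h x * (?\<theta> x * upper_cutoff n c x) \<partial>lborel)" for n
      by (rule eq[OF test_mult[OF cut_test smooth_upper_cutoff]])
        (simp add: cut_Reals upper_cutoff_def step_Reals)
    then show "(\<lambda>n. \<integral>x. g x * (?\<theta> x * upper_cutoff n c x) \<partial>lborel) \<longlonglongrightarrow> (LINT x:{..c}|lborel. h x * ?\<theta> x)"
      using upper_cutoff_limit[OF continuous_L1_loc[OF h] cut_test] by simp
  qed
  have deriv: "((\<lambda>c. LINT x:{..c}|lborel. f x * ?\<theta> x) has_vector_derivative f b) (at b within {b-2..b+3})"
    if f: "continuous_on UNIV f" for f
  proof -
    have cont: "continuous_on S (\<lambda>x. f x * ?\<theta> x)" for S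
      by (intro continuous_on_mult continuous_on_subset[OF f] smooth_continuous[OF smooth_cut]) auto
    have H: "(LINT x:{..c}|lborel. f x * ?\<theta> x) = integral {b-2..c} (\<lambda>x. f x * ?\<theta> x)" for c
    proof -
      have "(LINT x:{..c}|lborel. f x * ?\<theta> x) = (LINT x:{b-2..c}|lborel. f x * ?\<theta> x)"
        unfolding set_lebesgue_integral_def
        by (rule Bochner_Integration.integral_cong) (auto simp: indicator_def cut_0)
      then show ?thesis
        using set_borel_integral_eq_integral(2)[OF borel_integrable_atLeastAtMost'[OF cont]] by simp
    qed
    show ?thesis
      unfolding H using integral_has_vector_derivative[OF cont, of b "b - 2" "b + 3"] by (simp add: cut_1)
  qed
  have "((\<lambda>c. LINT x:{..c}|lborel. h x * ?\<theta> x) has_vector_derivative g b) (at b within {b-2..b+3})"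
    using deriv[OF g] unfolding half .
  then show "g b = h b"
    using vector_derivative_unique_within_closed_interval[of "b-2" "b+3" b _ "g b" "h b"] deriv[OF h]
    by (simp add: box_real)
qed

lemma has_bochner_integral_exp_halfline:
  fixes a :: real
  assumes a: "a > 0"
  shows "has_bochner_integral lborel (\<lambda>x. indicator {..0} x *\<^sub>R exp (a * x)) (1 / a)"
proof -
  have "(\<integral>\<^sup>+x. ennreal (exp (- a * x)) * indicator {0..} x \<partial>lborel) = ennreal (0 - (- exp (- a * 0) / a))"
  proof (rule nn_integral_FTC_atLeast)
    show "DERIV (\<lambda>x. - exp (- a * x) / a) x :> exp (- a * x)" for x
      using a by (auto intro!: derivative_eq_intros)
    show "((\<lambda>x. - exp (- a * x) / a) \<longlongrightarrow> 0) at_top" using a by real_asymp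
  qed auto
  moreover have "ennreal (indicator {0..} x *\<^sub>R exp (- a * x)) = ennreal (exp (- a * x)) * indicator {0..} x" for x
    by (simp add: indicator_def)
  ultimately have "(\<integral>\<^sup>+x. ennreal (indicator {0..} x *\<^sub>R exp (- a * x)) \<partial>lborel) = ennreal (1 / a)"
    by simp
  then have "has_bochner_integral lborel (\<lambda>x. indicator {0..} x *\<^sub>R exp (- a * x)) (1 / a)"
    using a by (intro has_bochner_integral_nn_integral) (auto simp: indicator_def)
  from iffD1[OF lborel_has_bochner_integral_real_affine_iff[of "-1" _ _ 0] this]
  have "has_bochner_integral lborel (\<lambda>x. indicator {0..} (- x) *\<^sub>R exp (a * x)) (1 / a)"
    by simp
  moreover have "indicator {0..} (- x) = (indicator {..0} x :: real)" for x :: real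
    by (simp add: indicator_def)
  ultimately show ?thesis by simp
qed

lemma halfline_dominated_limit:
  fixes f :: "nat \<Rightarrow> real \<Rightarrow> 'a::{banach, second_countable_topology}"
  assumes a: "a > 0" and f: "\<And>n. continuous_on UNIV (f n)" and g: "continuous_on UNIV g"
    and lim: "\<And>x. x \<le> 0 \<Longrightarrow> (\<lambda>n. f n x) \<longlonglongrightarrow> g x"
    and bound: "\<And>n x. x \<le> 0 \<Longrightarrow> norm (f n x) \<le> C * exp (a * x)"
  shows "(\<lambda>n. LINT x:{..0}|lborel. f n x) \<longlonglongrightarrow> (LINT x:{..0}|lborel. g x)"
  unfolding set_lebesgue_integral_def
proof (rule integral_dominated_convergence[where w = "\<lambda>x. C * (indicator {..0} x *\<^sub>R exp (a * x))"])
  have meas: "(\<lambda>x. indicator {..0} x *\<^sub>R h x) \<in> borel_measurable lborel"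
    if "continuous_on UNIV h" for h :: "real \<Rightarrow> 'a"
    using borel_measurable_continuous_onI[OF that]
    by (intro borel_measurable_scaleR borel_measurable_indicator) auto
  show "(\<lambda>x. indicator {..0} x *\<^sub>R g x) \<in> borel_measurable lborel" by (rule meas[OF g])
  show "(\<lambda>x. indicator {..0} x *\<^sub>R f n x) \<in> borel_measurable lborel" for n by (rule meas[OF f])
  show "integrable lborel (\<lambda>x. C * (indicator {..0} x *\<^sub>R exp (a * x)))"
    using has_bochner_integral_exp_halfline[OF a]
    by (intro integrable_mult_right) (simp add: has_bochner_integral_iff)
  show "AE x in lborel. (\<lambda>n. indicator {..0} x *\<^sub>R f n x) \<longlonglongrightarrow> indicator {..0} x *\<^sub>R g x"
  proof (rule AE_I2)
    show "(\<lambda>n. indicator {..0} x *\<^sub>R f n x) \<longlonglongrightarrow> indicator {..0} x *\<^sub>R g x" for x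
      using lim[of x] by (cases "x \<le> 0") auto
  qed
  show "AE x in lborel. norm (indicator {..0} x *\<^sub>R f n x) \<le> C * (indicator {..0} x *\<^sub>R exp (a * x))" for n
  proof (rule AE_I2)
    show "norm (indicator {..0} x *\<^sub>R f n x) \<le> C * (indicator {..0} x *\<^sub>R exp (a * x))" for x
      using bound[of x n] by (cases "x \<le> 0") auto
  qed
qed

subsection \<open>Truncated exponentials\<close>

text \<open>With upper end \<open>4\<close> the cut-off is \<open>1\<close> up to \<open>3\<close>.
  For \<open>t \<le> 0\<close> the pairing evaluates at \<open>t - x\<close> with
  \<open>x \<ge> -2\<close>, so at points up to \<open>2\<close>, where the function and all its
  derivatives are unaffected by the upper end.\<close>

definition exp_cut :: "complex \<Rightarrow> nat \<Rightarrow> real \<Rightarrow> complex" where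
  "exp_cut s n = (\<lambda>x. cut (- real n) 4 x * exp (s * of_real x))"

lemma exp_cut_test: "exp_cut s n \<in> test_functions"
  unfolding exp_cut_def by (rule cut_mult_test[OF smooth_exp])

text \<open>The profile \<open>exp (Re s * x)\<close> survives because the cut-off estimate is
  pointwise; the constant does not depend on \<open>n\<close>, as dominated convergence
  requires.\<close>

lemma exp_cut_nderiv_bound:
  "\<exists>C\<ge>0. \<forall>n x. norm (nderiv k (exp_cut s n) x) \<le> C * exp (Re s * x)"
proof -
  obtain D where D: "D \<ge> 0" "\<forall>a b f x A. smooth f \<longrightarrow> (\<forall>i\<le>k. norm (nderiv i f x) \<le> A) \<longrightarrow>
     norm (nderiv k (\<lambda>x. cut a b x * f x) x) \<le> D * A"
    using cut_mult_nderiv_bound[of k] by blast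
  have "norm (nderiv k (exp_cut s n) x) \<le> D * ((1 + norm s) ^ k * exp (Re s * x))" for n x
    unfolding exp_cut_def
  proof (rule D(2)[rule_format, OF smooth_exp])
    fix i assume "i \<le> k"
    have "norm s ^ i \<le> (1 + norm s) ^ i" by (intro power_mono) auto
    also have "\<dots> \<le> (1 + norm s) ^ k" using \<open>i \<le> k\<close> by (intro power_increasing) auto
    finally show "norm (nderiv i (\<lambda>x. exp (s * of_real x)) x) \<le> (1 + norm s) ^ k * exp (Re s * x)"
      unfolding nderiv_exp norm_mult norm_power norm_exp_mult_of_real by (intro mult_right_mono) auto
  qed
  then have "\<forall>n x. norm (nderiv k (exp_cut s n) x) \<le> (D * (1 + norm s) ^ k) * exp (Re s * x)"
    by (simp add: mult.assoc)
  moreover have "D * (1 + norm s) ^ k \<ge> 0" using D(1) by simp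
  ultimately show ?thesis by blast
qed

lemma exp_cut_nderiv_eq:
  assumes "- real n + 1 < x" "x < 3"
  shows "nderiv k (exp_cut s n) x = s ^ k * exp (s * of_real x)"
proof -
  have "nderiv k (exp_cut s n) x = nderiv k (\<lambda>x. exp (s * of_real x)) x"
    by (rule nderiv_cong_open[OF test_smooth[OF exp_cut_test] smooth_exp, of "{- real n + 1<..<3}"])
      (use assms in \<open>auto simp: exp_cut_def cut_1\<close>)
  then show ?thesis by (simp add: nderiv_exp)
qed

context causal_tempered
begin

text \<open>The bound \<open>exp (Re s * (t - x))\<close> splits into a profile in time and a
  decaying factor in \<open>x\<close> that absorbs the weight of the seminorms. The profile supplies
  the majorant for the half-line integrals.\<close>

lemma pairing_exp_cut_bound:
  assumes s: "Re s > 0"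
  shows "\<exists>C\<ge>0. \<forall>n t. norm (pairing (\<lambda>x. nderiv j (exp_cut s n) (t - x))) \<le> C * exp (Re s * t)"
proof -
  obtain C m where C: "C > 0" "\<forall>g B. g \<in> right_decaying \<longrightarrow>
      (\<forall>k\<le>m. \<forall>x\<ge>-2. (1 + \<bar>x\<bar>) ^ m * norm (nderiv k g x) \<le> B) \<longrightarrow> norm (pairing g) \<le> C * B"
    by (rule pairing_bound)
  have "\<forall>k. \<exists>D. D \<ge> 0 \<and> (\<forall>n x. norm (nderiv k (exp_cut s n) x) \<le> D * exp (Re s * x))"
    using exp_cut_nderiv_bound by blast
  from choice[OF this] obtain D where DD: "\<forall>k. D k \<ge> 0 \<and> (\<forall>n x. norm (nderiv k (exp_cut s n) x) \<le> D k * exp (Re s * x))" ..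
  have D0: "D k \<ge> 0" and D: "norm (nderiv k (exp_cut s n) x) \<le> D k * exp (Re s * x)" for k n x
    using DD by blast+
  define E where "E = (\<Sum>k\<le>m. D (k + j))"
  have E: "D (k + j) \<le> E" if "k \<le> m" for k
    unfolding E_def using that D0 by (intro member_le_sum) auto
  have E0: "E \<ge> 0" unfolding E_def by (intro sum_nonneg D0)
  obtain K where K: "K > 0" "\<forall>x\<ge>-2. (1 + \<bar>x\<bar>) ^ m * exp (- Re s * x) \<le> K"
    by (rule power_times_exp_bounded[OF s])
  have "norm (pairing (\<lambda>x. nderiv j (exp_cut s n) (t - x))) \<le> C * (E * exp (Re s * t) * K)" for n t
  proof (rule C(2)[rule_format])
    show "(\<lambda>x. nderiv j (exp_cut s n) (t - x)) \<in> right_decaying"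
      using test_reflect[OF nderiv_test[OF exp_cut_test]] test_right_decaying by blast
    fix k x assume k: "k \<le> m" and x: "(x::real) \<ge> -2"
    have "norm (nderiv k (\<lambda>x. nderiv j (exp_cut s n) (t - x)) x) = norm (nderiv (k + j) (exp_cut s n) (t - x))"
      by (simp add: nderiv_reflect[OF smooth_nderiv_smooth[OF test_smooth[OF exp_cut_test]]]
          nderiv_add_index norm_mult norm_power)
    also have "\<dots> \<le> D (k + j) * exp (Re s * (t - x))" by (rule D)
    also have "\<dots> \<le> E * exp (Re s * (t - x))" by (intro mult_right_mono E k) auto
    also have "\<dots> = E * exp (Re s * t) * exp (- Re s * x)"
      by (simp add: right_diff_distrib exp_diff exp_minus divide_inverse)
    finally have "(1 + \<bar>x\<bar>) ^ m * norm (nderiv k (\<lambda>x. nderiv j (exp_cut s n) (t - x)) x) \<le>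
        (1 + \<bar>x\<bar>) ^ m * (E * exp (Re s * t) * exp (- Re s * x))" by (intro mult_left_mono) auto
    also have "\<dots> = E * exp (Re s * t) * ((1 + \<bar>x\<bar>) ^ m * exp (- Re s * x))" by (simp add: mult_ac)
    also have "\<dots> \<le> E * exp (Re s * t) * K"
      using K(2) x E0 by (intro mult_left_mono) auto
    finally show "(1 + \<bar>x\<bar>) ^ m * norm (nderiv k (\<lambda>x. nderiv j (exp_cut s n) (t - x)) x) \<le> E * exp (Re s * t) * K" .
  qed
  then have "\<forall>n t. norm (pairing (\<lambda>x. nderiv j (exp_cut s n) (t - x))) \<le> (C * E * K) * exp (Re s * t)"
    by (simp add: mult_ac)
  moreover have "C * E * K \<ge> 0" using C(1) E0 K(1) by simp
  ultimately show ?thesis by blast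
qed

text \<open>Truncated and full exponential agree with all derivatives for
  \<open>x < n + t - 1\<close>. Beyond that point \<open>1 + |x| \<ge> n + t\<close>, and a spare
  power of the weight gives the rate \<open>1 / (n + t)\<close>.\<close>

lemma pairing_exp_cut_limit:
  assumes s: "Re s > 0" and t: "t \<le> 0"
  shows "(\<lambda>n. pairing (\<lambda>x. nderiv j (exp_cut s n) (t - x))) \<longlonglongrightarrow> s ^ j * exp (s * of_real t) * laplace Y s"
proof -
  obtain C m where C: "C > 0" "\<forall>g B. g \<in> right_decaying \<longrightarrow>
      (\<forall>k\<le>m. \<forall>x\<ge>-2. (1 + \<bar>x\<bar>) ^ m * norm (nderiv k g x) \<le> B) \<longrightarrow> norm (pairing g) \<le> C * B"
    by (rule pairing_bound)
  have "\<forall>k. \<exists>D. D \<ge> 0 \<and> (\<forall>n x. norm (nderiv k (exp_cut s n) x) \<le> D * exp (Re s * x))"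
    using exp_cut_nderiv_bound by blast
  from choice[OF this] obtain D where DD: "\<forall>k. D k \<ge> 0 \<and> (\<forall>n x. norm (nderiv k (exp_cut s n) x) \<le> D k * exp (Re s * x))" ..
  have D0: "D k \<ge> 0" and D: "norm (nderiv k (exp_cut s n) x) \<le> D k * exp (Re s * x)" for k n x
    using DD by blast+
  \<comment> \<open>\<open>D (k + j)\<close> bounds the truncated exponential and
    \<open>norm s ^ (k + j)\<close> the full one.\<close>
  define E where "E = (\<Sum>k\<le>m. D (k + j) + norm s ^ (k + j))"
  have E: "D (k + j) + norm s ^ (k + j) \<le> E" if "k \<le> m" for k
    unfolding E_def using that D0 by (intro member_le_sum) auto
  have E0: "E \<ge> 0" unfolding E_def by (intro sum_nonneg add_nonneg_nonneg D0) auto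
  obtain K where K: "K > 0" "\<forall>x\<ge>-2. (1 + \<bar>x\<bar>) ^ Suc m * exp (- Re s * x) \<le> K"
    by (rule power_times_exp_bounded[OF s])
  let ?h = "\<lambda>x. (s ^ j * exp (s * of_real t)) * exp (- s * of_real x)"
  have h: "?h \<in> right_decaying" by (rule right_decaying_cmult[OF exp_right_decaying[OF s]])
  have ph: "pairing ?h = s ^ j * exp (s * of_real t) * laplace Y s"
    using pairing_cmult[OF exp_right_decaying[OF s]] laplace_eq_pairing[OF s] by simp
  have main: "norm (pairing (\<lambda>x. nderiv j (exp_cut s n) (t - x)) - pairing ?h) \<le>
      C * (E * exp (Re s * t) * K / (real n + t))" if n: "real n + t > 0" for n
  proof -
    let ?g = "\<lambda>x. nderiv j (exp_cut s n) (t - x)"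
    note sc = test_smooth[OF exp_cut_test]
    have g: "?g \<in> right_decaying"
      using test_reflect[OF nderiv_test[OF exp_cut_test]] test_right_decaying by blast
    have "norm (pairing (\<lambda>x. ?g x - ?h x)) \<le> C * (E * exp (Re s * t) * K / (real n + t))"
    proof (rule C(2)[rule_format, OF right_decaying_diff[OF g h]])
      fix k x assume k: "k \<le> m" and x: "(x::real) \<ge> -2"
      have "exp (s * of_real t) * exp (- s * of_real x) = exp (s * of_real (t - x))"
        by (simp add: exp_add[symmetric] algebra_simps)
      then have d: "nderiv k (\<lambda>x. ?g x - ?h x) x =
          (-1) ^ k * (nderiv (k + j) (exp_cut s n) (t - x) - s ^ (k + j) * exp (s * of_real (t - x)))"
        unfolding nderiv_diff[OF right_decaying_smooth[OF g] right_decaying_smooth[OF h]]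
          nderiv_cmult[OF smooth_exp] nderiv_exp nderiv_reflect[OF smooth_nderiv_smooth[OF sc]] nderiv_add_index
        by (simp add: power_minus[of s] power_add algebra_simps)
      show "(1 + \<bar>x\<bar>) ^ m * norm (nderiv k (\<lambda>x. ?g x - ?h x) x) \<le> E * exp (Re s * t) * K / (real n + t)"
      proof (cases "- real n + 1 < t - x")
        case True
        then have "nderiv k (\<lambda>x. ?g x - ?h x) x = 0"
          unfolding d using x t by (simp add: exp_cut_nderiv_eq)
        then show ?thesis using E0 K(1) n by simp
      next
        case False
        have "norm (nderiv k (\<lambda>x. ?g x - ?h x) x) \<le>
            norm (nderiv (k + j) (exp_cut s n) (t - x)) + norm (s ^ (k + j) * exp (s * of_real (t - x)))"
          unfolding d norm_mult[of "(-1) ^ k"] by (simp add: norm_power norm_triangle_ineq4)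
        also have "\<dots> \<le> D (k + j) * exp (Re s * (t - x)) + norm s ^ (k + j) * exp (Re s * (t - x))"
          unfolding norm_mult norm_power norm_exp_mult_of_real by (intro add_right_mono D)
        also have "\<dots> \<le> E * exp (Re s * (t - x))"
          unfolding distrib_right[symmetric] by (intro mult_right_mono E k) auto
        also have "\<dots> = E * exp (Re s * t) * exp (- Re s * x)"
          by (simp add: right_diff_distrib exp_diff exp_minus divide_inverse)
        finally have *: "(1 + \<bar>x\<bar>) ^ Suc m * norm (nderiv k (\<lambda>x. ?g x - ?h x) x) \<le>
            (1 + \<bar>x\<bar>) ^ Suc m * (E * exp (Re s * t) * exp (- Re s * x))" by (intro mult_left_mono) auto
        also have "\<dots> = E * exp (Re s * t) * ((1 + \<bar>x\<bar>) ^ Suc m * exp (- Re s * x))" by (simp add: mult_ac)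
        also have "\<dots> \<le> E * exp (Re s * t) * K"
          using K(2) x E0 by (intro mult_left_mono) auto
        finally have **: "(1 + \<bar>x\<bar>) ^ Suc m * norm (nderiv k (\<lambda>x. ?g x - ?h x) x) \<le> E * exp (Re s * t) * K" .
        have "(real n + t) * ((1 + \<bar>x\<bar>) ^ m * norm (nderiv k (\<lambda>x. ?g x - ?h x) x)) \<le>
            (1 + \<bar>x\<bar>) * ((1 + \<bar>x\<bar>) ^ m * norm (nderiv k (\<lambda>x. ?g x - ?h x) x))"
          using False by (intro mult_right_mono) auto
        also have "\<dots> \<le> E * exp (Re s * t) * K" using ** by (simp only: power_Suc mult.assoc)
        finally show ?thesis using n by (simp only: pos_le_divide_eq mult.commute)
      qed
    qed
    then show ?thesis unfolding pairing_diff[OF g h] .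
  qed
  have lim: "(\<lambda>n. C * (E * exp (Re s * t) * K / (real n + t))) \<longlonglongrightarrow> 0"
    by real_asymp
  obtain n0 :: nat where n0: "- t < real n0" using reals_Archimedean2 by blast
  have "\<forall>\<^sub>F n in sequentially. norm (pairing (\<lambda>x. nderiv j (exp_cut s n) (t - x)) - pairing ?h) \<le>
      C * (E * exp (Re s * t) * K / (real n + t))"
    unfolding eventually_sequentially
  proof (intro exI[of _ n0] allI impI)
    fix n assume "n0 \<le> n"
    then have "real n + t > 0" using n0 by linarith
    then show "norm (pairing (\<lambda>x. nderiv j (exp_cut s n) (t - x)) - pairing ?h) \<le>
      C * (E * exp (Re s * t) * K / (real n + t))" by (rule main)
  qed
  then have "(\<lambda>n. pairing (\<lambda>x. nderiv j (exp_cut s n) (t - x)) - pairing ?h) \<longlonglongrightarrow> 0"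
    by (rule Lim_null_comparison[OF _ lim])
  then show ?thesis unfolding ph[symmetric] by (simp only: LIM_zero_iff)
qed

section \<open>The convolution output as a function, and the limit in the passivity
  inequality\<close>

lemma conv_eq_pairing_translate:
  assumes \<phi>: "\<phi> \<in> test_functions" and \<theta>: "\<theta> \<in> test_functions"
  shows "conv Y (dist_of_fun \<phi>) \<theta> = (\<integral>t. pairing (\<lambda>x. \<phi> (t - x)) * \<theta> t \<partial>lborel)"
  unfolding conv_dist_of_fun[OF \<phi> \<theta>] Y_pairing[OF correlation_test[OF \<phi> \<theta>]] by (rule pairing_correlation[OF \<phi> \<theta>])

text \<open>For a merely locally integrable output this equality against tests is all that is
  extracted from passivity; no pointwise statement is made.\<close>

lemma conv_eq_dist_of_fun_weak:
  assumes \<phi>: "\<phi> \<in> test_functions" and \<theta>: "\<theta> \<in> test_functions"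
    and \<psi>: "conv Y (dist_of_fun \<phi>) = dist_of_fun \<psi>"
  shows "(\<integral>t. \<psi> t * \<theta> t \<partial>lborel) = (\<integral>t. pairing (\<lambda>x. \<phi> (t - x)) * \<theta> t \<partial>lborel)"
proof -
  have "dist_of_fun \<psi> \<theta> = (\<integral>t. \<psi> t * \<theta> t \<partial>lborel)"
    unfolding dist_of_fun_def by (rule restrict_apply'[OF \<theta>])
  then show ?thesis using conv_eq_pairing_translate[OF \<phi> \<theta>] unfolding \<psi> by (rule trans[OF sym])
qed

lemma continuous_pairing_translate:
  "\<phi> \<in> test_functions \<Longrightarrow> continuous_on S (\<lambda>t. pairing (\<lambda>x. \<phi> (t - x)))"
  by (rule smooth_continuous[OF smooth_pairing_translate])

lemma passivity_limit:
  assumes pp: "pseudo_passivity Y N c d" and s: "Re s > 0"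
  shows "(\<Sum>j\<le>N. norm s ^ (2 * j) * (c j + (norm (laplace Y s))\<^sup>2 * d j)) \<le> Re (laplace Y s)"
proof -
  let ?W = "laplace Y s"
  let ?\<phi> = "exp_cut s"
  let ?F = "\<lambda>j n t. pairing (\<lambda>x. nderiv j (?\<phi> n) (t - x))"
  \<comment> \<open>Both sides are quadratic in the exponentials, so the majorants carry twice the
    rate \<open>Re s\<close>.\<close>
  define a where "a = 2 * Re s"
  have a: "a > 0" using s by (simp add: a_def)
  have ea: "exp (Re s * x) * exp (Re s * x) = exp (a * x)" for x
    by (simp add: a_def exp_add[symmetric])
  note \<phi> = exp_cut_test[of s]
  have "\<forall>n. \<exists>\<psi>. \<psi> \<in> (if \<forall>j\<le>N. d j = 0 then L1_loc else test_functions) \<and>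
      conv Y (dist_of_fun (?\<phi> n)) = dist_of_fun \<psi> \<and>
      Re (LINT \<tau>:{..0}|lborel. cnj (?\<phi> n \<tau>) * \<psi> \<tau>) \<ge>
        (\<Sum>j\<le>N. LINT \<tau>:{..0}|lborel. c j * (norm (nderiv j (?\<phi> n) \<tau>))\<^sup>2 + d j * (norm (nderiv j \<psi> \<tau>))\<^sup>2)"
    using pp \<phi> unfolding pseudo_passivity_def by meson
  from choice[OF this] obtain \<psi> where
    \<psi>: "\<forall>n. \<psi> n \<in> (if \<forall>j\<le>N. d j = 0 then L1_loc else test_functions) \<and>
      conv Y (dist_of_fun (?\<phi> n)) = dist_of_fun (\<psi> n) \<and>
      Re (LINT \<tau>:{..0}|lborel. cnj (?\<phi> n \<tau>) * \<psi> n \<tau>) \<ge>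
        (\<Sum>j\<le>N. LINT \<tau>:{..0}|lborel. c j * (norm (nderiv j (?\<phi> n) \<tau>))\<^sup>2 + d j * (norm (nderiv j (\<psi> n) \<tau>))\<^sup>2)" ..
  have conv: "conv Y (dist_of_fun (?\<phi> n)) = dist_of_fun (\<psi> n)" for n using \<psi> by blast
  have L1: "\<psi> n \<in> L1_loc" for n
    using \<psi> test_L1_loc[of "\<psi> n"] by (cases "\<forall>j\<le>N. d j = 0") auto
  note weak = conv_eq_dist_of_fun_weak[OF \<phi> _ conv]
  have F0: "?F 0 n = (\<lambda>t. pairing (\<lambda>x. ?\<phi> n (t - x)))" for n by simp
  \<comment> \<open>\<open>\<psi> n\<close> is known only weakly, so the sharp integral is reached
    by testing with \<open>cnj (?\<phi> n x) * upper_cutoff k 0 x\<close> and letting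
    \<open>k\<close> grow.\<close>
  have lhs: "(LINT \<tau>:{..0}|lborel. cnj (?\<phi> n \<tau>) * \<psi> n \<tau>) = (LINT \<tau>:{..0}|lborel. cnj (?\<phi> n \<tau>) * ?F 0 n \<tau>)" for n
  proof -
    note \<phi>c = test_cnj[OF \<phi>[of n]]
    have "(LINT \<tau>:{..0}|lborel. \<psi> n \<tau> * cnj (?\<phi> n \<tau>)) = (LINT \<tau>:{..0}|lborel. ?F 0 n \<tau> * cnj (?\<phi> n \<tau>))"
    proof (rule LIMSEQ_unique[OF upper_cutoff_limit[OF L1 \<phi>c]])
      have "(\<integral>x. \<psi> n x * (cnj (?\<phi> n x) * upper_cutoff k 0 x) \<partial>lborel) =
          (\<integral>x. ?F 0 n x * (cnj (?\<phi> n x) * upper_cutoff k 0 x) \<partial>lborel)" for k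
        using weak[OF test_mult[OF \<phi>c smooth_upper_cutoff[of k 0]], of n] by simp
      then show "(\<lambda>k. \<integral>x. \<psi> n x * (cnj (?\<phi> n x) * upper_cutoff k 0 x) \<partial>lborel) \<longlonglongrightarrow>
          (LINT \<tau>:{..0}|lborel. ?F 0 n \<tau> * cnj (?\<phi> n \<tau>))"
        using upper_cutoff_limit[OF continuous_L1_loc[OF continuous_pairing_translate[OF \<phi>[of n]]] \<phi>c, of 0]
        by simp
    qed
    then show ?thesis by (simp only: mult.commute)
  qed
  \<comment> \<open>If \<open>d j\<close> is nonzero, the output is a test function, so weak
    equality is equality and the derivatives can be exchanged; if it is zero, both sides
    vanish.\<close>
  have rhs: "d j * (norm (nderiv j (\<psi> n) \<tau>))\<^sup>2 = d j * (norm (?F j n \<tau>))\<^sup>2" if j: "j \<le> N" for j n \<tau>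
  proof (cases "d j = 0")
    case False
    then have "\<psi> n \<in> test_functions" using \<psi>[rule_format, of n] j by (auto split: if_splits)
    then have "\<psi> n = (\<lambda>t. pairing (\<lambda>x. ?\<phi> n (t - x)))"
      by (intro continuous_eq_if_weakly_eq continuous_pairing_translate[OF \<phi>] weak
          smooth_continuous[OF test_smooth])
    then show ?thesis by (simp add: nderiv_pairing_translate[OF \<phi>])
  qed simp
  have ineq: "(\<Sum>j\<le>N. LINT \<tau>:{..0}|lborel. c j * (norm (nderiv j (?\<phi> n) \<tau>))\<^sup>2 + d j * (norm (?F j n \<tau>))\<^sup>2) \<le>
      Re (LINT \<tau>:{..0}|lborel. cnj (?\<phi> n \<tau>) * ?F 0 n \<tau>)" for n
    using \<psi>[rule_format, of n] rhs lhs[of n] by simp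
  have "\<forall>k. \<exists>D. D \<ge> 0 \<and> (\<forall>n x. norm (nderiv k (?\<phi> n) x) \<le> D * exp (Re s * x))"
    using exp_cut_nderiv_bound by blast
  from choice[OF this] obtain D where DD: "\<forall>k. D k \<ge> 0 \<and> (\<forall>n x. norm (nderiv k (?\<phi> n) x) \<le> D k * exp (Re s * x))" ..
  have D0: "D k \<ge> 0" and D: "norm (nderiv k (?\<phi> n) x) \<le> D k * exp (Re s * x)" for k n x
    using DD by blast+
  have "\<forall>k. \<exists>E. E \<ge> 0 \<and> (\<forall>n t. norm (?F k n t) \<le> E * exp (Re s * t))"
    using pairing_exp_cut_bound[OF s] by blast
  from choice[OF this] obtain E where EE: "\<forall>k. E k \<ge> 0 \<and> (\<forall>n t. norm (?F k n t) \<le> E k * exp (Re s * t))" ..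
  have E0: "E k \<ge> 0" and E: "norm (?F k n t) \<le> E k * exp (Re s * t)" for k n t
    using EE by blast+
  have \<phi>lim: "(\<lambda>n. nderiv k (?\<phi> n) t) \<longlonglongrightarrow> s ^ k * exp (s * of_real t)" if t: "t \<le> 0" for k t
  proof (rule tendsto_eventually)
    obtain n0 :: nat where n0: "1 - t < real n0" using reals_Archimedean2 by blast
    show "\<forall>\<^sub>F n in sequentially. nderiv k (?\<phi> n) t = s ^ k * exp (s * of_real t)"
      unfolding eventually_sequentially
      by (intro exI[of _ n0] allI impI exp_cut_nderiv_eq) (use n0 t in auto)
  qed
  have \<phi>lim0: "(\<lambda>n. ?\<phi> n t) \<longlonglongrightarrow> exp (s * of_real t)" if t: "t \<le> 0" for t
    using \<phi>lim[OF t, of 0] by simp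
  have \<phi>cont: "continuous_on UNIV (nderiv k (?\<phi> n))" for k n
    by (rule smooth_continuous_nderiv[OF test_smooth[OF \<phi>]])
  have Fcont: "continuous_on UNIV (?F k n)" for k n
    by (rule continuous_pairing_translate[OF nderiv_test[OF \<phi>]])
  define I where "I = (LINT \<tau>:{..0}|lborel. exp (a * \<tau>))"
  have I: "I > 0"
    using has_bochner_integral_exp_halfline[OF a] a
    by (simp add: I_def set_lebesgue_integral_def has_bochner_integral_iff)
  have nexp: "norm (exp (s * of_real x)) = exp (Re s * x)" for x :: real by (rule norm_exp_mult_of_real)
  have cexp: "cnj (exp (s * of_real x)) * exp (s * of_real x) = of_real (exp (a * x))" for x :: real
    using complex_norm_square[of "exp (s * of_real x)"] nexp[of x] ea[of x]
    by (simp add: power2_eq_square mult.commute flip: of_real_mult)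
  have "(\<lambda>n. LINT \<tau>:{..0}|lborel. cnj (?\<phi> n \<tau>) * ?F 0 n \<tau>) \<longlonglongrightarrow> (LINT \<tau>:{..0}|lborel. of_real (exp (a * \<tau>)) * ?W)"
  proof (rule halfline_dominated_limit[OF a])
    show "continuous_on UNIV (\<lambda>\<tau>. cnj (?\<phi> n \<tau>) * ?F 0 n \<tau>)" for n
      using \<phi>cont[of 0 n] by (intro continuous_on_mult continuous_on_cnj Fcont) simp
    show "continuous_on UNIV (\<lambda>\<tau>. of_real (exp (a * \<tau>)) * ?W)" by (intro continuous_intros)
    show "(\<lambda>n. cnj (?\<phi> n x) * ?F 0 n x) \<longlonglongrightarrow> of_real (exp (a * x)) * ?W" if "x \<le> 0" for x
    proof -
      have "(\<lambda>n. cnj (?\<phi> n x) * ?F 0 n x) \<longlonglongrightarrow> cnj (exp (s * of_real x)) * (s ^ 0 * exp (s * of_real x) * ?W)"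
        by (intro tendsto_mult tendsto_cnj \<phi>lim0 pairing_exp_cut_limit s that)
      then show ?thesis using cexp[of x] by (simp add: mult.assoc[symmetric])
    qed
    show "norm (cnj (?\<phi> n x) * ?F 0 n x) \<le> (D 0 * E 0) * exp (a * x)" for n x
    proof -
      have "norm (cnj (?\<phi> n x) * ?F 0 n x) \<le> (D 0 * exp (Re s * x)) * (E 0 * exp (Re s * x))"
        unfolding norm_mult complex_mod_cnj using D[of 0 n x] E[of 0 n x] D0[of 0] E0[of 0] by (intro mult_mono) auto
      then show ?thesis by (simp add: ea[symmetric] mult_ac)
    qed
  qed
  moreover have "(LINT \<tau>:{..0}|lborel. of_real (exp (a * \<tau>)) * ?W) = of_real I * ?W"
    by (simp add: I_def set_integral_complex_of_real)
  ultimately have "(\<lambda>n. LINT \<tau>:{..0}|lborel. cnj (?\<phi> n \<tau>) * ?F 0 n \<tau>) \<longlonglongrightarrow> of_real I * ?W"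
    by (simp only:)
  from tendsto_Re[OF this] have L: "(\<lambda>n. Re (LINT \<tau>:{..0}|lborel. cnj (?\<phi> n \<tau>) * ?F 0 n \<tau>)) \<longlonglongrightarrow> I * Re ?W" by simp
  have R: "(\<lambda>n. LINT \<tau>:{..0}|lborel. c j * (norm (nderiv j (?\<phi> n) \<tau>))\<^sup>2 + d j * (norm (?F j n \<tau>))\<^sup>2)
      \<longlonglongrightarrow> I * (norm s ^ (2 * j) * (c j + (norm ?W)\<^sup>2 * d j))" for j
  proof -
    let ?q = "norm s ^ (2 * j) * (c j + (norm ?W)\<^sup>2 * d j)"
    have "(\<lambda>n. LINT \<tau>:{..0}|lborel. c j * (norm (nderiv j (?\<phi> n) \<tau>))\<^sup>2 + d j * (norm (?F j n \<tau>))\<^sup>2)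
      \<longlonglongrightarrow> (LINT \<tau>:{..0}|lborel. exp (a * \<tau>) * ?q)"
    proof (rule halfline_dominated_limit[OF a])
      show "continuous_on UNIV (\<lambda>\<tau>. c j * (norm (nderiv j (?\<phi> n) \<tau>))\<^sup>2 + d j * (norm (?F j n \<tau>))\<^sup>2)" for n
        by (intro continuous_on_add continuous_on_mult continuous_on_const continuous_on_power continuous_on_norm \<phi>cont Fcont)
      show "continuous_on UNIV (\<lambda>\<tau>. exp (a * \<tau>) * ?q)" by (intro continuous_intros)
      show "(\<lambda>n. c j * (norm (nderiv j (?\<phi> n) x))\<^sup>2 + d j * (norm (?F j n x))\<^sup>2) \<longlonglongrightarrow> exp (a * x) * ?q" if "x \<le> 0" for x
      proof -
        have "(\<lambda>n. c j * (norm (nderiv j (?\<phi> n) x))\<^sup>2 + d j * (norm (?F j n x))\<^sup>2) \<longlonglongrightarrow>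
          c j * (norm (s ^ j * exp (s * of_real x)))\<^sup>2 + d j * (norm (s ^ j * exp (s * of_real x) * ?W))\<^sup>2"
          by (intro tendsto_add tendsto_mult tendsto_const tendsto_power tendsto_norm \<phi>lim pairing_exp_cut_limit s that)
        also have "c j * (norm (s ^ j * exp (s * of_real x)))\<^sup>2 + d j * (norm (s ^ j * exp (s * of_real x) * ?W))\<^sup>2 =
            exp (a * x) * ?q"
          by (simp add: norm_mult norm_power norm_exp_mult_of_real ea[symmetric] power_mult_distrib power_mult[symmetric]
              power2_eq_square algebra_simps mult_2_right power_add)
        finally show ?thesis .
      qed
      show "norm (c j * (norm (nderiv j (?\<phi> n) x))\<^sup>2 + d j * (norm (?F j n x))\<^sup>2) \<le>
          (\<bar>c j\<bar> * (D j)\<^sup>2 + \<bar>d j\<bar> * (E j)\<^sup>2) * exp (a * x)" for n x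
      proof -
        have "norm (c j * (norm (nderiv j (?\<phi> n) x))\<^sup>2 + d j * (norm (?F j n x))\<^sup>2) \<le>
            \<bar>c j\<bar> * (norm (nderiv j (?\<phi> n) x))\<^sup>2 + \<bar>d j\<bar> * (norm (?F j n x))\<^sup>2"
          by (rule order_trans[OF norm_triangle_ineq]) (simp add: abs_mult)
        also have "\<dots> \<le> \<bar>c j\<bar> * (D j * exp (Re s * x))\<^sup>2 + \<bar>d j\<bar> * (E j * exp (Re s * x))\<^sup>2"
          by (intro add_mono mult_left_mono power_mono D E) auto
        also have "\<dots> = (\<bar>c j\<bar> * (D j)\<^sup>2 + \<bar>d j\<bar> * (E j)\<^sup>2) * exp (a * x)"
          unfolding power_mult_distrib power2_eq_square[of "exp _"] ea by (simp only: distrib_right mult.assoc)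
        finally show ?thesis .
      qed
    qed
    moreover have "(LINT \<tau>:{..0}|lborel. exp (a * \<tau>) * ?q) = I * ?q" by (simp add: I_def)
    ultimately show ?thesis by (simp only:)
  qed
  have "(\<Sum>j\<le>N. I * (norm s ^ (2 * j) * (c j + (norm ?W)\<^sup>2 * d j))) \<le> I * Re ?W"
    by (rule LIMSEQ_le[OF tendsto_sum[OF R] L]) (use ineq in blast)
  then have "I * (\<Sum>j\<le>N. norm s ^ (2 * j) * (c j + (norm ?W)\<^sup>2 * d j)) \<le> I * Re ?W"
    by (simp only: sum_distrib_left)
  then show ?thesis using I by (simp only: mult_le_cancel_left_pos)
qed

subsection \<open>Real operators\<close>

text \<open>No integrability is involved: the integral of a non-integrable function is
  \<open>0\<close>, which is real as well.\<close>

lemma integral_in_Reals: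
  fixes h :: "real \<Rightarrow> complex"
  assumes "\<And>x. h x \<in> \<real>" shows "integral\<^sup>L lborel h \<in> \<real>"
proof -
  have "h = (\<lambda>x. of_real (Re (h x)))" using assms by (simp add: fun_eq_iff)
  then have "integral\<^sup>L lborel h = of_real (\<integral>x. Re (h x) \<partial>lborel)"
    using integral_complex_of_real[of lborel "\<lambda>x. Re (h x)"] by simp
  then show ?thesis by simp
qed

text \<open>Convolving \<open>Y\<close> with the reflection of \<open>\<phi>\<close> gives a
  continuous function whose value at time \<open>0\<close> is \<open>pairing \<phi>\<close>. Reality
  of the operator makes it weakly equal to its own conjugate, hence equal to it.\<close>

lemma pairing_real:
  assumes R: "real_operator Y" and \<phi>: "\<phi> \<in> test_functions" and real: "\<And>x. \<phi> x \<in> \<real>"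
  shows "pairing \<phi> \<in> \<real>"
proof -
  let ?\<phi> = "\<lambda>x. \<phi> (0 - x)"
  have t: "?\<phi> \<in> test_functions" by (rule test_reflect[OF \<phi>])
  let ?F = "\<lambda>t. pairing (\<lambda>x. ?\<phi> (t - x))"
  have "real_distribution (dist_of_fun ?\<phi>)"
    unfolding real_distribution_def dist_of_fun_def
    using real by (auto intro!: integral_in_Reals Reals_mult)
  then have R': "real_distribution (conv Y (dist_of_fun ?\<phi>))"
    using R dist_of_fun_conv_domain[OF t] unfolding real_operator_def by blast
  have "(\<lambda>t. cnj (?F t)) = ?F"
  proof (rule continuous_eq_if_weakly_eq)
    show "continuous_on UNIV (\<lambda>t. cnj (?F t))" by (intro continuous_on_cnj continuous_pairing_translate[OF t])
    show "continuous_on UNIV ?F" by (rule continuous_pairing_translate[OF t])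
    fix \<theta> :: "real \<Rightarrow> complex" assume \<theta>: "\<theta> \<in> test_functions" and rt: "\<And>x. \<theta> x \<in> \<real>"
    have "(\<integral>x. ?F x * \<theta> x \<partial>lborel) \<in> \<real>"
      using R' \<theta> rt conv_eq_pairing_translate[OF t \<theta>] unfolding real_distribution_def by auto
    then have "(\<integral>x. ?F x * \<theta> x \<partial>lborel) = (\<integral>x. cnj (?F x * \<theta> x) \<partial>lborel)"
      by (simp only: Bochner_Integration.integral_cnj Reals_cnj_iff)
    also have "\<dots> = (\<integral>x. cnj (?F x) * \<theta> x \<partial>lborel)"
      using rt by (simp add: Reals_cnj_iff)
    finally show "(\<integral>x. cnj (?F x) * \<theta> x \<partial>lborel) = (\<integral>x. ?F x * \<theta> x \<partial>lborel)" by simp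
  qed
  from fun_cong[OF this, of 0] show ?thesis by (simp add: Reals_cnj_iff)
qed

text \<open>The exponential is real on the line but not a test function. Its truncations are, and
  reality passes to the limit because the reals are closed.\<close>

lemma laplace_real:
  assumes R: "real_operator Y" and x: "x > 0"
  shows "laplace Y (of_real x) \<in> \<real>"
proof -
  let ?e = "\<lambda>y. exp (- of_real x * of_real y) :: complex"
  have x': "Re (of_real x) > 0" using x by simp
  have lim: "(\<lambda>n. V (\<lambda>y. plateau n y * (left_step y * ?e y))) \<longlonglongrightarrow> V (\<lambda>y. left_step y * ?e y)"
    by (rule tempered_functional_plateau_limit[OF V left_step_mult_schwartz[OF exp_right_decaying[OF x']]])
  have "V (\<lambda>y. plateau n y * (left_step y * ?e y)) \<in> \<real>" for n
  proof -
    have "(\<lambda>y. plateau n y * ?e y) \<in> test_functions" by (rule plateau_mult_test[OF smooth_exp])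
    then have "pairing (\<lambda>y. plateau n y * ?e y) \<in> \<real>"
    proof (rule pairing_real[OF R])
      fix y
      have "?e y = of_real (exp (- x * y))" unfolding exp_of_real[symmetric] by simp
      then have "?e y \<in> \<real>" by (simp only: Reals_of_real)
      then show "plateau n y * ?e y \<in> \<real>" unfolding plateau_def by (intro Reals_mult cut_Reals)
    qed
    then show ?thesis by (simp add: pairing_def mult.left_commute)
  qed
  then have "V (\<lambda>y. left_step y * ?e y) \<in> \<real>"
    using real_lim_sequentially[OF lim] by blast
  then show ?thesis unfolding laplace_eq_pairing[OF x'] pairing_def .
qed

end

theorem theorem3p2:
  fixes Y :: functional and N :: nat and c d :: "nat \<Rightarrow> real"
  assumes "pseudo_passive_causal_slow_growth Y"
    and "pseudo_passivity Y N c d"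
  shows "(\<forall>s. Re s > 0 \<longrightarrow> laplace_exists Y s) \<and>
    laplace Y holomorphic_on {s. Re s > 0} \<and>
    (\<forall>s. Re s > 0 \<longrightarrow>
       Re (laplace Y s) \<ge> (\<Sum>j\<le>N. norm s ^ (2 * j) * (c j + (norm (laplace Y s))\<^sup>2 * d j))) \<and>
    (real_operator Y \<longrightarrow> (\<forall>x::real. x > 0 \<longrightarrow> laplace Y (of_real x) \<in> \<real>))"
proof -
  have "tempered Y" and supp: "dist_supp Y \<subseteq> {0..}"
    using assms(1) unfolding pseudo_passive_causal_slow_growth_def by blast+
  then obtain V where "V \<in> tempered_functionals" "restrict V test_functions = Y"
    unfolding tempered_def by blast
  then interpret causal_tempered Y V
    using supp by unfold_locales
  have "laplace_exists Y s" if "Re s > 0" for s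
    unfolding laplace_exists_def
    using laplace_abscissa_0 that bdd_below_mono[OF bdd_below_Ici supp] by blast
  then show ?thesis
    using laplace_holomorphic passivity_limit[OF assms(2)] laplace_real by blast
qed

end
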